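(* Let $k$ be a finite field and let $\mathcal{C}$ be a $k$-additive triangulated category with translation $[1]$ such that: (1) $\mathrm{Hom}(X,Y)$ is a finite dimensional $k$-space for all objects $X,Y$; (2) $\mathrm{End}\,X$ is a finite dimensional local $k$-algebra for every indecomposable object $X$; (3) $\sum_{i\ge 0}\dim_k\mathrm{Hom}(X[i],Y)<\infty$ for all objects $X,Y$. For all $Z,L,M\in\mathcal{C}$ the following equalities hold: $$\frac{|\mathrm{Hom}(M,L)_{Z[1]}|}{|\mathrm{Aut}\,L|}\cdot\frac{\{M,L\}}{\{Z,L\}\cdot\{L,L\}}=\sum_{\alpha\in V(Z,L;M)}\frac{|\mathrm{End}\,L_1(\alpha)|}{|\mathrm{Aut}\,L_1(\alpha)|},$$ $$\frac{|\mathrm{Hom}(Z,M)_{L}|}{|\mathrm{Aut}\,Z|}\cdot\frac{\{Z,M\}}{\{Z,L\}\cdot\{Z,Z\}}=\sum_{\alpha\in V(Z,L;M)}\frac{|\mathrm{End}\,L_1(\alpha)|}{|\mathrm{Aut}\,L_1(\alpha)|}.$$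
   Context: Conventions: $fg$ denotes the composition of $f:X\to Y$ followed by $g:Y\to Z$; "triangle" means distinguished triangle; $|A|$ is the cardinality of a finite set $A$. Conditions (1) and (2) imply that the Krull-Schmidt theorem holds in $\mathcal{C}$. For $X,Y\in\mathcal{C}$, $\{X,Y\}=\prod_{i>0}|\mathrm{Hom}(X[i],Y)|^{(-1)^{i}}$. $\mathrm{Hom}(X,Y)_{C}$ is the set of morphisms $X\to Y$ whose cone is isomorphic to $C$. $W(Z,L;M)$ is the set of triples $(l,m,n)\in\mathrm{Hom}(Z,M)\times\mathrm{Hom}(M,L)\times\mathrm{Hom}(L,Z[1])$ such that $Z\xrightarrow{l}M\xrightarrow{m}L\xrightarrow{n}Z[1]$ is a triangle. The group $\mathrm{Aut}\,Z\times\mathrm{Aut}\,L$ acts on it by $(d,b)\cdot(l,m,n)=(dl,\,mb^{-1},\,bn(d[1])^{-1})$, and $V(Z,L;M)$ is the set of orbits $(l,m,n)^{\wedge}$. The radical $\mathrm{radHom}(X,Y)$ is the set of $f\in\mathrm{Hom}(X,Y)$ such that $gfh$ is not an isomorphism for any $g:A\to X$, $h:Y\to A$ with $A$ indecomposable. For $\alpha=(l,m,n)^{\wedge}\in V(Z,L;M)$ there are decompositions $L=L_1(\alpha)\oplus L_2(\alpha)$, $Z=Z_1(\alpha)\oplus Z_2(\alpha)$ and automorphisms $b\in\mathrm{Aut}\,L$, $d\in\mathrm{Aut}\,Z$ such that $bn(d[1])^{-1}=\begin{pmatrix}n_{11}&0\\0&n_{22}\end{pmatrix}$ with $n_{11}:L_1(\alpha)\to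 Z_1(\alpha)[1]$ an isomorphism and $n_{22}\in\mathrm{radHom}(L_2(\alpha),Z_2(\alpha)[1])$. The isomorphism class of $L_1(\alpha)$ depends only on $\alpha$. *)

theory Defs
  imports
    "HOL-Algebra.Ideal"
    "HOL-Analysis.Infinite_Products"
    "Jordan_Normal_Form.Missing_VectorSpace"
begin

text \<open>
  A linear category with a translation and a family of candidate triangles. Objects are the
  elements of a type, and each \<open>Hom C X Y\<close> is a vector space given as a HOL-Algebra module record
  (its multiplicative fields are irrelevant). Different Hom sets need not be disjoint, so a morphism
  is always used together with its source and target. Composition is diagrammatic:
  \<open>f \<Zsemi> g\<close> is \<open>f\<close> followed by \<open>g\<close>. \<open>Tri C X Y Z f g h\<close> says that
  X --f--> Y --g--> Z --h--> X[1] is a distinguished triangle.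
\<close>

record ('k, 'o, 'm) translation_category =
  Hom :: "'o \<Rightarrow> 'o \<Rightarrow> ('k, 'm) module"
  Comp :: "'m \<Rightarrow> 'm \<Rightarrow> 'm"  (infixl \<open>\<Zsemi>\<index>\<close> 75)
  Ident :: "'o \<Rightarrow> 'm"
  Sh :: "'o \<Rightarrow> 'o"
  Shm :: "'m \<Rightarrow> 'm"
  Tri :: "'o \<Rightarrow> 'o \<Rightarrow> 'o \<Rightarrow> 'm \<Rightarrow> 'm \<Rightarrow> 'm \<Rightarrow> bool"

abbreviation Mor :: "('k, 'o, 'm, 'z) translation_category_scheme \<Rightarrow> 'o \<Rightarrow> 'o \<Rightarrow> 'm set"
  where "Mor C X Y \<equiv> carrier (Hom C X Y)"

definition inverse_mor ::
    "('k, 'o, 'm, 'z) translation_category_scheme \<Rightarrow> 'o \<Rightarrow> 'o \<Rightarrow> 'm \<Rightarrow> 'm \<Rightarrow> bool"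
  where "inverse_mor C X Y f g \<longleftrightarrow>
    f \<in> Mor C X Y \<and> g \<in> Mor C Y X \<and> f \<Zsemi>\<^bsub>C\<^esub> g = Ident C X \<and> g \<Zsemi>\<^bsub>C\<^esub> f = Ident C Y"

definition is_iso :: "('k, 'o, 'm, 'z) translation_category_scheme \<Rightarrow> 'o \<Rightarrow> 'o \<Rightarrow> 'm \<Rightarrow> bool"
  where "is_iso C X Y f \<longleftrightarrow> (\<exists>g. inverse_mor C X Y f g)"

definition inv_mor :: "('k, 'o, 'm, 'z) translation_category_scheme \<Rightarrow> 'o \<Rightarrow> 'o \<Rightarrow> 'm \<Rightarrow> 'm"
  where "inv_mor C X Y f = (THE g. inverse_mor C X Y f g)"

definition isomorphic :: "('k, 'o, 'm, 'z) translation_category_scheme \<Rightarrow> 'o \<Rightarrow> 'o \<Rightarrow> bool"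
  where "isomorphic C X Y \<longleftrightarrow> (\<exists>f. is_iso C X Y f)"

definition Aut :: "('k, 'o, 'm, 'z) translation_category_scheme \<Rightarrow> 'o \<Rightarrow> 'm set"
  where "Aut C X = {f. is_iso C X X f}"

definition End_ring :: "('k, 'o, 'm, 'z) translation_category_scheme \<Rightarrow> 'o \<Rightarrow> 'm ring"
  where "End_ring C X =
    \<lparr>carrier = Mor C X X, monoid.mult = Comp C, one = Ident C X,
     zero = \<zero>\<^bsub>Hom C X X\<^esub>, add = (\<oplus>\<^bsub>Hom C X X\<^esub>)\<rparr>"

text \<open>A not necessarily commutative ring is local if its non-units form a (two-sided) ideal. This
  forces the ring to be nonzero, since in the zero ring the set of non-units is empty.\<close>

definition local_ring :: "('a, 'b) ring_scheme \<Rightarrow> bool"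
  where "local_ring R \<longleftrightarrow> ring R \<and> ideal (carrier R - Units R) R"

definition zero_object :: "('k, 'o, 'm, 'z) translation_category_scheme \<Rightarrow> 'o \<Rightarrow> bool"
  where "zero_object C U \<longleftrightarrow>
    (\<forall>X. Mor C X U = {\<zero>\<^bsub>Hom C X U\<^esub>} \<and> Mor C U X = {\<zero>\<^bsub>Hom C U X\<^esub>})"

text \<open>\<open>X = A \<oplus> B\<close> with injections \<open>i\<close>, \<open>j\<close> and projections \<open>p\<close>, \<open>q\<close>.\<close>

definition biproduct :: "('k, 'o, 'm, 'z) translation_category_scheme \<Rightarrow>
    'o \<Rightarrow> 'o \<Rightarrow> 'o \<Rightarrow> 'm \<Rightarrow> 'm \<Rightarrow> 'm \<Rightarrow> 'm \<Rightarrow> bool"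
  where "biproduct C X A B i j p q \<longleftrightarrow>
    i \<in> Mor C A X \<and> j \<in> Mor C B X \<and> p \<in> Mor C X A \<and> q \<in> Mor C X B \<and>
    i \<Zsemi>\<^bsub>C\<^esub> p = Ident C A \<and> j \<Zsemi>\<^bsub>C\<^esub> q = Ident C B \<and>
    i \<Zsemi>\<^bsub>C\<^esub> q = \<zero>\<^bsub>Hom C A B\<^esub> \<and> j \<Zsemi>\<^bsub>C\<^esub> p = \<zero>\<^bsub>Hom C B A\<^esub> \<and>
    (p \<Zsemi>\<^bsub>C\<^esub> i) \<oplus>\<^bsub>Hom C X X\<^esub> (q \<Zsemi>\<^bsub>C\<^esub> j) = Ident C X"

definition indecomposable :: "('k, 'o, 'm, 'z) translation_category_scheme \<Rightarrow> 'o \<Rightarrow> bool"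
  where "indecomposable C X \<longleftrightarrow> \<not> zero_object C X \<and>
    (\<forall>A B i j p q. biproduct C X A B i j p q \<longrightarrow> zero_object C A \<or> zero_object C B)"

locale linear_category =
  fixes K and C (structure)
  assumes Hom_vectorspace: "vectorspace K (Hom C X Y)"
    and Id_closed: "Ident C X \<in> Mor C X X"
    and Comp_linear_right:
      "f \<in> Mor C X Y \<Longrightarrow> (\<lambda>g. f \<Zsemi> g) \<in> module_hom K (Hom C Y Z) (Hom C X Z)"
    and Comp_linear_left:
      "g \<in> Mor C Y Z \<Longrightarrow> (\<lambda>f. f \<Zsemi> g) \<in> module_hom K (Hom C X Y) (Hom C X Z)"
    and Id_left: "f \<in> Mor C X Y \<Longrightarrow> Ident C X \<Zsemi> f = f"
    and Id_right: "f \<in> Mor C X Y \<Longrightarrow> f \<Zsemi> Ident C Y = f"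
    and Comp_assoc:
      "\<lbrakk>f \<in> Mor C W X; g \<in> Mor C X Y; h \<in> Mor C Y Z\<rbrakk> \<Longrightarrow> (f \<Zsemi> g) \<Zsemi> h = f \<Zsemi> (g \<Zsemi> h)"

locale additive_linear_category = linear_category +
  assumes zero_object_exists: "\<exists>U. zero_object C U"
    and biproduct_exists: "\<exists>X i j p q. biproduct C X A B i j p q"

text \<open>The translation is a linear auto-equivalence; it need not be an automorphism.\<close>

locale translation_linear_category = additive_linear_category +
  assumes Shm_linear: "Shm C \<in> module_hom K (Hom C X Y) (Hom C (Sh C X) (Sh C Y))"
    and Shm_Id: "Shm C (Ident C X) = Ident C (Sh C X)"
    and Shm_Comp:
      "\<lbrakk>f \<in> Mor C X Y; g \<in> Mor C Y Z\<rbrakk> \<Longrightarrow> Shm C (f \<Zsemi> g) = Shm C f \<Zsemi> Shm C g"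
    and Shm_fully_faithful: "bij_betw (Shm C) (Mor C X Y) (Mor C (Sh C X) (Sh C Y))"
    and Sh_essentially_surjective: "\<exists>X. isomorphic C (Sh C X) Y"

locale triangulated_linear_category = translation_linear_category +
  assumes Tri_closed:
      "Tri C X Y Z f g h \<Longrightarrow> f \<in> Mor C X Y \<and> g \<in> Mor C Y Z \<and> h \<in> Mor C Z (Sh C X)"
    and Tri_isomorphic:
      "\<lbrakk>Tri C X Y Z f g h;
        f' \<in> Mor C X' Y'; g' \<in> Mor C Y' Z'; h' \<in> Mor C Z' (Sh C X');
        is_iso C X X' a; is_iso C Y Y' b; is_iso C Z Z' c;
        f \<Zsemi> b = a \<Zsemi> f'; g \<Zsemi> c = b \<Zsemi> g'; h \<Zsemi> Shm C a = c \<Zsemi> h'\<rbrakk>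
       \<Longrightarrow> Tri C X' Y' Z' f' g' h'"
    and Tri_Id:
      "zero_object C U \<Longrightarrow>
        Tri C X X U (Ident C X) \<zero>\<^bsub>Hom C X U\<^esub> \<zero>\<^bsub>Hom C U (Sh C X)\<^esub>"
    and Tri_cone: "f \<in> Mor C X Y \<Longrightarrow> \<exists>Z g h. Tri C X Y Z f g h"
    and Tri_rotate:
      "\<lbrakk>f \<in> Mor C X Y; g \<in> Mor C Y Z; h \<in> Mor C Z (Sh C X)\<rbrakk> \<Longrightarrow>
        Tri C X Y Z f g h \<longleftrightarrow> Tri C Y Z (Sh C X) g h (\<ominus>\<^bsub>Hom C (Sh C X) (Sh C Y)\<^esub> Shm C f)"
    and Tri_morphism:
      "\<lbrakk>Tri C X Y Z f g h; Tri C X' Y' Z' f' g' h';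
        a \<in> Mor C X X'; b \<in> Mor C Y Y'; f \<Zsemi> b = a \<Zsemi> f'\<rbrakk>
       \<Longrightarrow> \<exists>c \<in> Mor C Z Z'. g \<Zsemi> c = b \<Zsemi> g' \<and> h \<Zsemi> Shm C a = c \<Zsemi> h'"
    and Tri_octahedral:
      "\<lbrakk>Tri C X Y Z' f u u'; Tri C Y Z X' g v v'; Tri C X Z Y' (f \<Zsemi> g) w w'\<rbrakk>
       \<Longrightarrow> \<exists>a b. Tri C Z' Y' X' a b (v' \<Zsemi> Shm C u) \<and>
             u \<Zsemi> a = g \<Zsemi> w \<and> a \<Zsemi> w' = u' \<and> w \<Zsemi> b = v \<and> b \<Zsemi> v' = w' \<Zsemi> Shm C f"

text \<open>\<open>{X, Y}\<close>; the product over positive \<open>i\<close> is indexed by \<open>Suc i\<close>.\<close>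

definition brace :: "('k, 'o, 'm, 'z) translation_category_scheme \<Rightarrow> 'o \<Rightarrow> 'o \<Rightarrow> real"
  where "brace C X Y =
    (\<Prod>i. real (card (Mor C ((Sh C ^^ Suc i) X) Y)) powi ((- 1) ^ Suc i))"

text \<open>\<open>Hom(X,Y)\<^sub>D\<close>: the morphisms from \<open>X\<close> to \<open>Y\<close> whose cone is isomorphic to \<open>D\<close>.\<close>

definition Mor_cone :: "('k, 'o, 'm, 'z) translation_category_scheme \<Rightarrow> 'o \<Rightarrow> 'o \<Rightarrow> 'o \<Rightarrow> 'm set"
  where "Mor_cone C X Y D =
    {f \<in> Mor C X Y. \<exists>E g h. Tri C X Y E f g h \<and> isomorphic C E D}"

definition triangle_triples ::
    "('k, 'o, 'm, 'z) translation_category_scheme \<Rightarrow> 'o \<Rightarrow> 'o \<Rightarrow> 'o \<Rightarrow> ('m \<times> 'm \<times> 'm) set"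
  where "triangle_triples C Z L M =
    {(l, m, n). l \<in> Mor C Z M \<and> m \<in> Mor C M L \<and> n \<in> Mor C L (Sh C Z) \<and> Tri C Z M L l m n}"

definition twist :: "('k, 'o, 'm, 'z) translation_category_scheme \<Rightarrow> 'o \<Rightarrow> 'o \<Rightarrow> 'm \<Rightarrow> 'm \<Rightarrow> 'm \<Rightarrow> 'm"
  where "twist C Z L d b n = b \<Zsemi>\<^bsub>C\<^esub> n \<Zsemi>\<^bsub>C\<^esub> inv_mor C (Sh C Z) (Sh C Z) (Shm C d)"

definition triple_orbit :: "('k, 'o, 'm, 'z) translation_category_scheme \<Rightarrow> 'o \<Rightarrow> 'o \<Rightarrow>
    'm \<times> 'm \<times> 'm \<Rightarrow> ('m \<times> 'm \<times> 'm) set"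
  where "triple_orbit C Z L = (\<lambda>(l, m, n).
    {(d \<Zsemi>\<^bsub>C\<^esub> l, m \<Zsemi>\<^bsub>C\<^esub> inv_mor C L L b, twist C Z L d b n) | d b. d \<in> Aut C Z \<and> b \<in> Aut C L})"

definition triangle_orbits :: "('k, 'o, 'm, 'z) translation_category_scheme \<Rightarrow> 'o \<Rightarrow> 'o \<Rightarrow> 'o \<Rightarrow>
    ('m \<times> 'm \<times> 'm) set set"
  where "triangle_orbits C Z L M = triple_orbit C Z L ` triangle_triples C Z L M"

definition radHom :: "('k, 'o, 'm, 'z) translation_category_scheme \<Rightarrow> 'o \<Rightarrow> 'o \<Rightarrow> 'm set"
  where "radHom C X Y =
    {f \<in> Mor C X Y. \<forall>A g h. indecomposable C A \<and> g \<in> Mor C A X \<and> h \<in> Mor C Y A \<longrightarrow>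
       \<not> is_iso C A A (g \<Zsemi>\<^bsub>C\<^esub> f \<Zsemi>\<^bsub>C\<^esub> h)}"

text \<open>
  \<open>diag_form C Z L n L1\<close>: there are decompositions \<open>L = L1 \<oplus> L2\<close>, \<open>Z = Z1 \<oplus> Z2\<close> and
  automorphisms \<open>b\<close>, \<open>d\<close> for which \<open>b n (d[1])\<^sup>-\<^sup>1\<close> is the block-diagonal matrix with entries
  an isomorphism \<open>n11\<close> from \<open>L1\<close> to \<open>Z1[1]\<close> and a radical morphism \<open>n22\<close> from \<open>L2\<close> to \<open>Z2[1]\<close>.
  The decomposition of \<open>Z[1]\<close> is the translate of that of \<open>Z\<close>.
\<close>

definition diag_form ::
    "('k, 'o, 'm, 'z) translation_category_scheme \<Rightarrow> 'o \<Rightarrow> 'o \<Rightarrow> 'm \<Rightarrow> 'o \<Rightarrow> bool"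
  where "diag_form C Z L n L1 \<longleftrightarrow>
    (\<exists>L2 Z1 Z2 i1 i2 p1 p2 j1 j2 q1 q2 b d n11 n22.
       biproduct C L L1 L2 i1 i2 p1 p2 \<and> biproduct C Z Z1 Z2 j1 j2 q1 q2 \<and>
       b \<in> Aut C L \<and> d \<in> Aut C Z \<and>
       is_iso C L1 (Sh C Z1) n11 \<and> n22 \<in> radHom C L2 (Sh C Z2) \<and>
       twist C Z L d b n =
         (p1 \<Zsemi>\<^bsub>C\<^esub> n11 \<Zsemi>\<^bsub>C\<^esub> Shm C j1) \<oplus>\<^bsub>Hom C L (Sh C Z)\<^esub> (p2 \<Zsemi>\<^bsub>C\<^esub> n22 \<Zsemi>\<^bsub>C\<^esub> Shm C j2))"

text \<open>\<open>L\<^sub>1(\<alpha>)\<close> is defined up to isomorphism only; a representative is chosen.\<close>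

definition L_one ::
    "('k, 'o, 'm, 'z) translation_category_scheme \<Rightarrow> 'o \<Rightarrow> 'o \<Rightarrow> ('m \<times> 'm \<times> 'm) set \<Rightarrow> 'o"
  where "L_one C Z L \<alpha> = (SOME L1. \<exists>(l, m, n) \<in> \<alpha>. diag_form C Z L n L1)"

end

theory Submission
  imports Defs
begin

text \<open>
  Forgetting \<open>l\<close> identifies the orbits of triangles with the orbits of \<open>Aut L\<close> on
  \<open>Hom(M,L)\<close> restricted to cone \<open>Z[1]\<close>, and forgetting \<open>m\<close> and \<open>n\<close> identifies them with the
  orbits of \<open>Aut Z\<close> on \<open>Hom(Z,M)\<close> restricted to cone \<open>L\<close>. By exactness the stabilizer of \<open>m\<close>
  consists of the invertible \<open>1 + nx\<close>, and that of \<open>l\<close>, after translation, of the invertible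
  \<open>1 + xn\<close>, where \<open>x\<close> runs through \<open>Hom(Z[1],L)\<close>. For block-diagonal \<open>n\<close> the radical block does
  not affect invertibility, so the proportion of \<open>x\<close> with \<open>1 + nx\<close> invertible is
  \<open>|Aut L\<^sub>1| / |End L\<^sub>1|\<close>. The orders of the images of \<open>Hom(Z[1],L)\<close> under composition with
  \<open>n\<close> follow from the long exact sequences, which terminate by the finiteness condition, and
  are the quotients of braces in the statement.
\<close>


text \<open>Both equalities have the same right-hand side because one number governs them: the
  number \<open>N\<close> of \<open>x\<close> in \<open>Hom(Z[1],L)\<close> with
  \<open>1 + nx\<close> invertible. If composition with \<open>n\<close> on one side has kernel of
  order \<open>k\<close> and image of order \<open>I\<close>, the corresponding stabilizer has order
  \<open>N / k\<close>, while \<open>|Hom(Z[1],L)| = k I\<close>. Orbit size times \<open>I\<close>,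
  divided by the order of the acting group, is therefore \<open>|Hom(Z[1],L)| / N\<close> on either
  side, and this is the weight \<open>|End L1| / |Aut L1|\<close> of an orbit; \<open>I\<close> is
  the factor formed from braces. And the translation comes without a chosen inverse, so in place of
  negative translates a morphism is moved to the translated objects, where exactness applies, and
  brought back by full faithfulness.\<close>

section \<open>Counting in finite groups, vector spaces and quotients\<close>

lemma card_hom_preimage:
  assumes "abelian_group A" "abelian_group B" and "finite (carrier A)"
    and maps: "\<And>x. x \<in> carrier A \<Longrightarrow> f x \<in> carrier B"
    and additive: "\<And>x y. x \<in> carrier A \<Longrightarrow> y \<in> carrier A \<Longrightarrow> f (x \<oplus>\<^bsub>A\<^esub> y) = f x \<oplus>\<^bsub>B\<^esub> f y"
    and S: "S \<subseteq> f ` carrier A"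
  shows "card {x \<in> carrier A. f x \<in> S} = card S * card {x \<in> carrier A. f x = \<zero>\<^bsub>B\<^esub>}"
proof -
  interpret A: abelian_group A by fact
  interpret B: abelian_group B by fact
  interpret f: group_hom "add_monoid A" "add_monoid B" f
    by unfold_locales (auto simp: hom_def maps additive)
  define N where "N = {x \<in> carrier A. f x = \<zero>\<^bsub>B\<^esub>}"
  \<comment> \<open>A nonempty fibre is a coset of the kernel \<open>N\<close>: translation by any
    preimage \<open>a\<close> of \<open>y\<close> identifies the two.\<close>
  have fibre: "card {x \<in> carrier A. f x = y} = card N" if "y \<in> S" for y
  proof -
    from that S obtain a where a: "a \<in> carrier A" "y = f a" by auto
    have fneg: "f (\<ominus>\<^bsub>A\<^esub> x) = \<ominus>\<^bsub>B\<^esub> f x" if "x \<in> carrier A" for x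
      using f.hom_inv that by (simp add: a_inv_def)
    have "bij_betw (\<lambda>x. x \<oplus>\<^bsub>A\<^esub> a) N {x \<in> carrier A. f x = f a}"
    proof (rule bij_betwI[where g = "\<lambda>x. x \<oplus>\<^bsub>A\<^esub> (\<ominus>\<^bsub>A\<^esub> a)"])
      show "(\<lambda>x. x \<oplus>\<^bsub>A\<^esub> a) \<in> N \<rightarrow> {x \<in> carrier A. f x = f a}"
        unfolding N_def using a(1) by (simp add: Pi_iff additive maps)
      show "(\<lambda>x. x \<oplus>\<^bsub>A\<^esub> (\<ominus>\<^bsub>A\<^esub> a)) \<in> {x \<in> carrier A. f x = f a} \<rightarrow> N"
        unfolding N_def using a(1) by (simp add: Pi_iff additive maps fneg B.r_neg)
    qed (use a(1) in \<open>simp_all add: N_def A.a_assoc A.r_neg A.l_neg\<close>)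
    then show ?thesis using a(2) by (simp add: bij_betw_same_card)
  qed
  have "{x \<in> carrier A. f x \<in> S} = (\<Union>y\<in>S. {x \<in> carrier A. f x = y})" by auto
  moreover have "finite S" using S assms(3) finite_surj by blast
  ultimately have "card {x \<in> carrier A. f x \<in> S} = (\<Sum>y\<in>S. card {x \<in> carrier A. f x = y})"
    using assms(3) by (simp add: card_UN_disjoint disjoint_iff)
  also have "\<dots> = card S * card N" using fibre by simp
  finally show ?thesis by (simp add: N_def)
qed

corollary card_hom_image_kernel:
  assumes "abelian_group A" "abelian_group B" and "finite (carrier A)"
    and maps: "\<And>x. x \<in> carrier A \<Longrightarrow> f x \<in> carrier B"
    and additive: "\<And>x y. x \<in> carrier A \<Longrightarrow> y \<in> carrier A \<Longrightarrow> f (x \<oplus>\<^bsub>A\<^esub> y) = f x \<oplus>\<^bsub>B\<^esub> f y"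
  shows "card (carrier A) = card (f ` carrier A) * card {x \<in> carrier A. f x = \<zero>\<^bsub>B\<^esub>}"
proof -
  have "{x \<in> carrier A. f x \<in> f ` carrier A} = carrier A" by auto
  then show ?thesis using card_hom_preimage[OF assms, of "f ` carrier A"] by simp
qed

text \<open>A finite generating set and finitely many scalars leave finitely many coefficient
  functions, once these are restricted to the generating set.\<close>

lemma (in vectorspace) finite_carrier:
  assumes "finite (carrier K)" "fin_dim"
  shows "finite (carrier V)"
proof -
  obtain A where A: "finite A" "A \<subseteq> carrier V" "gen_set A"
    using assms(2) unfolding fin_dim_def by blast
  have "span A \<subseteq> (\<lambda>a. lincomb a A) ` (A \<rightarrow>\<^sub>E carrier K)"
  proof
    fix v assume "v \<in> span A"
    then obtain a where a: "a \<in> A \<rightarrow> carrier K" "v = lincomb a A"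
      using finite_span[OF A(1,2)] by blast
    have "v = lincomb (restrict a A) A"
      unfolding a(2) lincomb_def using a(1) A(2) by (intro finsum_cong') (auto simp: Pi_iff subset_iff)
    with a(1) show "v \<in> (\<lambda>a. lincomb a A) ` (A \<rightarrow>\<^sub>E carrier K)"
      by (intro image_eqI[where x = "restrict a A"]) auto
  qed
  moreover have "finite (A \<rightarrow>\<^sub>E carrier K)" using A(1) assms(1) by (intro finite_PiE) auto
  ultimately show ?thesis using A(3) finite_subset by fastforce
qed

text \<open>\<open>dim\<close> is the least size of a finite generating set. Finite dimensionality
  makes this minimum attained, so dimension 0 means that the empty set generates.\<close>

lemma (in vectorspace) dim_0_carrier:
  assumes "fin_dim" "dim = 0"
  shows "carrier V = {\<zero>\<^bsub>V\<^esub>}"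
proof -
  have "\<exists>n A. finite A \<and> card A = n \<and> A \<subseteq> carrier V \<and> gen_set A"
    using assms(1) unfolding fin_dim_def by blast
  from LeastI_ex[OF this] have "gen_set {}"
    using assms(2) unfolding dim_def by auto
  then show ?thesis by (simp add: span_empty)
qed

text \<open>The terms tend to 0, and a natural number below 1 is 0. Applied to dimensions, this
  turns condition (3) into the vanishing of \<open>Hom(X[i],Y)\<close> for large
  \<open>i\<close>.\<close>

lemma summable_nat_eventually_zero:
  fixes d :: "nat \<Rightarrow> nat"
  assumes "summable (\<lambda>i. real (d i))"
  shows "\<exists>N. \<forall>i\<ge>N. d i = 0"
proof -
  have "(\<lambda>i. real (d i)) \<longlonglongrightarrow> 0" using assms by (rule summable_LIMSEQ_zero)
  from LIMSEQ_D[OF this, of 1] obtain N where "\<forall>i\<ge>N. norm (real (d i) - 0) < 1" by auto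
  then show ?thesis by (intro exI[of _ N]) auto
qed

lemma card_eq_card_image_times_fibre:
  assumes "finite A" and "\<And>y. y \<in> f ` A \<Longrightarrow> card {x \<in> A. f x = y} = k"
  shows "card A = card (f ` A) * k"
proof -
  have "A = (\<Union>y\<in>f ` A. {x \<in> A. f x = y})" by auto
  also have "card \<dots> = (\<Sum>y\<in>f ` A. card {x \<in> A. f x = y})"
    using assms(1) by (intro card_UN_disjoint) auto
  finally show ?thesis using assms(2) by simp
qed

text \<open>Since \<open>f\<close> identifies equivalent elements only, distinct classes have
  disjoint images. With \<open>f\<close> a projection of triangles, this cuts a set of morphisms
  with prescribed cone into one piece per orbit.\<close>

lemma card_image_eq_sum_quotient:
  assumes "equiv A r" "finite A" and "\<And>x y. x \<in> A \<Longrightarrow> y \<in> A \<Longrightarrow> f x = f y \<Longrightarrow> (x, y) \<in> r"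
  shows "card (f ` A) = (\<Sum>\<alpha>\<in>A // r. card (f ` \<alpha>))"
proof -
  have sub: "\<alpha> \<subseteq> A" if "\<alpha> \<in> A // r" for \<alpha>
    using that Union_quotient[OF assms(1)] by blast
  have "f ` A = (\<Union>\<alpha>\<in>A // r. f ` \<alpha>)"
    using Union_quotient[OF assms(1)] by blast
  also have "card \<dots> = (\<Sum>\<alpha>\<in>A // r. card (f ` \<alpha>))"
  proof (rule card_UN_disjoint)
    show "finite (A // r)" using assms(1,2) by (intro finite_quotient) (auto simp: equiv_def refl_on_def)
    show "\<forall>\<alpha>\<in>A // r. finite (f ` \<alpha>)" using sub assms(2) finite_subset by blast
    show "\<forall>\<alpha>\<in>A // r. \<forall>\<beta>\<in>A // r. \<alpha> \<noteq> \<beta> \<longrightarrow> f ` \<alpha> \<inter> f ` \<beta> = {}"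
    proof (intro ballI impI, rule ccontr)
      fix \<alpha> \<beta> assume *: "\<alpha> \<in> A // r" "\<beta> \<in> A // r" "\<alpha> \<noteq> \<beta>" "f ` \<alpha> \<inter> f ` \<beta> \<noteq> {}"
      then obtain x y where "x \<in> \<alpha>" "y \<in> \<beta>" "f x = f y" by blast
      moreover from this have "(x, y) \<in> r" using assms(3) sub * by blast
      ultimately have "\<alpha> = \<beta>" using quotient_eq_iff[OF assms(1) *(1,2)] by blast
      with * show False by simp
    qed
  qed
  finally show ?thesis .
qed

text \<open>Arithmetic for one orbit: \<open>a\<close> is the order of the acting automorphism
  group, \<open>c\<close> and \<open>s\<close> those of orbit and stabilizer, \<open>e\<close> and
  \<open>u\<close> those of \<open>End L1\<close> and \<open>Aut L1\<close>, and \<open>i\<close>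
  that of the image of composition with \<open>n\<close>, known as a quotient \<open>B\<close> of
  braces.\<close>

lemma orbit_stabilizer_ratio:
  fixes a :: nat
  assumes "a = c * s" "s * e = u * i" "real i = B" "a > 0" "u > 0"
  shows "real c / real a * B = real e / real u"
proof -
  have "c > 0" "s > 0" using assms(1,4) by auto
  moreover have "real s * real e = real u * B" using assms(2,3) by (metis of_nat_mult)
  ultimately show ?thesis using assms(1,5) by (simp add: field_simps)
qed

section \<open>Isomorphisms, radical morphisms and biproducts in a linear category\<close>

context linear_category
begin

sublocale Hom: abelian_group "Hom C X Y" for X Y
proof -
  interpret vectorspace K "Hom C X Y" by (rule Hom_vectorspace)
  show "abelian_group (Hom C X Y)" by unfold_locales
qed

lemma comp_closed [intro]:
  "\<lbrakk>f \<in> Mor C X Y; g \<in> Mor C Y Z\<rbrakk> \<Longrightarrow> f \<Zsemi> g \<in> Mor C X Z"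
  using Comp_linear_right[of f X Y Z] by (auto simp: module_hom_def)

lemma comp_add_right:
  "\<lbrakk>f \<in> Mor C X Y; g \<in> Mor C Y Z; h \<in> Mor C Y Z\<rbrakk> \<Longrightarrow>
    f \<Zsemi> (g \<oplus>\<^bsub>Hom C Y Z\<^esub> h) = (f \<Zsemi> g) \<oplus>\<^bsub>Hom C X Z\<^esub> (f \<Zsemi> h)"
  using Comp_linear_right[of f X Y Z] by (auto simp: module_hom_def)

lemma comp_add_left:
  "\<lbrakk>f \<in> Mor C X Y; g \<in> Mor C X Y; h \<in> Mor C Y Z\<rbrakk> \<Longrightarrow>
    (f \<oplus>\<^bsub>Hom C X Y\<^esub> g) \<Zsemi> h = (f \<Zsemi> h) \<oplus>\<^bsub>Hom C X Z\<^esub> (g \<Zsemi> h)"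
  using Comp_linear_left[of h Y Z X] by (auto simp: module_hom_def)

lemma mod_hom_comp_right: "f \<in> Mor C X Y \<Longrightarrow> mod_hom K (Hom C Y Z) (Hom C X Z) (\<lambda>g. f \<Zsemi> g)"
  by (intro mod_hom.intro mod_hom_axioms.intro Comp_linear_right)
    (auto intro: vectorspace.axioms Hom_vectorspace)

lemma mod_hom_comp_left: "g \<in> Mor C Y Z \<Longrightarrow> mod_hom K (Hom C X Y) (Hom C X Z) (\<lambda>f. f \<Zsemi> g)"
  by (intro mod_hom.intro mod_hom_axioms.intro Comp_linear_left)
    (auto intro: vectorspace.axioms Hom_vectorspace)

lemmas comp_zero_right = mod_hom.f0_is_0[OF mod_hom_comp_right]

lemmas comp_zero_left = mod_hom.f0_is_0[OF mod_hom_comp_left]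

lemmas comp_neg_right = mod_hom.f_neg[OF mod_hom_comp_right]

lemmas comp_neg_left = mod_hom.f_neg[OF mod_hom_comp_left]

lemmas comp_minus_right = mod_hom.f_minus[OF mod_hom_comp_right]

lemmas comp_minus_left = mod_hom.f_minus[OF mod_hom_comp_left]

lemma is_isoI:
  "\<lbrakk>f \<in> Mor C X Y; g \<in> Mor C Y X; f \<Zsemi> g = Ident C X; g \<Zsemi> f = Ident C Y\<rbrakk> \<Longrightarrow> is_iso C X Y f"
  unfolding is_iso_def inverse_mor_def by blast

lemma is_isoE:
  assumes "is_iso C X Y f"
  obtains g where "f \<in> Mor C X Y" "g \<in> Mor C Y X" "f \<Zsemi> g = Ident C X" "g \<Zsemi> f = Ident C Y"
  using assms unfolding is_iso_def inverse_mor_def by blast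

lemma is_iso_closed: "is_iso C X Y f \<Longrightarrow> f \<in> Mor C X Y"
  by (erule is_isoE)

lemma inv_mor_eq:
  assumes "inverse_mor C X Y f g"
  shows "inv_mor C X Y f = g"
  unfolding inv_mor_def
proof (rule the_equality)
  show "inverse_mor C X Y f g" by fact
next
  fix h assume "inverse_mor C X Y f h"
  with assms show "h = g"
    unfolding inverse_mor_def by (metis Comp_assoc Id_left Id_right)
qed

lemma inverse_mor_inv_mor: "is_iso C X Y f \<Longrightarrow> inverse_mor C X Y f (inv_mor C X Y f)"
  unfolding is_iso_def using inv_mor_eq by blast

lemma is_iso_left_right:
  assumes "f \<in> Mor C X Y" "g \<in> Mor C Y X" "h \<in> Mor C Y X" "f \<Zsemi> g = Ident C X" "h \<Zsemi> f = Ident C Y"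
  shows "is_iso C X Y f"
proof -
  have "h = g" using assms by (metis Comp_assoc Id_left Id_right)
  then show ?thesis using assms by (intro is_isoI[of f X Y g]) simp_all
qed

lemma Id_Id [simp]: "Ident C X \<Zsemi> Ident C X = Ident C X"
  by (rule Id_left[OF Id_closed])

lemma is_iso_Ident: "is_iso C X X (Ident C X)"
  by (rule is_isoI[of _ _ _ "Ident C X"]) (simp_all add: Id_closed)

lemma comp_cancel_inverse:
  assumes "f \<in> Mor C X Y" "g \<in> Mor C Y X" "f \<Zsemi> g = Ident C X" "h \<in> Mor C X Z"
  shows "f \<Zsemi> (g \<Zsemi> h) = h"
  using assms by (metis Comp_assoc Id_left)

lemma is_iso_comp:
  assumes "is_iso C X Y f" "is_iso C Y Z g"
  shows "is_iso C X Z (f \<Zsemi> g)"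
proof -
  from assms(1) obtain f' where f: "f \<in> Mor C X Y" "f' \<in> Mor C Y X" "f \<Zsemi> f' = Ident C X" "f' \<Zsemi> f = Ident C Y"
    by (rule is_isoE)
  from assms(2) obtain g' where g: "g \<in> Mor C Y Z" "g' \<in> Mor C Z Y" "g \<Zsemi> g' = Ident C Y" "g' \<Zsemi> g = Ident C Z"
    by (rule is_isoE)
  show ?thesis
  proof (rule is_isoI[of _ _ _ "g' \<Zsemi> f'"])
    show "(f \<Zsemi> g) \<Zsemi> (g' \<Zsemi> f') = Ident C X"
      using f g by (simp add: Comp_assoc[of f X Y g Z "g' \<Zsemi> f'" X] comp_closed comp_cancel_inverse)
    show "(g' \<Zsemi> f') \<Zsemi> (f \<Zsemi> g) = Ident C Z"
      using f g by (simp add: Comp_assoc[of g' Z Y f' X "f \<Zsemi> g" Z] comp_closed comp_cancel_inverse)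
  qed (use f g in auto)
qed

lemma is_iso_inverse: "inverse_mor C X Y f g \<Longrightarrow> is_iso C Y X g"
  unfolding is_iso_def inverse_mor_def by blast

lemma Aut_iff: "f \<in> Aut C X \<longleftrightarrow> is_iso C X X f"
  by (simp add: Aut_def)

lemma inv_mor_Ident: "inv_mor C X X (Ident C X) = Ident C X"
  by (rule inv_mor_eq) (simp add: inverse_mor_def Id_closed Id_left)

text \<open>If \<open>u\<close> inverts \<open>1 + ab\<close>, then \<open>1 - bua\<close> inverts
  \<open>1 + ba\<close>. As \<open>a\<close> and \<open>b\<close> may connect different objects,
  this moves a question of invertibility from one object to another.\<close>

lemma is_iso_one_plus_swap:
  assumes a: "a \<in> Mor C X Y" and b: "b \<in> Mor C Y X"
    and iso: "is_iso C X X (Ident C X \<oplus>\<^bsub>Hom C X X\<^esub> (a \<Zsemi> b))"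
  shows "is_iso C Y Y (Ident C Y \<oplus>\<^bsub>Hom C Y Y\<^esub> (b \<Zsemi> a))"
proof -
  from iso obtain u where u: "u \<in> Mor C X X"
    "(Ident C X \<oplus>\<^bsub>Hom C X X\<^esub> (a \<Zsemi> b)) \<Zsemi> u = Ident C X"
    "u \<Zsemi> (Ident C X \<oplus>\<^bsub>Hom C X X\<^esub> (a \<Zsemi> b)) = Ident C X"
    by (rule is_isoE)
  have cl: "a \<Zsemi> b \<in> Mor C X X" "b \<Zsemi> a \<in> Mor C Y Y" "u \<Zsemi> a \<in> Mor C X Y" "b \<Zsemi> u \<in> Mor C Y X"
    "b \<Zsemi> (u \<Zsemi> a) \<in> Mor C Y Y" "(a \<Zsemi> b) \<Zsemi> u \<in> Mor C X X" "u \<Zsemi> (a \<Zsemi> b) \<in> Mor C X X"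
    "b \<Zsemi> ((a \<Zsemi> b) \<Zsemi> u) \<in> Mor C Y X" "b \<Zsemi> (u \<Zsemi> (a \<Zsemi> b)) \<in> Mor C Y X"
    "(b \<Zsemi> a) \<Zsemi> (b \<Zsemi> (u \<Zsemi> a)) \<in> Mor C Y Y" "(b \<Zsemi> (u \<Zsemi> a)) \<Zsemi> (b \<Zsemi> a) \<in> Mor C Y Y"
    using a b u(1) by (meson comp_closed)+
  define v where "v = Ident C Y \<ominus>\<^bsub>Hom C Y Y\<^esub> (b \<Zsemi> (u \<Zsemi> a))"
  have v: "v \<in> Mor C Y Y" using cl by (simp add: v_def Id_closed)
  have 1: "u \<oplus>\<^bsub>Hom C X X\<^esub> (a \<Zsemi> b) \<Zsemi> u = Ident C X"
    using u(2) comp_add_left[OF Id_closed cl(1) u(1)] Id_left[OF u(1)] by simp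
  have 2: "u \<oplus>\<^bsub>Hom C X X\<^esub> u \<Zsemi> (a \<Zsemi> b) = Ident C X"
    using u(3) comp_add_right[OF u(1) Id_closed cl(1)] Id_right[OF u(1)] by simp
  \<comment> \<open>The equation \<open>1\<close> is multiplied by \<open>b\<close> on the left and
    by \<open>a\<close> on the right; \<open>4\<close> arises from \<open>2\<close> in the same
    way.\<close>
  have "b \<Zsemi> a = (b \<Zsemi> (u \<oplus>\<^bsub>Hom C X X\<^esub> (a \<Zsemi> b) \<Zsemi> u)) \<Zsemi> a"
    using b by (simp add: 1 Id_right)
  also have "\<dots> = (b \<Zsemi> u) \<Zsemi> a \<oplus>\<^bsub>Hom C Y Y\<^esub> (b \<Zsemi> ((a \<Zsemi> b) \<Zsemi> u)) \<Zsemi> a"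
    using a b u cl by (simp add: comp_add_right[OF b] comp_add_left[OF _ _ a])
  also have "(b \<Zsemi> ((a \<Zsemi> b) \<Zsemi> u)) \<Zsemi> a = (b \<Zsemi> a) \<Zsemi> (b \<Zsemi> (u \<Zsemi> a))"
    using cl by (simp add: Comp_assoc[OF b _ a] Comp_assoc[OF a b] Comp_assoc[OF b a] Comp_assoc[OF cl(1) u(1) a]
        Comp_assoc[OF b u(1) a])
  finally have 3: "b \<Zsemi> (u \<Zsemi> a) \<oplus>\<^bsub>Hom C Y Y\<^esub> (b \<Zsemi> a) \<Zsemi> (b \<Zsemi> (u \<Zsemi> a)) = b \<Zsemi> a"
    using Comp_assoc[OF b u(1) a] by simp
  have "b \<Zsemi> a = (b \<Zsemi> (u \<oplus>\<^bsub>Hom C X X\<^esub> u \<Zsemi> (a \<Zsemi> b))) \<Zsemi> a"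
    using b by (simp add: 2 Id_right)
  also have "\<dots> = (b \<Zsemi> u) \<Zsemi> a \<oplus>\<^bsub>Hom C Y Y\<^esub> (b \<Zsemi> (u \<Zsemi> (a \<Zsemi> b))) \<Zsemi> a"
    using a b u cl by (simp add: comp_add_right[OF b] comp_add_left[OF _ _ a])
  also have "(b \<Zsemi> (u \<Zsemi> (a \<Zsemi> b))) \<Zsemi> a = (b \<Zsemi> (u \<Zsemi> a)) \<Zsemi> (b \<Zsemi> a)"
    using cl by (simp add: Comp_assoc[OF b _ a] Comp_assoc[OF u(1) _ a] Comp_assoc[OF a b a]
        Comp_assoc[OF b] Comp_assoc[OF u(1) a])
  finally have 4: "b \<Zsemi> (u \<Zsemi> a) \<oplus>\<^bsub>Hom C Y Y\<^esub> (b \<Zsemi> (u \<Zsemi> a)) \<Zsemi> (b \<Zsemi> a) = b \<Zsemi> a"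
    using Comp_assoc[OF b u(1) a] by simp
  \<comment> \<open>With \<open>x = bua\<close> and \<open>w = ba\<close>, this collapses both
    expanded products of \<open>1 + ba\<close> and \<open>v\<close>; the required
    \<open>x + z = w\<close> is \<open>3\<close> for one order of the factors and \<open>4\<close>
    for the other.\<close>
  have neg: "(Ident C Y \<ominus>\<^bsub>Hom C Y Y\<^esub> x) \<oplus>\<^bsub>Hom C Y Y\<^esub> (w \<ominus>\<^bsub>Hom C Y Y\<^esub> z) = Ident C Y"
    if "x \<in> Mor C Y Y" "z \<in> Mor C Y Y" "x \<oplus>\<^bsub>Hom C Y Y\<^esub> z = w" for x z w
    unfolding that(3)[symmetric] using that(1,2)
    by (simp add: Hom.minus_eq Hom.a_assoc Hom.r_neg Hom.l_neg Hom.r_neg1 Id_closed)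
  show ?thesis
  proof (rule is_isoI)
    have "(Ident C Y \<oplus>\<^bsub>Hom C Y Y\<^esub> b \<Zsemi> a) \<Zsemi> v =
      (Ident C Y \<ominus>\<^bsub>Hom C Y Y\<^esub> b \<Zsemi> (u \<Zsemi> a)) \<oplus>\<^bsub>Hom C Y Y\<^esub> (b \<Zsemi> a \<ominus>\<^bsub>Hom C Y Y\<^esub> (b \<Zsemi> a) \<Zsemi> (b \<Zsemi> (u \<Zsemi> a)))"
      using comp_add_left[OF Id_closed cl(2) v] comp_minus_right[OF cl(2) Id_closed cl(5)]
        Id_left[OF v] Id_right[OF cl(2)] by (simp add: v_def)
    then show "(Ident C Y \<oplus>\<^bsub>Hom C Y Y\<^esub> b \<Zsemi> a) \<Zsemi> v = Ident C Y"
      using neg[OF cl(5,10) 3] by simp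
    have "v \<Zsemi> (Ident C Y \<oplus>\<^bsub>Hom C Y Y\<^esub> b \<Zsemi> a) =
      (Ident C Y \<ominus>\<^bsub>Hom C Y Y\<^esub> b \<Zsemi> (u \<Zsemi> a)) \<oplus>\<^bsub>Hom C Y Y\<^esub> (b \<Zsemi> a \<ominus>\<^bsub>Hom C Y Y\<^esub> (b \<Zsemi> (u \<Zsemi> a)) \<Zsemi> (b \<Zsemi> a))"
      using comp_add_right[OF v Id_closed cl(2)] comp_minus_left[OF cl(2) Id_closed cl(5)]
        Id_right[OF v] Id_left[OF cl(2)] by (simp add: v_def)
    then show "v \<Zsemi> (Ident C Y \<oplus>\<^bsub>Hom C Y Y\<^esub> b \<Zsemi> a) = Ident C Y"
      using neg[OF cl(5,11) 4] by simp
  qed (use cl v in \<open>simp_all add: Id_closed\<close>)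
qed

text \<open>The sum \<open>w + x\<close> factors as \<open>w (1 + ux)\<close>.\<close>

lemma is_iso_add:
  assumes w: "inverse_mor C X X w u" and x: "x \<in> Mor C X X"
    and iso: "is_iso C X X (Ident C X \<oplus>\<^bsub>Hom C X X\<^esub> (u \<Zsemi> x))"
  shows "is_iso C X X (w \<oplus>\<^bsub>Hom C X X\<^esub> x)"
proof -
  have wu: "w \<in> Mor C X X" "u \<in> Mor C X X" "w \<Zsemi> u = Ident C X"
    using w by (auto simp: inverse_mor_def)
  have "w \<Zsemi> (Ident C X \<oplus>\<^bsub>Hom C X X\<^esub> (u \<Zsemi> x)) = w \<oplus>\<^bsub>Hom C X X\<^esub> x"
    using wu x comp_closed[OF wu(2) x]
    by (simp add: comp_add_right[OF wu(1)] comp_cancel_inverse[OF wu] Id_closed Id_right)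
  moreover have "is_iso C X X w" using w by (auto simp: is_iso_def)
  ultimately show ?thesis using is_iso_comp[OF _ iso, of X w] by simp
qed

lemma radHom_closed: "r \<in> radHom C X Y \<Longrightarrow> r \<in> Mor C X Y"
  by (simp add: radHom_def)

lemma radHom_comp_left:
  assumes "a \<in> Mor C W X" "r \<in> radHom C X Y"
  shows "a \<Zsemi> r \<in> radHom C W Y"
  unfolding radHom_def
proof (clarify, intro conjI allI impI)
  have r: "r \<in> Mor C X Y" by (rule radHom_closed) fact
  then show "a \<Zsemi> r \<in> Mor C W Y" using assms(1) by blast
  fix A g h assume *: "indecomposable C A \<and> g \<in> Mor C A W \<and> h \<in> Mor C Y A"
  then have "(g \<Zsemi> (a \<Zsemi> r)) \<Zsemi> h = ((g \<Zsemi> a) \<Zsemi> r) \<Zsemi> h"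
    using Comp_assoc[of g A W a X r Y] assms(1) r by simp
  moreover have "g \<Zsemi> a \<in> Mor C A X" using * assms(1) by blast
  ultimately show "\<not> is_iso C A A ((g \<Zsemi> (a \<Zsemi> r)) \<Zsemi> h)"
    using assms(2) * by (auto simp: radHom_def)
qed

lemma radHom_comp_right:
  assumes "r \<in> radHom C X Y" "b \<in> Mor C Y Z"
  shows "r \<Zsemi> b \<in> radHom C X Z"
  unfolding radHom_def
proof (clarify, intro conjI allI impI)
  have r: "r \<in> Mor C X Y" by (rule radHom_closed) fact
  then show "r \<Zsemi> b \<in> Mor C X Z" using assms(2) by blast
  fix A g h assume *: "indecomposable C A \<and> g \<in> Mor C A X \<and> h \<in> Mor C Z A"
  then have "(g \<Zsemi> (r \<Zsemi> b)) \<Zsemi> h = (g \<Zsemi> r) \<Zsemi> (b \<Zsemi> h)"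
    using assms(2) r * comp_closed[of g A X r Y] by (simp add: Comp_assoc[of g A X r Y b Z, symmetric] Comp_assoc[of "g \<Zsemi> r" A Y b Z h A])
  moreover have "b \<Zsemi> h \<in> Mor C Y A" using * assms(2) by blast
  ultimately show "\<not> is_iso C A A ((g \<Zsemi> (r \<Zsemi> b)) \<Zsemi> h)"
    using assms(1) * by (auto simp: radHom_def)
qed

lemma End_ring_Units: "Units (End_ring C X) = {f. is_iso C X X f}"
  by (auto simp: Units_def End_ring_def is_iso_def inverse_mor_def)

text \<open>Were \<open>x\<close> and \<open>1 + x\<close> both non-units, their difference 1 would
  lie in the ideal of non-units.\<close>

lemma local_End_one_plus:
  assumes loc: "local_ring (End_ring C X)" and x: "x \<in> Mor C X X" and "\<not> is_iso C X X x"
  shows "is_iso C X X (Ident C X \<oplus>\<^bsub>Hom C X X\<^esub> x)"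
proof (rule ccontr)
  let ?R = "End_ring C X"
  interpret R: ring ?R using loc by (simp add: local_ring_def)
  interpret I: ideal "carrier ?R - Units ?R" ?R using loc by (simp add: local_ring_def)
  assume "\<not> ?thesis"
  then have 1: "\<one>\<^bsub>?R\<^esub> \<oplus>\<^bsub>?R\<^esub> x \<in> carrier ?R - Units ?R"
    using x by (simp add: End_ring_Units) (simp add: End_ring_def Id_closed)
  have 2: "x \<in> carrier ?R - Units ?R"
    using x assms(3) by (simp add: End_ring_Units) (simp add: End_ring_def)
  have "\<one>\<^bsub>?R\<^esub> = (\<one>\<^bsub>?R\<^esub> \<oplus>\<^bsub>?R\<^esub> x) \<oplus>\<^bsub>?R\<^esub> (\<ominus>\<^bsub>?R\<^esub> x)"
    using 2 by (simp add: R.a_assoc R.r_neg)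
  then have "\<one>\<^bsub>?R\<^esub> \<in> carrier ?R - Units ?R"
    using I.a_closed[OF 1 I.a_inv_closed[OF 2]] by simp
  then show False by simp
qed

lemma zero_object_iff: "zero_object C U \<longleftrightarrow> Ident C U = \<zero>\<^bsub>Hom C U U\<^esub>"
proof
  assume "zero_object C U"
  then show "Ident C U = \<zero>\<^bsub>Hom C U U\<^esub>" using Id_closed[of U] by (auto simp: zero_object_def)
next
  assume 0: "Ident C U = \<zero>\<^bsub>Hom C U U\<^esub>"
  have "f = \<zero>\<^bsub>Hom C X U\<^esub>" if "f \<in> Mor C X U" for f X
    using Id_right[OF that] comp_zero_right[OF that, of U] 0 by simp
  moreover have "f = \<zero>\<^bsub>Hom C U X\<^esub>" if "f \<in> Mor C U X" for f X
    using Id_left[OF that] comp_zero_left[OF that, of U] 0 by simp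
  ultimately show "zero_object C U" by (auto simp: zero_object_def)
qed

lemma zero_object_eq_zero:
  assumes "zero_object C U"
  shows "f \<in> Mor C X U \<Longrightarrow> f = \<zero>\<^bsub>Hom C X U\<^esub>" "f \<in> Mor C U X \<Longrightarrow> f = \<zero>\<^bsub>Hom C U X\<^esub>"
  using assms by (auto simp: zero_object_def)

lemma biproduct_closed:
  assumes "biproduct C X A B i j p q"
  shows "i \<in> Mor C A X" "j \<in> Mor C B X" "p \<in> Mor C X A" "q \<in> Mor C X B"
  using assms by (simp_all add: biproduct_def)

lemma biproduct_swap:
  assumes "biproduct C X A B i j p q"
  shows "biproduct C X B A j i q p"
proof -
  have "p \<Zsemi> i \<in> Mor C X X" "q \<Zsemi> j \<in> Mor C X X"
    using assms by (auto simp: biproduct_def)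
  then show ?thesis using assms by (simp add: biproduct_def Hom.a_comm)
qed

lemma biproduct_decompose:
  assumes "biproduct C X A B i j p q" "f \<in> Mor C X Y"
  shows "f = p \<Zsemi> (i \<Zsemi> f) \<oplus>\<^bsub>Hom C X Y\<^esub> q \<Zsemi> (j \<Zsemi> f)"
proof -
  note b = biproduct_closed[OF assms(1)]
  have "f = (p \<Zsemi> i \<oplus>\<^bsub>Hom C X X\<^esub> q \<Zsemi> j) \<Zsemi> f"
    using assms by (simp add: biproduct_def Id_left)
  then show ?thesis
    using comp_add_left[OF comp_closed[OF b(3,1)] comp_closed[OF b(4,2)] assms(2)]
      Comp_assoc[OF b(3,1) assms(2)] Comp_assoc[OF b(4,2) assms(2)] by simp
qed

lemma biproduct_decompose_right:
  assumes "biproduct C X A B i j p q" "f \<in> Mor C Y X"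
  shows "f = (f \<Zsemi> p) \<Zsemi> i \<oplus>\<^bsub>Hom C Y X\<^esub> (f \<Zsemi> q) \<Zsemi> j"
proof -
  note b = biproduct_closed[OF assms(1)]
  have "f = f \<Zsemi> (p \<Zsemi> i \<oplus>\<^bsub>Hom C X X\<^esub> q \<Zsemi> j)"
    using assms by (simp add: biproduct_def Id_right)
  then show ?thesis
    using comp_add_right[OF assms(2) comp_closed[OF b(3,1)] comp_closed[OF b(4,2)]]
      Comp_assoc[OF assms(2) b(3,1)] Comp_assoc[OF assms(2) b(4,2)] by simp
qed

text \<open>This allows the summands of \<open>Z[1]\<close> to be replaced by translates of objects,
  which essential surjectivity supplies up to isomorphism.\<close>

lemma biproduct_iso:
  assumes bi: "biproduct C X A B i j p q"
    and s: "inverse_mor C A' A s t" and s': "inverse_mor C B' B s' t'"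
  shows "biproduct C X A' B' (s \<Zsemi> i) (s' \<Zsemi> j) (p \<Zsemi> t) (q \<Zsemi> t')"
proof -
  note b = biproduct_closed[OF bi]
  have bb: "i \<Zsemi> p = Ident C A" "j \<Zsemi> q = Ident C B" "i \<Zsemi> q = \<zero>\<^bsub>Hom C A B\<^esub>" "j \<Zsemi> p = \<zero>\<^bsub>Hom C B A\<^esub>"
    "(p \<Zsemi> i) \<oplus>\<^bsub>Hom C X X\<^esub> (q \<Zsemi> j) = Ident C X" using bi by (simp_all add: biproduct_def)
  have st: "s \<in> Mor C A' A" "t \<in> Mor C A A'" "s \<Zsemi> t = Ident C A'" "t \<Zsemi> s = Ident C A"
    and st': "s' \<in> Mor C B' B" "t' \<in> Mor C B B'" "s' \<Zsemi> t' = Ident C B'" "t' \<Zsemi> s' = Ident C B"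
    using s s' by (auto simp: inverse_mor_def)
  have cl: "s \<Zsemi> i \<in> Mor C A' X" "s' \<Zsemi> j \<in> Mor C B' X" "p \<Zsemi> t \<in> Mor C X A'" "q \<Zsemi> t' \<in> Mor C X B'"
    using b st st' by auto
  have "(s \<Zsemi> i) \<Zsemi> (p \<Zsemi> t) = Ident C A'"
    by (simp add: Comp_assoc[OF st(1) b(1) cl(3)] Comp_assoc[OF b(1,3) st(2), symmetric] bb Id_left[OF st(2)] st)
  moreover have "(s' \<Zsemi> j) \<Zsemi> (q \<Zsemi> t') = Ident C B'"
    by (simp add: Comp_assoc[OF st'(1) b(2) cl(4)] Comp_assoc[OF b(2,4) st'(2), symmetric] bb Id_left[OF st'(2)] st')
  moreover have "(s \<Zsemi> i) \<Zsemi> (q \<Zsemi> t') = \<zero>\<^bsub>Hom C A' B'\<^esub>"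
    by (simp add: Comp_assoc[OF st(1) b(1) cl(4)] Comp_assoc[OF b(1,4) st'(2), symmetric] bb
        comp_zero_left[OF st'(2)] comp_zero_right[OF st(1)])
  moreover have "(s' \<Zsemi> j) \<Zsemi> (p \<Zsemi> t) = \<zero>\<^bsub>Hom C B' A'\<^esub>"
    by (simp add: Comp_assoc[OF st'(1) b(2) cl(3)] Comp_assoc[OF b(2,3) st(2), symmetric] bb
        comp_zero_left[OF st(2)] comp_zero_right[OF st'(1)])
  moreover have "(p \<Zsemi> t) \<Zsemi> (s \<Zsemi> i) = p \<Zsemi> i"
    by (simp add: Comp_assoc[OF b(3) st(2) cl(1)] comp_cancel_inverse[OF st(2,1,4) b(1)])
  moreover have "(q \<Zsemi> t') \<Zsemi> (s' \<Zsemi> j) = q \<Zsemi> j"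
    by (simp add: Comp_assoc[OF b(4) st'(2) cl(2)] comp_cancel_inverse[OF st'(2,1,4) b(2)])
  ultimately show ?thesis using cl bb by (simp add: biproduct_def)
qed

lemma is_iso_one_plus_swap_iff:
  assumes "a \<in> Mor C X Y" "b \<in> Mor C Y X"
  shows "is_iso C X X (Ident C X \<oplus>\<^bsub>Hom C X X\<^esub> (a \<Zsemi> b)) \<longleftrightarrow> is_iso C Y Y (Ident C Y \<oplus>\<^bsub>Hom C Y Y\<^esub> (b \<Zsemi> a))"
  using is_iso_one_plus_swap[OF assms] is_iso_one_plus_swap[OF assms(2,1)] by blast

lemma Aut_inverse:
  assumes "f \<in> Aut C X"
  obtains g where "f \<in> Mor C X X" "g \<in> Aut C X" "g \<in> Mor C X X" "f \<Zsemi> g = Ident C X" "g \<Zsemi> f = Ident C X"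
  using assms unfolding Aut_iff is_iso_def inverse_mor_def by blast

lemma bij_betw_one_plus:
  "bij_betw (\<lambda>y. Ident C X \<oplus>\<^bsub>Hom C X X\<^esub> y) (Mor C X X) (Mor C X X)"
  by (rule bij_betwI[where g = "\<lambda>y. \<ominus>\<^bsub>Hom C X X\<^esub> Ident C X \<oplus>\<^bsub>Hom C X X\<^esub> y"])
    (auto simp: Id_closed Hom.r_neg1 Hom.r_neg2)

end

section \<open>Transport along the translation\<close>

context translation_linear_category
begin

lemma mod_hom_Shm: "mod_hom K (Hom C X Y) (Hom C (Sh C X) (Sh C Y)) (Shm C)"
  by (intro mod_hom.intro mod_hom_axioms.intro Shm_linear)
    (auto intro: vectorspace.axioms Hom_vectorspace)

lemma Shm_closed [intro]: "f \<in> Mor C X Y \<Longrightarrow> Shm C f \<in> Mor C (Sh C X) (Sh C Y)"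
  by (rule mod_hom.f_im[OF mod_hom_Shm])

lemmas Shm_add = module_hom_add[OF Shm_linear]

lemmas Shm_zero = mod_hom.f0_is_0[OF mod_hom_Shm]

lemmas Shm_neg = mod_hom.f_neg[OF mod_hom_Shm]

lemma Shm_eq_iff:
  "\<lbrakk>f \<in> Mor C X Y; g \<in> Mor C X Y\<rbrakk> \<Longrightarrow> Shm C f = Shm C g \<longleftrightarrow> f = g"
  using Shm_fully_faithful[of X Y] by (auto simp: bij_betw_def inj_on_def)

lemma Shm_surj:
  assumes "f \<in> Mor C (Sh C X) (Sh C Y)"
  obtains g where "g \<in> Mor C X Y" "Shm C g = f"
  using assms Shm_fully_faithful[of X Y] by (metis bij_betw_imp_surj_on imageE)

lemma zero_object_Sh: "zero_object C U \<Longrightarrow> zero_object C (Sh C U)"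
  unfolding zero_object_iff using Shm_Id[of U] Shm_zero[of U U] by simp

lemma inverse_mor_Shm:
  assumes "f \<in> Mor C X Y" "g \<in> Mor C Y X"
  shows "inverse_mor C (Sh C X) (Sh C Y) (Shm C f) (Shm C g) \<longleftrightarrow> inverse_mor C X Y f g"
  unfolding inverse_mor_def Shm_Id[symmetric]
  using assms Shm_eq_iff[OF comp_closed[OF assms] Id_closed] Shm_eq_iff[OF comp_closed[OF assms(2,1)] Id_closed]
  by (auto simp: Shm_Comp[OF assms] Shm_Comp[OF assms(2,1)])

lemma is_iso_Shm_iff:
  assumes "f \<in> Mor C X Y"
  shows "is_iso C (Sh C X) (Sh C Y) (Shm C f) \<longleftrightarrow> is_iso C X Y f"
proof
  assume "is_iso C (Sh C X) (Sh C Y) (Shm C f)"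
  then obtain g where g: "inverse_mor C (Sh C X) (Sh C Y) (Shm C f) g" by (auto simp: is_iso_def)
  then have "g \<in> Mor C (Sh C Y) (Sh C X)" by (simp add: inverse_mor_def)
  then obtain h where "h \<in> Mor C Y X" "Shm C h = g" by (rule Shm_surj)
  with g show "is_iso C X Y f" using inverse_mor_Shm[OF assms] by (auto simp: is_iso_def)
next
  assume "is_iso C X Y f"
  then obtain g where g: "inverse_mor C X Y f g" by (auto simp: is_iso_def)
  then have "g \<in> Mor C Y X" by (simp add: inverse_mor_def)
  with g show "is_iso C (Sh C X) (Sh C Y) (Shm C f)"
    using inverse_mor_Shm[OF assms] by (auto simp: is_iso_def)
qed

lemma inv_mor_Shm:
  assumes "is_iso C X Y f"
  shows "inv_mor C (Sh C X) (Sh C Y) (Shm C f) = Shm C (inv_mor C X Y f)"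
  using inverse_mor_inv_mor[OF assms] inverse_mor_Shm[of f X Y "inv_mor C X Y f"]
  by (intro inv_mor_eq) (auto simp: inverse_mor_def)

text \<open>Faithfulness reflects each of the defining equations. A decomposition of
  \<open>Z[1]\<close> whose structure maps are translates thus descends to \<open>Z\<close>, as
  \<open>diag_form\<close> requires.\<close>

lemma biproduct_Shm_iff:
  assumes "i \<in> Mor C A X" "j \<in> Mor C B X" "p \<in> Mor C X A" "q \<in> Mor C X B"
  shows "biproduct C (Sh C X) (Sh C A) (Sh C B) (Shm C i) (Shm C j) (Shm C p) (Shm C q) \<longleftrightarrow>
    biproduct C X A B i j p q"
proof -
  note cl = comp_closed[OF assms(1,3)] comp_closed[OF assms(2,4)] comp_closed[OF assms(1,4)]
    comp_closed[OF assms(2,3)] comp_closed[OF assms(3,1)] comp_closed[OF assms(4,2)]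
  note sh = Shm_Comp[OF assms(1,3)] Shm_Comp[OF assms(2,4)] Shm_Comp[OF assms(1,4)]
    Shm_Comp[OF assms(2,3)] Shm_Comp[OF assms(3,1)] Shm_Comp[OF assms(4,2)]
  show ?thesis unfolding biproduct_def
    using assms Shm_eq_iff[OF cl(1) Id_closed] Shm_eq_iff[OF cl(2) Id_closed]
      Shm_eq_iff[OF cl(3) Hom.zero_closed] Shm_eq_iff[OF cl(4) Hom.zero_closed]
      Shm_eq_iff[OF Hom.a_closed[OF cl(5,6)] Id_closed]
    by (auto simp: biproduct_def Shm_Id Shm_zero Shm_add[OF cl(5,6)] sh)
qed

lemma Shm_comp_eq_zero_iff:
  assumes "a \<in> Mor C X Y" "f \<in> Mor C Y Z"
  shows "Shm C a \<Zsemi> Shm C f = \<zero>\<^bsub>Hom C (Sh C X) (Sh C Z)\<^esub> \<longleftrightarrow> a \<Zsemi> f = \<zero>\<^bsub>Hom C X Z\<^esub>"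
  using Shm_eq_iff[OF comp_closed[OF assms] Hom.zero_closed] by (simp add: Shm_Comp[OF assms] Shm_zero)

lemma bij_betw_Shm_kernel:
  assumes "f \<in> Mor C Y Z"
  shows "bij_betw (Shm C) {a \<in> Mor C X Y. a \<Zsemi> f = \<zero>\<^bsub>Hom C X Z\<^esub>}
    {a \<in> Mor C (Sh C X) (Sh C Y). a \<Zsemi> Shm C f = \<zero>\<^bsub>Hom C (Sh C X) (Sh C Z)\<^esub>}"
  by (rule bij_betw_Collect[OF Shm_fully_faithful]) (rule Shm_comp_eq_zero_iff[OF _ assms])

lemma twist_Ident:
  assumes "n \<in> Mor C L (Sh C Z)"
  shows "twist C Z L (Ident C Z) (Ident C L) n = n"
  using assms by (simp add: twist_def Shm_Id inv_mor_Ident Id_left Id_right)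

lemma twist_eq:
  assumes "inverse_mor C Z Z d d'"
  shows "twist C Z L d b n = b \<Zsemi> n \<Zsemi> Shm C d'"
proof -
  have "is_iso C Z Z d" using assms by (auto simp: is_iso_def)
  then show ?thesis using inv_mor_eq[OF assms] by (simp add: twist_def inv_mor_Shm)
qed

end

section \<open>Exactness, uniqueness of cones and splitting\<close>

context triangulated_linear_category
begin

lemma Tri_rotated: "Tri C X Y Z f g h \<Longrightarrow> Tri C Y Z (Sh C X) g h (\<ominus>\<^bsub>Hom C (Sh C X) (Sh C Y)\<^esub> Shm C f)"
  using Tri_rotate[of f X Y g Z h] Tri_closed[of X Y Z f g h] by simp

text \<open>The square with sides 1 and \<open>f\<close> extends to a morphism from the triangle on
  the identity of \<open>X\<close>, whose third object is zero; hence \<open>fg\<close> factors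
  through zero.\<close>

lemma Tri_comp_zero:
  assumes "Tri C X Y Z f g h"
  shows "f \<Zsemi> g = \<zero>\<^bsub>Hom C X Z\<^esub>"
proof -
  obtain U where U: "zero_object C U" using zero_object_exists by blast
  from Tri_closed[OF assms] have cl: "f \<in> Mor C X Y" "g \<in> Mor C Y Z" by auto
  from Tri_morphism[OF Tri_Id[OF U, of X] assms Id_closed cl(1)]
  obtain c where "c \<in> Mor C U Z" "\<zero>\<^bsub>Hom C X U\<^esub> \<Zsemi> c = f \<Zsemi> g" by auto
  then show ?thesis using comp_zero_left by metis
qed

lemma Tri_comp_zero_2: "Tri C X Y Z f g h \<Longrightarrow> g \<Zsemi> h = \<zero>\<^bsub>Hom C Y (Sh C X)\<^esub>"
  by (rule Tri_comp_zero[OF Tri_rotated])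

lemma Tri_comp_zero_3:
  assumes "Tri C X Y Z f g h"
  shows "h \<Zsemi> Shm C f = \<zero>\<^bsub>Hom C Z (Sh C Y)\<^esub>"
proof -
  from Tri_closed[OF assms] have cl: "h \<in> Mor C Z (Sh C X)" "Shm C f \<in> Mor C (Sh C X) (Sh C Y)" by auto
  have "h \<Zsemi> (\<ominus>\<^bsub>Hom C (Sh C X) (Sh C Y)\<^esub> Shm C f) = \<zero>\<^bsub>Hom C Z (Sh C Y)\<^esub>"
    by (rule Tri_comp_zero_2[OF Tri_rotated[OF assms]])
  then have "\<ominus>\<^bsub>Hom C Z (Sh C Y)\<^esub> (h \<Zsemi> Shm C f) = \<zero>\<^bsub>Hom C Z (Sh C Y)\<^esub>"
    using cl by (simp add: comp_neg_right)
  then show ?thesis using Hom.r_neg[OF comp_closed[OF cl]] comp_closed[OF cl] by simp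
qed

text \<open>The triangle is mapped to the one with objects \<open>U\<close>, \<open>W\<close>,
  \<open>W\<close>, where \<open>U\<close> is zero and the middle map is the identity; the third
  component of the morphism is the wanted factor.\<close>

lemma Tri_exact_left:
  assumes T: "Tri C X Y Z f g h" and a: "a \<in> Mor C Y W" "f \<Zsemi> a = \<zero>\<^bsub>Hom C X W\<^esub>"
  obtains b where "b \<in> Mor C Z W" "g \<Zsemi> b = a"
proof -
  obtain U where U: "zero_object C U" using zero_object_exists by blast
  note zero = zero_object_eq_zero[OF zero_object_Sh[OF U]]
  have 0: "\<zero>\<^bsub>Hom C U W\<^esub> \<in> Mor C U W" "\<zero>\<^bsub>Hom C W (Sh C U)\<^esub> \<in> Mor C W (Sh C U)"
    "\<zero>\<^bsub>Hom C X U\<^esub> \<in> Mor C X U" by auto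
  have "\<ominus>\<^bsub>Hom C (Sh C U) (Sh C W)\<^esub> Shm C \<zero>\<^bsub>Hom C U W\<^esub> = \<zero>\<^bsub>Hom C (Sh C U) (Sh C W)\<^esub>"
    using 0 by (intro zero) auto
  then have TW: "Tri C U W W \<zero>\<^bsub>Hom C U W\<^esub> (Ident C W) \<zero>\<^bsub>Hom C W (Sh C U)\<^esub>"
    using Tri_rotate[OF 0(1) Id_closed 0(2)] Tri_Id[OF zero_object_Sh[OF U], of W] by simp
  have "f \<Zsemi> a = \<zero>\<^bsub>Hom C X U\<^esub> \<Zsemi> \<zero>\<^bsub>Hom C U W\<^esub>" using a comp_zero_left[OF 0(1)] by simp
  from Tri_morphism[OF T TW 0(3) a(1) this]
  obtain c where "c \<in> Mor C Z W" "g \<Zsemi> c = a \<Zsemi> Ident C W" by auto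
  then show ?thesis using that Id_right[OF a(1)] by simp
qed

text \<open>The morphism axiom produces a third component, whereas \<open>b\<close> is a first one.
  Both triangles are therefore rotated once, so that \<open>b[1]\<close> stands in third place;
  fullness recovers \<open>b\<close>, and the two signs from the rotations cancel.\<close>

lemma Tri_exact_right:
  assumes T: "Tri C X Y Z f g h" and a: "a \<in> Mor C W Y" "a \<Zsemi> g = \<zero>\<^bsub>Hom C W Z\<^esub>"
  obtains b where "b \<in> Mor C W X" "b \<Zsemi> f = a"
proof -
  obtain U where U: "zero_object C U" using zero_object_exists by blast
  have cl: "f \<in> Mor C X Y" using Tri_closed[OF T] by simp
  have 0: "\<zero>\<^bsub>Hom C U Z\<^esub> \<in> Mor C U Z" by auto
  have "\<zero>\<^bsub>Hom C W U\<^esub> \<Zsemi> \<zero>\<^bsub>Hom C U Z\<^esub> = a \<Zsemi> g"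
    using a(2) comp_zero_left[OF 0] by simp
  from Tri_morphism[OF Tri_rotated[OF Tri_Id[OF U, of W]] Tri_rotated[OF T] a(1) 0 this]
  obtain c where c: "c \<in> Mor C (Sh C W) (Sh C X)"
    "(\<ominus>\<^bsub>Hom C (Sh C W) (Sh C W)\<^esub> Ident C (Sh C W)) \<Zsemi> Shm C a =
      c \<Zsemi> (\<ominus>\<^bsub>Hom C (Sh C X) (Sh C Y)\<^esub> Shm C f)"
    by (auto simp: Shm_Id)
  from c(1) obtain b where b: "b \<in> Mor C W X" "Shm C b = c" by (rule Shm_surj)
  have "\<ominus>\<^bsub>Hom C (Sh C W) (Sh C Y)\<^esub> Shm C a = \<ominus>\<^bsub>Hom C (Sh C W) (Sh C Y)\<^esub> Shm C (b \<Zsemi> f)"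
    using c(2) comp_neg_left[OF Shm_closed[OF a(1)] Id_closed] comp_neg_right[OF c(1) Shm_closed[OF cl]]
      Id_left[OF Shm_closed[OF a(1)]] b by (simp add: Shm_Comp[OF b(1) cl])
  then have "Shm C a = Shm C (b \<Zsemi> f)"
    using Shm_closed[OF a(1)] Shm_closed[OF comp_closed[OF b(1) cl]] by (metis Hom.minus_minus)
  then have "b \<Zsemi> f = a" using Shm_eq_iff[OF a(1) comp_closed[OF b(1) cl]] by simp
  with b show ?thesis using that by blast
qed

text \<open>This is exactness at \<open>X[1]\<close> in the twice rotated triangle; the sign of
  \<open>f[1]\<close> there does not change its kernel.\<close>

lemma Shm_kernel_image:
  assumes T: "Tri C X Y Z f g h"
  shows "{a \<in> Mor C W (Sh C X). a \<Zsemi> Shm C f = \<zero>\<^bsub>Hom C W (Sh C Y)\<^esub>} = (\<lambda>a. a \<Zsemi> h) ` Mor C W Z"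
proof (intro equalityI subsetI)
  from Tri_closed[OF T] have cl: "f \<in> Mor C X Y" "h \<in> Mor C Z (Sh C X)" by auto
  have f': "Shm C f \<in> Mor C (Sh C X) (Sh C Y)" using cl by blast
  {
    fix a assume "a \<in> {a \<in> Mor C W (Sh C X). a \<Zsemi> Shm C f = \<zero>\<^bsub>Hom C W (Sh C Y)\<^esub>}"
    then have a: "a \<in> Mor C W (Sh C X)" "a \<Zsemi> Shm C f = \<zero>\<^bsub>Hom C W (Sh C Y)\<^esub>" by auto
    then have "a \<Zsemi> (\<ominus>\<^bsub>Hom C (Sh C X) (Sh C Y)\<^esub> Shm C f) = \<zero>\<^bsub>Hom C W (Sh C Y)\<^esub>"
      using comp_neg_right[OF a(1) f'] Hom.r_neg[of "\<zero>\<^bsub>Hom C W (Sh C Y)\<^esub>" W "Sh C Y"] by simp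
    then show "a \<in> (\<lambda>a. a \<Zsemi> h) ` Mor C W Z"
      using Tri_exact_right[OF Tri_rotated[OF Tri_rotated[OF T]] a(1)] by blast
  }
  fix a assume "a \<in> (\<lambda>a. a \<Zsemi> h) ` Mor C W Z"
  then obtain b where b: "b \<in> Mor C W Z" "a = b \<Zsemi> h" by blast
  then show "a \<in> {a \<in> Mor C W (Sh C X). a \<Zsemi> Shm C f = \<zero>\<^bsub>Hom C W (Sh C Y)\<^esub>}"
    using Comp_assoc[OF b(1) cl(2) f'] Tri_comp_zero_3[OF T] comp_zero_right[OF b(1)] cl by auto
qed

text \<open>The difference \<open>x = e - 1\<close> is killed by \<open>h\<close> and so factors as
  \<open>tg\<close>. From \<open>gx = 0\<close> it follows that \<open>x\<close> has square zero,
  and \<open>1 - x\<close> inverts \<open>e\<close>.\<close>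

lemma Tri_endo_iso:
  assumes T: "Tri C X Y Z f g h" and e: "e \<in> Mor C Z Z" "g \<Zsemi> e = g" "e \<Zsemi> h = h"
  shows "is_iso C Z Z e"
proof -
  from Tri_closed[OF T] have cl: "g \<in> Mor C Y Z" "h \<in> Mor C Z (Sh C X)" by auto
  define x where "x = e \<ominus>\<^bsub>Hom C Z Z\<^esub> Ident C Z"
  have x: "x \<in> Mor C Z Z" using e(1) by (simp add: x_def Id_closed)
  have ex: "e \<ominus>\<^bsub>Hom C Z Z\<^esub> x = Ident C Z"
    using e(1) by (simp add: x_def Hom.minus_eq Hom.minus_add Hom.a_assoc[symmetric] Hom.r_neg Id_closed)
  have "x \<Zsemi> h = \<zero>\<^bsub>Hom C Z (Sh C X)\<^esub>"
    using comp_minus_left[OF cl(2) e(1) Id_closed] e(3) Id_left[OF cl(2)] cl(2)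
    by (simp add: x_def Hom.minus_eq Hom.r_neg)
  then obtain t where t: "t \<in> Mor C Z Y" "t \<Zsemi> g = x"
    by (rule Tri_exact_right[OF Tri_rotated[OF T] x])
  have 1: "x \<Zsemi> e = x"
    using Comp_assoc[OF t(1) cl(1) e(1)] t(2) e(2) by simp
  have "x \<Zsemi> x = \<zero>\<^bsub>Hom C Z Z\<^esub>"
    using comp_minus_right[OF x e(1) Id_closed, folded x_def] 1 Id_right[OF x] x
    by (simp add: Hom.minus_eq Hom.r_neg)
  moreover have "e = x \<oplus>\<^bsub>Hom C Z Z\<^esub> Ident C Z"
    using e(1) by (simp add: x_def Hom.minus_eq Hom.a_assoc Hom.l_neg Id_closed)
  ultimately have 2: "e \<Zsemi> x = x"
    using comp_add_left[OF x Id_closed x] Id_left[OF x] x by simp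
  show ?thesis
  proof (rule is_isoI)
    show "e \<Zsemi> (Ident C Z \<ominus>\<^bsub>Hom C Z Z\<^esub> x) = Ident C Z"
      using comp_minus_right[OF e(1) Id_closed x] Id_right[OF e(1)] 2 ex by simp
    show "(Ident C Z \<ominus>\<^bsub>Hom C Z Z\<^esub> x) \<Zsemi> e = Ident C Z"
      using comp_minus_left[OF e(1) Id_closed x] Id_left[OF e(1)] 1 ex by simp
  qed (use e(1) x in \<open>simp_all add: Id_closed\<close>)
qed

text \<open>Comparison maps exist in both directions, and both composites are invertible because
  they fix the second and third maps of a triangle. The compatibility of \<open>c\<close> with these
  maps is retained, since it supplies the equations that place two triangles in one orbit.\<close>

lemma Tri_cone_unique:
  assumes T: "Tri C X Y Z f g h" and T': "Tri C X Y Z' f g' h'"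
  obtains c where "is_iso C Z Z' c" "g \<Zsemi> c = g'" "c \<Zsemi> h' = h"
proof -
  from Tri_closed[OF T] Tri_closed[OF T']
  have cl: "f \<in> Mor C X Y" "g \<in> Mor C Y Z" "h \<in> Mor C Z (Sh C X)" "g' \<in> Mor C Y Z'" "h' \<in> Mor C Z' (Sh C X)"
    by auto
  note sq = trans[OF Id_right[OF cl(1)] Id_left[OF cl(1), symmetric]]
  from Tri_morphism[OF T T' Id_closed Id_closed sq] Id_left[OF cl(4)] Id_right[OF cl(3)]
  obtain c where c: "c \<in> Mor C Z Z'" "g \<Zsemi> c = g'" "c \<Zsemi> h' = h" by (auto simp: Shm_Id)
  from Tri_morphism[OF T' T Id_closed Id_closed sq] Id_left[OF cl(2)] Id_right[OF cl(5)]
  obtain c' where c': "c' \<in> Mor C Z' Z" "g' \<Zsemi> c' = g" "c' \<Zsemi> h = h'" by (auto simp: Shm_Id)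
  have "is_iso C Z Z (c \<Zsemi> c')"
    using c c' Comp_assoc[OF cl(2) c(1) c'(1)] Comp_assoc[OF c(1) c'(1) cl(3)]
    by (intro Tri_endo_iso[OF T]) auto
  then obtain u where u: "u \<in> Mor C Z Z" "(c \<Zsemi> c') \<Zsemi> u = Ident C Z" by (rule is_isoE)
  have "is_iso C Z' Z' (c' \<Zsemi> c)"
    using c c' Comp_assoc[OF cl(4) c'(1) c(1)] Comp_assoc[OF c'(1) c(1) cl(5)]
    by (intro Tri_endo_iso[OF T']) auto
  then obtain v where v: "v \<in> Mor C Z' Z'" "v \<Zsemi> (c' \<Zsemi> c) = Ident C Z'" by (rule is_isoE)
  have "is_iso C Z Z' c"
    using u v c(1) c'(1) Comp_assoc[OF c(1) c'(1) u(1)] Comp_assoc[OF v(1) c'(1) c(1)]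
    by (intro is_iso_left_right[of c Z Z' "c' \<Zsemi> u" "v \<Zsemi> c'"]) auto
  with c show ?thesis using that by blast
qed

text \<open>The complement is the cone \<open>B\<close> of \<open>g\<close>: since \<open>g\<close>
  splits, the connecting map \<open>d\<close> vanishes, and \<open>c\<close> acquires a
  section.\<close>

lemma split_mono_complement:
  assumes g: "g \<in> Mor C A L" and r: "r \<in> Mor C L A" and gr: "g \<Zsemi> r = Ident C A"
  obtains B j c where "biproduct C L A B g j r c"
proof -
  obtain B c d where T: "Tri C A L B g c d" using Tri_cone[OF g] by blast
  from Tri_closed[OF T] have cl: "c \<in> Mor C L B" "d \<in> Mor C B (Sh C A)" by auto
  have gc: "g \<Zsemi> c = \<zero>\<^bsub>Hom C A B\<^esub>" by (rule Tri_comp_zero[OF T])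
  \<comment> \<open>\<open>d g[1]\<close> is zero by exactness, and \<open>g[1] r[1]\<close> is the
    identity.\<close>
  have "d = d \<Zsemi> (Shm C g \<Zsemi> Shm C r)"
    using Shm_Comp[OF g r] gr Id_right[OF cl(2)] by (simp add: Shm_Id)
  also have "\<dots> = (d \<Zsemi> Shm C g) \<Zsemi> Shm C r"
    using Comp_assoc[OF cl(2) Shm_closed[OF g] Shm_closed[OF r]] by simp
  also have "\<dots> = \<zero>\<^bsub>Hom C B (Sh C A)\<^esub>"
    using Tri_comp_zero_3[OF T] comp_zero_left[OF Shm_closed[OF r]] by simp
  finally have "Ident C B \<Zsemi> d = \<zero>\<^bsub>Hom C B (Sh C A)\<^esub>" using Id_left[OF cl(2)] by simp
  then obtain j where j: "j \<in> Mor C B L" "j \<Zsemi> c = Ident C B"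
    by (rule Tri_exact_right[OF Tri_rotated[OF T] Id_closed])
  have jr: "j \<Zsemi> r \<in> Mor C B A" using j r by blast
  then have jrg: "(j \<Zsemi> r) \<Zsemi> g \<in> Mor C B L" using g by blast
  \<comment> \<open>The section \<open>j\<close> may have a component along \<open>A\<close>.
    Subtracting it gives \<open>kr = 0\<close>, and \<open>kc = 1\<close> survives because
    \<open>gc = 0\<close>.\<close>
  define k where "k = j \<ominus>\<^bsub>Hom C B L\<^esub> ((j \<Zsemi> r) \<Zsemi> g)"
  have k: "k \<in> Mor C B L" using j jrg by (simp add: k_def)
  have kr: "k \<Zsemi> r = \<zero>\<^bsub>Hom C B A\<^esub>"
    using comp_minus_left[OF r j(1) jrg] Comp_assoc[OF jr g r] gr Id_right[OF jr] jr
    by (simp add: k_def Hom.minus_eq Hom.r_neg)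
  have kc: "k \<Zsemi> c = Ident C B"
    using comp_minus_left[OF cl(1) j(1) jrg] Comp_assoc[OF jr g cl(1)] gc comp_zero_right[OF jr] j(2)
    by (simp add: k_def Hom.minus_eq Id_closed)
  have rg: "r \<Zsemi> g \<in> Mor C L L" and ck: "c \<Zsemi> k \<in> Mor C L L" using r g cl k by auto
  \<comment> \<open>\<open>s\<close> is the error in the decomposition of the identity. From
    \<open>sc = 0\<close> comes \<open>s = tg\<close>, and then \<open>sr = 0\<close> forces
    \<open>t = tgr = 0\<close>.\<close>
  define s where "s = Ident C L \<ominus>\<^bsub>Hom C L L\<^esub> (r \<Zsemi> g \<oplus>\<^bsub>Hom C L L\<^esub> c \<Zsemi> k)"
  have s: "s \<in> Mor C L L" using rg ck by (simp add: s_def Id_closed)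
  have sx: "s \<Zsemi> x = x \<ominus>\<^bsub>Hom C L Y\<^esub> (r \<Zsemi> (g \<Zsemi> x) \<oplus>\<^bsub>Hom C L Y\<^esub> c \<Zsemi> (k \<Zsemi> x))"
    if x: "x \<in> Mor C L Y" for x Y
    using comp_minus_left[OF x Id_closed Hom.a_closed[OF rg ck]] comp_add_left[OF rg ck x] Id_left[OF x]
      Comp_assoc[OF r g x] Comp_assoc[OF cl(1) k x] by (simp add: s_def)
  have "s \<Zsemi> c = \<zero>\<^bsub>Hom C L B\<^esub>"
    using sx[OF cl(1)] cl(1) gc kc comp_zero_right[OF r] Id_right[OF cl(1)] by (simp add: Hom.minus_eq Hom.r_neg)
  then obtain t where t: "t \<in> Mor C L A" "t \<Zsemi> g = s" by (rule Tri_exact_right[OF T s])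
  have "s \<Zsemi> r = \<zero>\<^bsub>Hom C L A\<^esub>"
    using sx[OF r] r kr gr comp_zero_right[OF cl(1)] Id_right[OF r] by (simp add: Hom.minus_eq Hom.r_neg)
  then have "t = \<zero>\<^bsub>Hom C L A\<^esub>"
    using Comp_assoc[OF t(1) g r] t gr Id_right[OF t(1)] by simp
  then have "s = \<zero>\<^bsub>Hom C L L\<^esub>" using t(2) comp_zero_left[OF g] by simp
  then have "r \<Zsemi> g \<oplus>\<^bsub>Hom C L L\<^esub> c \<Zsemi> k = Ident C L"
    using Hom.a_closed[OF rg ck] Hom.l_neg[OF Hom.a_closed[OF rg ck]]
      Hom.a_assoc[OF Id_closed _ Hom.a_closed[OF rg ck], of "\<ominus>\<^bsub>Hom C L L\<^esub> (r \<Zsemi> g \<oplus>\<^bsub>Hom C L L\<^esub> c \<Zsemi> k)"]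
    by (simp add: s_def Hom.minus_eq Id_closed)
  then have "biproduct C L A B g k r c"
    using g r gr k cl(1) kr kc gc by (simp add: biproduct_def)
  then show ?thesis by (rule that)
qed

lemma Tri_kernel_contravariant:
  assumes T: "Tri C X Y Z f g h"
  shows "{a \<in> Mor C Y W. f \<Zsemi> a = \<zero>\<^bsub>Hom C X W\<^esub>} = (\<lambda>a. g \<Zsemi> a) ` Mor C Z W"
proof (intro equalityI subsetI)
  from Tri_closed[OF T] have cl: "f \<in> Mor C X Y" "g \<in> Mor C Y Z" by auto
  {
    fix a assume "a \<in> {a \<in> Mor C Y W. f \<Zsemi> a = \<zero>\<^bsub>Hom C X W\<^esub>}"
    then show "a \<in> (\<lambda>a. g \<Zsemi> a) ` Mor C Z W" using Tri_exact_left[OF T, of a W] by blast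
  }
  fix a assume "a \<in> (\<lambda>a. g \<Zsemi> a) ` Mor C Z W"
  then obtain b where b: "b \<in> Mor C Z W" "a = g \<Zsemi> b" by blast
  then show "a \<in> {a \<in> Mor C Y W. f \<Zsemi> a = \<zero>\<^bsub>Hom C X W\<^esub>}"
    using Comp_assoc[OF cl b(1)] Tri_comp_zero[OF T] comp_zero_left[OF b(1)] cl by auto
qed

lemma Tri_kernel_covariant:
  assumes T: "Tri C X Y Z f g h"
  shows "{a \<in> Mor C W Y. a \<Zsemi> g = \<zero>\<^bsub>Hom C W Z\<^esub>} = (\<lambda>a. a \<Zsemi> f) ` Mor C W X"
proof (intro equalityI subsetI)
  from Tri_closed[OF T] have cl: "f \<in> Mor C X Y" "g \<in> Mor C Y Z" by auto
  {
    fix a assume "a \<in> {a \<in> Mor C W Y. a \<Zsemi> g = \<zero>\<^bsub>Hom C W Z\<^esub>}"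
    then show "a \<in> (\<lambda>a. a \<Zsemi> f) ` Mor C W X" using Tri_exact_right[OF T, of a W] by blast
  }
  fix a assume "a \<in> (\<lambda>a. a \<Zsemi> f) ` Mor C W X"
  then obtain b where b: "b \<in> Mor C W X" "a = b \<Zsemi> f" by blast
  then show "a \<in> {a \<in> Mor C W Y. a \<Zsemi> g = \<zero>\<^bsub>Hom C W Z\<^esub>}"
    using Comp_assoc[OF b(1) cl] Tri_comp_zero[OF T] comp_zero_right[OF b(1)] cl by auto
qed

section \<open>Orbits of triangles as equivalence classes\<close>

text \<open>The equations say that \<open>(d, 1, b)\<close> is an isomorphism of triangles from the
  primed triple to the unprimed one. This is the group action with its inverses cleared.\<close>

definition triple_rel where
  "triple_rel Z L M = {((l, m, n), (l', m', n')).
    (l, m, n) \<in> triangle_triples C Z L M \<and> (l', m', n') \<in> triangle_triples C Z L M \<and>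
    (\<exists>d\<in>Aut C Z. \<exists>b\<in>Aut C L. l' = d \<Zsemi> l \<and> m' \<Zsemi> b = m \<and> n' \<Zsemi> Shm C d = b \<Zsemi> n)}"

lemma triangle_triples_iff: "(l, m, n) \<in> triangle_triples C Z L M \<longleftrightarrow> Tri C Z M L l m n"
  using Tri_closed by (auto simp: triangle_triples_def)

lemma Tri_act:
  assumes T: "Tri C Z M L l m n" and d: "inverse_mor C Z Z d d'" and b: "inverse_mor C L L b b'"
  shows "Tri C Z M L (d \<Zsemi> l) (m \<Zsemi> b') (b \<Zsemi> n \<Zsemi> Shm C d')"
proof -
  from Tri_closed[OF T] have cl: "l \<in> Mor C Z M" "m \<in> Mor C M L" "n \<in> Mor C L (Sh C Z)" by auto
  have dc: "d \<in> Mor C Z Z" "d' \<in> Mor C Z Z" "d' \<Zsemi> d = Ident C Z" using d by (auto simp: inverse_mor_def)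
  have bc: "b \<in> Mor C L L" "b' \<in> Mor C L L" "b' \<Zsemi> b = Ident C L" using b by (auto simp: inverse_mor_def)
  have nd: "n \<Zsemi> Shm C d' \<in> Mor C L (Sh C Z)" using cl dc by blast
  have bn: "b \<Zsemi> n \<Zsemi> Shm C d' = b \<Zsemi> (n \<Zsemi> Shm C d')"
    by (rule Comp_assoc[OF bc(1) cl(3) Shm_closed[OF dc(2)]])
  show ?thesis
  proof (rule Tri_isomorphic[OF T])
    show "is_iso C Z Z d'" "is_iso C M M (Ident C M)" "is_iso C L L b'"
      by (rule is_iso_inverse[OF d], rule is_iso_Ident, rule is_iso_inverse[OF b])
    show "l \<Zsemi> Ident C M = d' \<Zsemi> (d \<Zsemi> l)"
      using comp_cancel_inverse[OF dc(2,1,3) cl(1)] Id_right[OF cl(1)] by simp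
    show "m \<Zsemi> b' = Ident C M \<Zsemi> (m \<Zsemi> b')" using Id_left[OF comp_closed[OF cl(2) bc(2)]] by simp
    show "n \<Zsemi> Shm C d' = b' \<Zsemi> (b \<Zsemi> n \<Zsemi> Shm C d')"
      using comp_cancel_inverse[OF bc(2,1,3) nd] by (simp add: bn)
  qed (use cl dc bc nd in \<open>auto simp: bn\<close>)
qed

lemma triple_orbit_eq:
  assumes t: "(l, m, n) \<in> triangle_triples C Z L M"
  shows "triple_orbit C Z L (l, m, n) = triple_rel Z L M `` {(l, m, n)}"
proof (intro equalityI subsetI)
  have T: "Tri C Z M L l m n" using t by (simp add: triangle_triples_iff)
  from Tri_closed[OF T] have cl: "l \<in> Mor C Z M" "m \<in> Mor C M L" "n \<in> Mor C L (Sh C Z)" by auto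
  {
    fix t' assume "t' \<in> triple_orbit C Z L (l, m, n)"
    then obtain d b where bd: "d \<in> Aut C Z" "b \<in> Aut C L"
      and t': "t' = (d \<Zsemi> l, m \<Zsemi> inv_mor C L L b, twist C Z L d b n)"
      by (auto simp: triple_orbit_def)
    from bd obtain d' b' where d': "inverse_mor C Z Z d d'" and b': "inverse_mor C L L b b'"
      by (auto simp: Aut_iff is_iso_def)
    have dc: "d \<in> Mor C Z Z" "d' \<in> Mor C Z Z" "d' \<Zsemi> d = Ident C Z" using d' by (auto simp: inverse_mor_def)
    have bc: "b \<in> Mor C L L" "b' \<in> Mor C L L" "b' \<Zsemi> b = Ident C L" using b' by (auto simp: inverse_mor_def)
    have t'2: "t' = (d \<Zsemi> l, m \<Zsemi> b', b \<Zsemi> n \<Zsemi> Shm C d')"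
      by (simp add: t' inv_mor_eq[OF b'] twist_eq[OF d'])
    have "m \<Zsemi> b' \<Zsemi> b = m" using Comp_assoc[OF cl(2) bc(2,1)] bc(3) Id_right[OF cl(2)] by simp
    moreover have "b \<Zsemi> n \<Zsemi> Shm C d' \<Zsemi> Shm C d = b \<Zsemi> n"
      using Comp_assoc[OF comp_closed[OF bc(1) cl(3)] Shm_closed[OF dc(2)] Shm_closed[OF dc(1)]]
        Shm_Comp[OF dc(2,1)] dc(3) Id_right[OF comp_closed[OF bc(1) cl(3)]] by (simp add: Shm_Id)
    ultimately show "t' \<in> triple_rel Z L M `` {(l, m, n)}"
      using t Tri_act[OF T d' b'] bd unfolding t'2 triple_rel_def by (auto simp: triangle_triples_iff)
  next
    fix t' assume "t' \<in> triple_rel Z L M `` {(l, m, n)}"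
    then obtain l' m' n' d b where t': "t' = (l', m', n')" "Tri C Z M L l' m' n'" and bd: "d \<in> Aut C Z" "b \<in> Aut C L"
      and eq: "l' = d \<Zsemi> l" "m' \<Zsemi> b = m" "n' \<Zsemi> Shm C d = b \<Zsemi> n"
      by (auto simp: triple_rel_def triangle_triples_iff)
    from Tri_closed[OF t'(2)] have cl': "m' \<in> Mor C M L" "n' \<in> Mor C L (Sh C Z)" by auto
    from bd obtain d' b' where d': "inverse_mor C Z Z d d'" and b': "inverse_mor C L L b b'"
      by (auto simp: Aut_iff is_iso_def)
    have dc: "d \<in> Mor C Z Z" "d' \<in> Mor C Z Z" "d \<Zsemi> d' = Ident C Z" using d' by (auto simp: inverse_mor_def)
    have bc: "b \<in> Mor C L L" "b' \<in> Mor C L L" "b \<Zsemi> b' = Ident C L" using b' by (auto simp: inverse_mor_def)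
    have "m \<Zsemi> b' = m'" using Comp_assoc[OF cl'(1) bc(1,2)] bc(3) Id_right[OF cl'(1)] eq(2) by simp
    moreover have "b \<Zsemi> n \<Zsemi> Shm C d' = n'"
      using Comp_assoc[OF cl'(2) Shm_closed[OF dc(1)] Shm_closed[OF dc(2)]]
        Shm_Comp[OF dc(1,2)] dc(3) Id_right[OF cl'(2)] eq(3) by (simp add: Shm_Id)
    ultimately show "t' \<in> triple_orbit C Z L (l, m, n)"
      unfolding triple_orbit_def t'(1) eq(1) using bd inv_mor_eq[OF b'] twist_eq[OF d', of L b n] by force
  }
qed

text \<open>After one rotation \<open>m\<close> is the first map of both triangles, so uniqueness of
  the cone gives an automorphism of \<open>Z[1]\<close>; it is \<open>d[1]\<close> for an
  automorphism \<open>d\<close> of \<open>Z\<close>, and \<open>b\<close> is the identity.\<close>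

lemma triple_rel_same_middle:
  assumes "(l, m, n) \<in> triangle_triples C Z L M" "(l', m, n') \<in> triangle_triples C Z L M"
  shows "((l, m, n), (l', m, n')) \<in> triple_rel Z L M"
proof -
  have T: "Tri C Z M L l m n" "Tri C Z M L l' m n'" using assms by (auto simp: triangle_triples_iff)
  from Tri_closed[OF T(1)] Tri_closed[OF T(2)]
  have cl: "l \<in> Mor C Z M" "n \<in> Mor C L (Sh C Z)" "l' \<in> Mor C Z M" "n' \<in> Mor C L (Sh C Z)" "m \<in> Mor C M L" by auto
  obtain c where c: "is_iso C (Sh C Z) (Sh C Z) c" "n' \<Zsemi> c = n"
    "c \<Zsemi> (\<ominus>\<^bsub>Hom C (Sh C Z) (Sh C M)\<^esub> Shm C l) = \<ominus>\<^bsub>Hom C (Sh C Z) (Sh C M)\<^esub> Shm C l'"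
    by (rule Tri_cone_unique[OF Tri_rotated[OF T(2)] Tri_rotated[OF T(1)]])
  obtain d where d: "d \<in> Mor C Z Z" "Shm C d = c" using Shm_surj[OF is_iso_closed[OF c(1)]] .
  have "\<ominus>\<^bsub>Hom C (Sh C Z) (Sh C M)\<^esub> Shm C (d \<Zsemi> l) = \<ominus>\<^bsub>Hom C (Sh C Z) (Sh C M)\<^esub> Shm C l'"
    using c(3) comp_neg_right[OF is_iso_closed[OF c(1)] Shm_closed[OF cl(1)]] Shm_Comp[OF d(1) cl(1)] d(2) by simp
  then have "Shm C (d \<Zsemi> l) = Shm C l'"
    using Shm_closed[OF comp_closed[OF d(1) cl(1)]] Shm_closed[OF cl(3)] Hom.minus_minus by metis
  then have "l' = d \<Zsemi> l" using Shm_eq_iff[OF comp_closed[OF d(1) cl(1)] cl(3)] by simp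
  moreover have "d \<in> Aut C Z" using c(1) is_iso_Shm_iff[OF d(1)] d(2) by (simp add: Aut_iff)
  moreover have "m \<Zsemi> Ident C L = m" "n' \<Zsemi> Shm C d = Ident C L \<Zsemi> n" "Ident C L \<in> Aut C L"
    using Id_right[OF cl(5)] Id_left[OF cl(2)] c(2) d(2) is_iso_Ident by (simp_all add: Aut_iff)
  ultimately show ?thesis using assms unfolding triple_rel_def by blast
qed

text \<open>Uniqueness of the cone of \<open>l\<close> gives \<open>b\<close> directly, with
  \<open>d\<close> the identity.\<close>

lemma triple_rel_same_left:
  assumes "(l, m, n) \<in> triangle_triples C Z L M" "(l, m', n') \<in> triangle_triples C Z L M"
  shows "((l, m, n), (l, m', n')) \<in> triple_rel Z L M"
proof -
  have T: "Tri C Z M L l m n" "Tri C Z M L l m' n'" using assms by (auto simp: triangle_triples_iff)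
  from Tri_closed[OF T(1)] Tri_closed[OF T(2)]
  have cl: "l \<in> Mor C Z M" "n' \<in> Mor C L (Sh C Z)" by auto
  obtain c where c: "is_iso C L L c" "m' \<Zsemi> c = m" "c \<Zsemi> n = n'"
    by (rule Tri_cone_unique[OF T(2,1)])
  have "l = Ident C Z \<Zsemi> l" "n' \<Zsemi> Shm C (Ident C Z) = c \<Zsemi> n" "Ident C Z \<in> Aut C Z" "c \<in> Aut C L"
    using Id_left[OF cl(1)] Id_right[OF cl(2)] c is_iso_Ident by (simp_all add: Aut_iff Shm_Id)
  then show ?thesis using assms c(2) unfolding triple_rel_def by blast
qed

lemma equiv_triple_rel: "equiv (triangle_triples C Z L M) (triple_rel Z L M)"
proof (rule equivI)
  show "triple_rel Z L M \<subseteq> triangle_triples C Z L M \<times> triangle_triples C Z L M"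
    by (auto simp: triple_rel_def)
  show "refl_on (triangle_triples C Z L M) (triple_rel Z L M)"
  proof (rule refl_onI)
    fix t assume t: "t \<in> triangle_triples C Z L M"
    then show "(t, t) \<in> triple_rel Z L M" by (cases t) (blast intro: triple_rel_same_left)
  qed
  show "sym (triple_rel Z L M)"
  proof (rule symI)
    fix s t assume st: "(s, t) \<in> triple_rel Z L M"
    then obtain l m n l' m' n' d b where s: "s = (l, m, n)" and t: "t = (l', m', n')"
      and T: "Tri C Z M L l m n" "Tri C Z M L l' m' n'" and bd: "d \<in> Aut C Z" "b \<in> Aut C L"
      and eq: "l' = d \<Zsemi> l" "m' \<Zsemi> b = m" "n' \<Zsemi> Shm C d = b \<Zsemi> n"
      by (auto simp: triple_rel_def triangle_triples_iff)
    from Tri_closed[OF T(1)] Tri_closed[OF T(2)]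
    have cl: "l \<in> Mor C Z M" "n \<in> Mor C L (Sh C Z)" "m' \<in> Mor C M L" "n' \<in> Mor C L (Sh C Z)" by auto
    obtain d' where d: "d \<in> Mor C Z Z" "d' \<in> Aut C Z" "d' \<in> Mor C Z Z" "d \<Zsemi> d' = Ident C Z" "d' \<Zsemi> d = Ident C Z"
      by (rule Aut_inverse[OF bd(1)])
    obtain b' where b: "b \<in> Mor C L L" "b' \<in> Aut C L" "b' \<in> Mor C L L" "b \<Zsemi> b' = Ident C L" "b' \<Zsemi> b = Ident C L"
      by (rule Aut_inverse[OF bd(2)])
    note sd = Shm_closed[OF d(1)] Shm_closed[OF d(3)]
    have "l = d' \<Zsemi> l'" using comp_cancel_inverse[OF d(3,1,5) cl(1)] by (simp add: eq)
    moreover have "m \<Zsemi> b' = m'"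
      using Comp_assoc[OF cl(3) b(1,3)] b(4) Id_right[OF cl(3)] by (simp add: eq(2))
    moreover have "n \<Zsemi> Shm C d' = b' \<Zsemi> n'"
    proof -
      have "n = b' \<Zsemi> (n' \<Zsemi> Shm C d)" using comp_cancel_inverse[OF b(3,1,5) cl(2)] by (simp add: eq(3))
      then have "n \<Zsemi> Shm C d' = b' \<Zsemi> ((n' \<Zsemi> Shm C d) \<Zsemi> Shm C d')"
        using Comp_assoc[OF b(3) comp_closed[OF cl(4) sd(1)] sd(2)] by simp
      also have "(n' \<Zsemi> Shm C d) \<Zsemi> Shm C d' = n'"
        using Comp_assoc[OF cl(4) sd] Shm_Comp[OF d(1,3)] d(4) Id_right[OF cl(4)] by (simp add: Shm_Id)
      finally show ?thesis .
    qed
    ultimately show "(t, s) \<in> triple_rel Z L M"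
      using T d(2) b(2) unfolding s t triple_rel_def by (auto simp: triangle_triples_iff)
  qed
  show "trans (triple_rel Z L M)"
  proof (rule transI)
    fix s t u assume st: "(s, t) \<in> triple_rel Z L M" and tu: "(t, u) \<in> triple_rel Z L M"
    from st obtain l m n l' m' n' d b where s: "s = (l, m, n)" and t: "t = (l', m', n')"
      and T: "Tri C Z M L l m n" "Tri C Z M L l' m' n'" and bd: "d \<in> Aut C Z" "b \<in> Aut C L"
      and eq: "l' = d \<Zsemi> l" "m' \<Zsemi> b = m" "n' \<Zsemi> Shm C d = b \<Zsemi> n"
      by (auto simp: triple_rel_def triangle_triples_iff)
    from tu obtain k p q e c where u: "u = (k, p, q)"
      and T': "Tri C Z M L k p q" and ec: "e \<in> Aut C Z" "c \<in> Aut C L"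
      and eq': "k = e \<Zsemi> l'" "p \<Zsemi> c = m'" "q \<Zsemi> Shm C e = c \<Zsemi> n'"
      unfolding t by (auto simp: triple_rel_def triangle_triples_iff)
    from Tri_closed[OF T(1)] Tri_closed[OF T(2)] Tri_closed[OF T']
    have cl: "l \<in> Mor C Z M" "n \<in> Mor C L (Sh C Z)" "n' \<in> Mor C L (Sh C Z)" "p \<in> Mor C M L" "q \<in> Mor C L (Sh C Z)"
      by auto
    have mc: "d \<in> Mor C Z Z" "b \<in> Mor C L L" "e \<in> Mor C Z Z" "c \<in> Mor C L L"
      using bd ec is_iso_closed by (auto simp: Aut_iff)
    have "e \<Zsemi> d \<in> Aut C Z" "c \<Zsemi> b \<in> Aut C L" using bd ec is_iso_comp by (auto simp: Aut_iff)
    moreover have "k = (e \<Zsemi> d) \<Zsemi> l" using Comp_assoc[OF mc(3,1) cl(1)] by (simp add: eq eq')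
    moreover have "p \<Zsemi> (c \<Zsemi> b) = m" using Comp_assoc[OF cl(4) mc(4,2)] by (simp add: eq eq')
    moreover have "q \<Zsemi> Shm C (e \<Zsemi> d) = (c \<Zsemi> b) \<Zsemi> n"
    proof -
      have "q \<Zsemi> Shm C (e \<Zsemi> d) = (q \<Zsemi> Shm C e) \<Zsemi> Shm C d"
        using Comp_assoc[OF cl(5) Shm_closed[OF mc(3)] Shm_closed[OF mc(1)]] Shm_Comp[OF mc(3,1)] by simp
      also have "\<dots> = c \<Zsemi> (n' \<Zsemi> Shm C d)"
        using Comp_assoc[OF mc(4) cl(3) Shm_closed[OF mc(1)]] by (simp add: eq')
      also have "\<dots> = (c \<Zsemi> b) \<Zsemi> n" using Comp_assoc[OF mc(4,2) cl(2)] by (simp add: eq)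
      finally show ?thesis .
    qed
    ultimately show "(s, u) \<in> triple_rel Z L M"
      using T T' unfolding s u triple_rel_def by (auto simp: triangle_triples_iff)
  qed
qed

lemma triangle_orbits_eq_quotient:
  "triangle_orbits C Z L M = triangle_triples C Z L M // triple_rel Z L M"
proof -
  have "triple_orbit C Z L t = triple_rel Z L M `` {t}" if "t \<in> triangle_triples C Z L M" for t
    using that triple_orbit_eq by (cases t) blast
  then show ?thesis unfolding triangle_orbits_def quotient_def by auto
qed

lemma Mor_cone_eq_image_middle: "Mor_cone C M L (Sh C Z) = (\<lambda>(l, m, n). m) ` triangle_triples C Z L M"
proof (intro equalityI subsetI)
  fix m assume "m \<in> Mor_cone C M L (Sh C Z)"
  then obtain E g h s where m: "m \<in> Mor C M L" and T: "Tri C M L E m g h" and s: "is_iso C E (Sh C Z) s"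
    unfolding Mor_cone_def isomorphic_def by blast
  from Tri_closed[OF T] have cl: "g \<in> Mor C L E" "h \<in> Mor C E (Sh C M)" by auto
  from s obtain t where st: "s \<in> Mor C E (Sh C Z)" "t \<in> Mor C (Sh C Z) E" "s \<Zsemi> t = Ident C E"
    by (rule is_isoE)
  have gs: "g \<Zsemi> s \<in> Mor C L (Sh C Z)" and th: "t \<Zsemi> h \<in> Mor C (Sh C Z) (Sh C M)" using cl st by auto
  have T': "Tri C M L (Sh C Z) m (g \<Zsemi> s) (t \<Zsemi> h)"
    by (rule Tri_isomorphic[OF T m gs th is_iso_Ident is_iso_Ident s])
      (use comp_cancel_inverse[OF st cl(2)] m gs cl in \<open>simp_all add: Id_left Id_right Shm_Id\<close>)
  from th obtain x where x: "x \<in> Mor C Z M" "Shm C x = t \<Zsemi> h" by (rule Shm_surj)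
  \<comment> \<open>Rotation puts the negative of the translated first map in third place, hence the
    sign of \<open>x\<close>.\<close>
  have "Tri C Z M L (\<ominus>\<^bsub>Hom C Z M\<^esub> x) m (g \<Zsemi> s)"
    using Tri_rotate[of "\<ominus>\<^bsub>Hom C Z M\<^esub> x" Z M m L "g \<Zsemi> s"] T' x m gs th by (simp add: Shm_neg)
  then show "m \<in> (\<lambda>(l, m, n). m) ` triangle_triples C Z L M"
    by (auto simp: triangle_triples_iff image_iff intro!: bexI[of _ "(\<ominus>\<^bsub>Hom C Z M\<^esub> x, m, g \<Zsemi> s)"])
next
  fix m assume "m \<in> (\<lambda>(l, m, n). m) ` triangle_triples C Z L M"
  then obtain l n where T: "Tri C Z M L l m n" by (auto simp: triangle_triples_iff)
  then show "m \<in> Mor_cone C M L (Sh C Z)"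
    using Tri_rotated[OF T] Tri_closed[OF T] is_iso_Ident[of "Sh C Z"]
    unfolding Mor_cone_def isomorphic_def by blast
qed

lemma Mor_cone_eq_image_left: "Mor_cone C Z M L = (\<lambda>(l, m, n). l) ` triangle_triples C Z L M"
proof (intro equalityI subsetI)
  fix l assume "l \<in> Mor_cone C Z M L"
  then obtain E g h s where l: "l \<in> Mor C Z M" and T: "Tri C Z M E l g h" and s: "is_iso C E L s"
    unfolding Mor_cone_def isomorphic_def by blast
  from Tri_closed[OF T] have cl: "g \<in> Mor C M E" "h \<in> Mor C E (Sh C Z)" by auto
  from s obtain t where st: "s \<in> Mor C E L" "t \<in> Mor C L E" "s \<Zsemi> t = Ident C E"
    by (rule is_isoE)
  have gs: "g \<Zsemi> s \<in> Mor C M L" and th: "t \<Zsemi> h \<in> Mor C L (Sh C Z)" using cl st by auto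
  have "Tri C Z M L l (g \<Zsemi> s) (t \<Zsemi> h)"
    by (rule Tri_isomorphic[OF T l gs th is_iso_Ident is_iso_Ident s])
      (use comp_cancel_inverse[OF st cl(2)] l gs cl in \<open>simp_all add: Id_left Id_right Shm_Id\<close>)
  then show "l \<in> (\<lambda>(l, m, n). l) ` triangle_triples C Z L M"
    by (auto simp: triangle_triples_iff image_iff intro!: bexI[of _ "(l, g \<Zsemi> s, t \<Zsemi> h)"])
next
  fix l assume "l \<in> (\<lambda>(l, m, n). l) ` triangle_triples C Z L M"
  then obtain m n where T: "Tri C Z M L l m n" by (auto simp: triangle_triples_iff)
  then show "l \<in> Mor_cone C Z M L"
    using Tri_closed[OF T] is_iso_Ident[of L] unfolding Mor_cone_def isomorphic_def by blast
qed

text \<open>The action multiplies \<open>m\<close> by inverses of automorphisms of \<open>L\<close>.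
  These run through the whole group, so the image is the orbit under right multiplication.\<close>

lemma class_image_middle:
  assumes t: "(l, m, n) \<in> triangle_triples C Z L M"
  shows "(\<lambda>(l, m, n). m) ` (triple_rel Z L M `` {(l, m, n)}) = (\<lambda>b. m \<Zsemi> b) ` Aut C L"
proof (intro equalityI subsetI)
  have T: "Tri C Z M L l m n" using t by (simp add: triangle_triples_iff)
  from Tri_closed[OF T] have m: "m \<in> Mor C M L" by simp
  {
    fix x assume "x \<in> (\<lambda>(l, m, n). m) ` (triple_rel Z L M `` {(l, m, n)})"
    then obtain l' n' b where T': "Tri C Z M L l' x n'" and b: "b \<in> Aut C L" "x \<Zsemi> b = m"
      by (auto simp: triple_rel_def triangle_triples_iff)
    have x: "x \<in> Mor C M L" using Tri_closed[OF T'] by simp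
    obtain b' where b': "b \<in> Mor C L L" "b' \<in> Aut C L" "b' \<in> Mor C L L" "b \<Zsemi> b' = Ident C L" "b' \<Zsemi> b = Ident C L"
      by (rule Aut_inverse[OF b(1)])
    have "x = m \<Zsemi> b'" using Comp_assoc[OF x b'(1,3)] b(2) b'(4) Id_right[OF x] by simp
    then show "x \<in> (\<lambda>b. m \<Zsemi> b) ` Aut C L" using b'(2) by blast
  }
  fix x assume "x \<in> (\<lambda>b. m \<Zsemi> b) ` Aut C L"
  then obtain b where b: "b \<in> Aut C L" "x = m \<Zsemi> b" by blast
  obtain b' where b': "b \<in> Mor C L L" "b' \<in> Aut C L" "b' \<in> Mor C L L" "b \<Zsemi> b' = Ident C L" "b' \<Zsemi> b = Ident C L"
    by (rule Aut_inverse[OF b(1)])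
  have "inv_mor C L L b' = b" by (rule inv_mor_eq) (use b' in \<open>simp add: inverse_mor_def\<close>)
  moreover have "Ident C Z \<in> Aut C Z" by (simp add: Aut_iff is_iso_Ident)
  ultimately have "(Ident C Z \<Zsemi> l, x, twist C Z L (Ident C Z) b' n) \<in> triple_orbit C Z L (l, m, n)"
    using b(2) b'(2) unfolding triple_orbit_def by force
  then show "x \<in> (\<lambda>(l, m, n). m) ` (triple_rel Z L M `` {(l, m, n)})"
    unfolding triple_orbit_eq[OF t] by force
qed

lemma class_image_left:
  assumes t: "(l, m, n) \<in> triangle_triples C Z L M"
  shows "(\<lambda>(l, m, n). l) ` (triple_rel Z L M `` {(l, m, n)}) = (\<lambda>d. d \<Zsemi> l) ` Aut C Z"
proof (intro equalityI subsetI)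
  fix x assume "x \<in> (\<lambda>(l, m, n). l) ` (triple_rel Z L M `` {(l, m, n)})"
  then show "x \<in> (\<lambda>d. d \<Zsemi> l) ` Aut C Z" by (auto simp: triple_rel_def)
next
  fix x assume "x \<in> (\<lambda>d. d \<Zsemi> l) ` Aut C Z"
  then obtain d where d: "d \<in> Aut C Z" "x = d \<Zsemi> l" by blast
  moreover have "Ident C L \<in> Aut C L" by (simp add: Aut_iff is_iso_Ident)
  ultimately have "(x, m \<Zsemi> inv_mor C L L (Ident C L), twist C Z L d (Ident C L) n) \<in> triple_orbit C Z L (l, m, n)"
    unfolding triple_orbit_def by force
  then show "x \<in> (\<lambda>(l, m, n). l) ` (triple_rel Z L M `` {(l, m, n)})"
    unfolding triple_orbit_eq[OF t] by force
qed

end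

section \<open>Radical morphisms and invertibility\<close>

text \<open>These are conditions (1) to (3) in the form used for counting: finite Hom sets, local
  endomorphism rings, and vanishing of \<open>Hom(X[i],Y)\<close> for large
  \<open>i\<close>.\<close>

locale finite_triangulated_category = triangulated_linear_category +
  assumes finite_Hom: "finite (Mor C X Y)"
    and local_End: "indecomposable C X \<Longrightarrow> local_ring (End_ring C X)"
    and Hom_Sh_eventually_zero:
      "\<exists>N. \<forall>i\<ge>N. Mor C ((Sh C ^^ i) X) Y = {\<zero>\<^bsub>Hom C ((Sh C ^^ i) X) Y\<^esub>}"
begin

text \<open>The order of the endomorphism ring serves as the size of an object. Here
  \<open>a\<close> is recovered from \<open>pai\<close> by composing with \<open>i\<close> and
  \<open>p\<close>.\<close>

lemma card_End_retract_le:
  assumes i: "i \<in> Mor C A X" and p: "p \<in> Mor C X A" and ip: "i \<Zsemi> p = Ident C A"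
  shows "inj_on (\<lambda>a. p \<Zsemi> (a \<Zsemi> i)) (Mor C A A)" and "card (Mor C A A) \<le> card (Mor C X X)"
proof -
  have "(i \<Zsemi> (p \<Zsemi> (a \<Zsemi> i))) \<Zsemi> p = a" if a: "a \<in> Mor C A A" for a
    using comp_cancel_inverse[OF i p ip comp_closed[OF a i]] Comp_assoc[OF a i p] ip Id_right[OF a] by simp
  then show "inj_on (\<lambda>a. p \<Zsemi> (a \<Zsemi> i)) (Mor C A A)" by (rule inj_on_inverseI)
  then show "card (Mor C A A) \<le> card (Mor C X X)"
    by (rule card_inj_on_le) (use i p finite_Hom in auto)
qed

text \<open>The endomorphisms \<open>pai\<close> miss the identity of \<open>X\<close>: if one were
  the identity, \<open>j\<close> would factor through \<open>jp = 0\<close>, making \<open>B\<close>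
  zero. The strict inequality drives the induction below and the maximality argument for
  \<open>L1\<close>.\<close>

lemma card_End_biproduct_less:
  assumes bi: "biproduct C X A B i j p q" and B: "\<not> zero_object C B"
  shows "card (Mor C A A) < card (Mor C X X)"
proof -
  note b = biproduct_closed[OF bi]
  have ip: "i \<Zsemi> p = Ident C A" and jp: "j \<Zsemi> p = \<zero>\<^bsub>Hom C B A\<^esub>" and jq: "j \<Zsemi> q = Ident C B"
    using bi by (simp_all add: biproduct_def)
  have "p \<Zsemi> (a \<Zsemi> i) \<noteq> Ident C X" if a: "a \<in> Mor C A A" for a
  proof
    assume eq: "p \<Zsemi> (a \<Zsemi> i) = Ident C X"
    have ai: "a \<Zsemi> i \<in> Mor C A X" using a b(1) by blast
    have "j = (j \<Zsemi> p) \<Zsemi> (a \<Zsemi> i)"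
      using Comp_assoc[OF b(2,3) ai] eq Id_right[OF b(2)] by simp
    then have "j = \<zero>\<^bsub>Hom C B X\<^esub>" using jp comp_zero_left[OF ai] by simp
    then have "Ident C B = \<zero>\<^bsub>Hom C B B\<^esub>" using jq comp_zero_left[OF b(4)] by simp
    with B show False by (simp add: zero_object_iff)
  qed
  then have "(\<lambda>a. p \<Zsemi> (a \<Zsemi> i)) ` Mor C A A \<subseteq> Mor C X X - {Ident C X}"
    using b by auto
  then have "card (Mor C A A) \<le> card (Mor C X X - {Ident C X})"
    using finite_Hom by (intro card_inj_on_le[OF card_End_retract_le(1)[OF b(1,3) ip]]) auto
  also have "\<dots> < card (Mor C X X)" by (intro card_Diff1_less finite_Hom Id_closed)
  finally show ?thesis .
qed

text \<open>Induction along a decomposition into indecomposables. For \<open>X = A \<oplus> B\<close> the morphism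
  \<open>1 + rg\<close> is a product of two factors, and \<open>1 + ab\<close> is invertible if and only if \<open>1 + ba\<close>
  is, so that each factor can be moved to \<open>A\<close> or \<open>B\<close>.\<close>

lemma is_iso_one_plus_radHom:
  assumes "r \<in> radHom C X Y" "g \<in> Mor C Y X"
  shows "is_iso C X X (Ident C X \<oplus>\<^bsub>Hom C X X\<^esub> (r \<Zsemi> g))"
  using assms
proof (induction "card (Mor C X X)" arbitrary: X r g rule: less_induct)
  case less
  have r: "r \<in> Mor C X Y" using less.prems(1) by (rule radHom_closed)
  have rg: "r \<Zsemi> g \<in> Mor C X X" using r less.prems(2) by blast
  consider "zero_object C X" | "indecomposable C X"
    | A B i j p q where "biproduct C X A B i j p q" "\<not> zero_object C A" "\<not> zero_object C B"
    unfolding indecomposable_def by blast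
  then show ?case
  proof cases
    case 1
    then have "Ident C X \<oplus>\<^bsub>Hom C X X\<^esub> (r \<Zsemi> g) = Ident C X"
      using zero_object_eq_zero(1)[OF 1 rg] by (simp add: Id_closed)
    then show ?thesis using is_iso_Ident by simp
  next
    case 2
    \<comment> \<open>The definition of the radical is applied to the indecomposable object
      \<open>X\<close> itself, with the identity on the left.\<close>
    then have "\<not> is_iso C X X (r \<Zsemi> g)"
      using less.prems Id_left[OF r] Id_closed[of X] unfolding radHom_def by force
    then show ?thesis using local_End_one_plus[OF local_End[OF 2] rg] by simp
  next
    case 3
    note b = biproduct_closed[OF 3(1)]
    note rA = radHom_comp_left[OF b(1) less.prems(1)] and rB = radHom_comp_left[OF b(2) less.prems(1)]
    let ?a = "(i \<Zsemi> r) \<Zsemi> g" and ?b = "(j \<Zsemi> r) \<Zsemi> g"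
    have a: "?a \<in> Mor C A X" and bb: "?b \<in> Mor C B X" using b r less.prems(2) by auto
    have "is_iso C A A (Ident C A \<oplus>\<^bsub>Hom C A A\<^esub> ((i \<Zsemi> r) \<Zsemi> (g \<Zsemi> p)))"
      by (rule less.hyps[OF card_End_biproduct_less[OF 3(1,3)] rA]) (use less.prems(2) b in blast)
    then have "is_iso C X X (Ident C X \<oplus>\<^bsub>Hom C X X\<^esub> (p \<Zsemi> ?a))"
      using is_iso_one_plus_swap[OF a b(3)] Comp_assoc[OF comp_closed[OF b(1) r] less.prems(2) b(3)] by simp
    then obtain u where u: "inverse_mor C X X (Ident C X \<oplus>\<^bsub>Hom C X X\<^esub> (p \<Zsemi> ?a)) u"
      by (auto simp: is_iso_def)
    then have u': "u \<in> Mor C X X" by (simp add: inverse_mor_def)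
    have uq: "u \<Zsemi> q \<in> Mor C X B" using u' b by blast
    \<comment> \<open>With \<open>w = 1 + p a\<close> and \<open>u\<close> its inverse,
      \<open>1 + rg = w + q b = w (1 + uq b)\<close>, writing \<open>a\<close> and \<open>b\<close>
      for \<open>?a\<close> and \<open>?b\<close>. The last factor swaps to \<open>1 + b uq\<close>
      on \<open>B\<close>, where the induction hypothesis applies because \<open>jr\<close> is
      radical.\<close>
    have "is_iso C B B (Ident C B \<oplus>\<^bsub>Hom C B B\<^esub> ((j \<Zsemi> r) \<Zsemi> (g \<Zsemi> (u \<Zsemi> q))))"
      by (rule less.hyps[OF card_End_biproduct_less[OF biproduct_swap[OF 3(1)] 3(2)] rB])
        (use less.prems(2) uq in blast)
    then have "is_iso C X X (Ident C X \<oplus>\<^bsub>Hom C X X\<^esub> ((u \<Zsemi> q) \<Zsemi> ?b))"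
      using is_iso_one_plus_swap[OF bb uq] Comp_assoc[OF comp_closed[OF b(2) r] less.prems(2) uq] by simp
    then have "is_iso C X X ((Ident C X \<oplus>\<^bsub>Hom C X X\<^esub> (p \<Zsemi> ?a)) \<oplus>\<^bsub>Hom C X X\<^esub> (q \<Zsemi> ?b))"
      using Comp_assoc[OF u' b(4) bb] comp_closed[OF b(4) bb] by (intro is_iso_add[OF u]) simp_all
    moreover have "(Ident C X \<oplus>\<^bsub>Hom C X X\<^esub> (p \<Zsemi> ?a)) \<oplus>\<^bsub>Hom C X X\<^esub> (q \<Zsemi> ?b) = Ident C X \<oplus>\<^bsub>Hom C X X\<^esub> (r \<Zsemi> g)"
      using biproduct_decompose[OF 3(1) rg] Comp_assoc[OF b(1) r less.prems(2)]
        Comp_assoc[OF b(2) r less.prems(2)] comp_closed[OF b(3) a] comp_closed[OF b(4) bb]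
      by (simp add: Hom.a_assoc Id_closed)
    ultimately show ?thesis by simp
  qed
qed

lemma is_iso_add_radHom:
  assumes w: "is_iso C X X w" and r: "r \<in> radHom C X Y" and g: "g \<in> Mor C Y X"
  shows "is_iso C X X (w \<oplus>\<^bsub>Hom C X X\<^esub> (r \<Zsemi> g))"
proof -
  obtain u where u: "inverse_mor C X X w u" using w by (auto simp: is_iso_def)
  then have u': "u \<in> Mor C X X" by (simp add: inverse_mor_def)
  show ?thesis
    using is_iso_one_plus_radHom[OF radHom_comp_left[OF u' r] g] Comp_assoc[OF u' radHom_closed[OF r] g]
      comp_closed[OF radHom_closed[OF r] g]
    by (intro is_iso_add[OF u]) simp_all
qed

lemma is_iso_add_radHom_iff:
  assumes w: "w \<in> Mor C X X" and r: "r \<in> radHom C X Y" and g: "g \<in> Mor C Y X"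
  shows "is_iso C X X (w \<oplus>\<^bsub>Hom C X X\<^esub> (r \<Zsemi> g)) \<longleftrightarrow> is_iso C X X w"
proof
  assume iso: "is_iso C X X (w \<oplus>\<^bsub>Hom C X X\<^esub> (r \<Zsemi> g))"
  note r' = radHom_closed[OF r]
  \<comment> \<open>The converse is the direct implication for \<open>-g\<close>.\<close>
  have "is_iso C X X ((w \<oplus>\<^bsub>Hom C X X\<^esub> (r \<Zsemi> g)) \<oplus>\<^bsub>Hom C X X\<^esub> (r \<Zsemi> (\<ominus>\<^bsub>Hom C Y X\<^esub> g)))"
    by (rule is_iso_add_radHom[OF iso r]) (use g in simp)
  then show "is_iso C X X w"
    using w comp_closed[OF r' g] comp_neg_right[OF r' g] by (simp add: Hom.a_assoc Hom.r_neg)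
qed (use is_iso_add_radHom r g in blast)

section \<open>Existence of the block-diagonal form\<close>

text \<open>When \<open>n\<close> restricts to identities on \<open>S\<close> and on
  \<open>A\<close> with vanishing cross terms, it restricts to the identity on their biproduct. As
  \<open>A\<close> is nonzero, the endomorphism ring grows strictly, against a maximal choice of
  \<open>S\<close>.\<close>

lemma retract_enlarge:
  assumes n: "n \<in> Mor C L V" and g: "g \<in> Mor C S L" and h: "h \<in> Mor C V S"
    and gnh: "(g \<Zsemi> n) \<Zsemi> h = Ident C S"
    and g': "g' \<in> Mor C A L" and h': "h' \<in> Mor C V A"
    and gnh': "(g' \<Zsemi> n) \<Zsemi> h' = Ident C A"
    and orth: "(g \<Zsemi> n) \<Zsemi> h' = \<zero>\<^bsub>Hom C S A\<^esub>" "(g' \<Zsemi> n) \<Zsemi> h = \<zero>\<^bsub>Hom C A S\<^esub>"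
    and A: "\<not> zero_object C A"
  obtains B G H where "G \<in> Mor C B L" "H \<in> Mor C V B" "(G \<Zsemi> n) \<Zsemi> H = Ident C B"
    "card (Mor C S S) < card (Mor C B B)"
proof -
  obtain B i j p q where bi: "biproduct C B S A i j p q" using biproduct_exists by blast
  note b = biproduct_closed[OF bi]
  have bb: "(p \<Zsemi> i) \<oplus>\<^bsub>Hom C B B\<^esub> (q \<Zsemi> j) = Ident C B" using bi by (simp add: biproduct_def)
  have gn: "g \<Zsemi> n \<in> Mor C S V" and gn': "g' \<Zsemi> n \<in> Mor C A V" using n g g' by auto
  have cl: "p \<Zsemi> g \<in> Mor C B L" "q \<Zsemi> g' \<in> Mor C B L" "h \<Zsemi> i \<in> Mor C V B" "h' \<Zsemi> j \<in> Mor C V B"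
    "p \<Zsemi> (g \<Zsemi> n) \<in> Mor C B V" "q \<Zsemi> (g' \<Zsemi> n) \<in> Mor C B V"
    using b g g' h h' gn gn' by auto
  define G where "G = p \<Zsemi> g \<oplus>\<^bsub>Hom C B L\<^esub> q \<Zsemi> g'"
  define H where "H = h \<Zsemi> i \<oplus>\<^bsub>Hom C V B\<^esub> h' \<Zsemi> j"
  have G: "G \<in> Mor C B L" and H: "H \<in> Mor C V B" using cl by (simp_all add: G_def H_def)
  have 1: "(g \<Zsemi> n) \<Zsemi> H = i"
    using b(1) by (simp add: H_def comp_add_right[OF gn cl(3,4)] Comp_assoc[OF gn h b(1), symmetric]
        Comp_assoc[OF gn h' b(2), symmetric] gnh orth(1) Id_left[OF b(1)] comp_zero_left[OF b(2)])
  have 2: "(g' \<Zsemi> n) \<Zsemi> H = j"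
    using b(2) by (simp add: H_def comp_add_right[OF gn' cl(3,4)] Comp_assoc[OF gn' h b(1), symmetric]
        Comp_assoc[OF gn' h' b(2), symmetric] gnh' orth(2) Id_left[OF b(2)] comp_zero_left[OF b(1)])
  have "G \<Zsemi> n = p \<Zsemi> (g \<Zsemi> n) \<oplus>\<^bsub>Hom C B V\<^esub> q \<Zsemi> (g' \<Zsemi> n)"
    using comp_add_left[OF cl(1,2) n] Comp_assoc[OF b(3) g n] Comp_assoc[OF b(4) g' n] by (simp add: G_def)
  then have "(G \<Zsemi> n) \<Zsemi> H = p \<Zsemi> i \<oplus>\<^bsub>Hom C B B\<^esub> q \<Zsemi> j"
    using comp_add_left[OF cl(5,6) H] Comp_assoc[OF b(3) gn H] Comp_assoc[OF b(4) gn' H] 1 2 by simp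
  then show ?thesis using that[OF G H] bb card_End_biproduct_less[OF bi A] by simp
qed

text \<open>\<open>L\<^sub>1\<close> is chosen with the largest endomorphism ring among the objects on which \<open>n\<close> restricts to
  a split isomorphism; a non-radical remainder would allow a larger choice.\<close>

lemma diag_form_exists:
  assumes n: "n \<in> Mor C L (Sh C Z)"
  shows "\<exists>L1. diag_form C Z L n L1"
proof -
  let ?P = "\<lambda>S. \<exists>g h. g \<in> Mor C S L \<and> h \<in> Mor C (Sh C Z) S \<and> (g \<Zsemi> n) \<Zsemi> h = Ident C S"
  obtain U where U: "zero_object C U" using zero_object_exists by blast
  have "?P U"
  proof (intro exI conjI)
    have "\<zero>\<^bsub>Hom C U L\<^esub> \<Zsemi> n \<in> Mor C U (Sh C Z)" using n by auto
    then have "(\<zero>\<^bsub>Hom C U L\<^esub> \<Zsemi> n) \<Zsemi> \<zero>\<^bsub>Hom C (Sh C Z) U\<^esub> = \<zero>\<^bsub>Hom C U U\<^esub>"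
      by (rule comp_zero_right)
    then show "(\<zero>\<^bsub>Hom C U L\<^esub> \<Zsemi> n) \<Zsemi> \<zero>\<^bsub>Hom C (Sh C Z) U\<^esub> = Ident C U"
      using U by (simp add: zero_object_iff)
  qed auto
  moreover have "card (Mor C S S) < Suc (card (Mor C L L))" if "?P S" for S
  proof -
    from that obtain g h where gh: "g \<in> Mor C S L" "h \<in> Mor C (Sh C Z) S" "(g \<Zsemi> n) \<Zsemi> h = Ident C S"
      by blast
    then have "g \<Zsemi> (n \<Zsemi> h) = Ident C S" using Comp_assoc[OF gh(1) n gh(2)] by simp
    then show ?thesis using card_End_retract_le(2)[OF gh(1) comp_closed[OF n gh(2)]] by simp
  qed
  ultimately obtain L1 where "?P L1" and max: "\<And>S. ?P S \<Longrightarrow> card (Mor C S S) \<le> card (Mor C L1 L1)"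
    using ex_has_greatest_nat[of ?P U "\<lambda>S. card (Mor C S S)" "Suc (card (Mor C L L))"] by blast
  then obtain g h where g: "g \<in> Mor C L1 L" and h: "h \<in> Mor C (Sh C Z) L1"
    and gnh: "(g \<Zsemi> n) \<Zsemi> h = Ident C L1" by blast
  have nh: "n \<Zsemi> h \<in> Mor C L L1" and gn: "g \<Zsemi> n \<in> Mor C L1 (Sh C Z)" using n g h by auto
  \<comment> \<open>The identity \<open>gnh = 1\<close> splits both ends at once: \<open>L1\<close>
    embeds in \<open>L\<close> by \<open>g\<close> with retraction \<open>nh\<close>, and in
    \<open>Z[1]\<close> by \<open>gn\<close> with retraction \<open>h\<close>. In these
    decompositions \<open>n\<close> is diagonal, with the identity of \<open>L1\<close> and
    \<open>r = jne\<close> as entries.\<close>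
  have "g \<Zsemi> (n \<Zsemi> h) = Ident C L1" using Comp_assoc[OF g n h] gnh by simp
  then obtain L2 j c where bL: "biproduct C L L1 L2 g j (n \<Zsemi> h) c"
    by (rule split_mono_complement[OF g nh])
  obtain V2 k e where bV: "biproduct C (Sh C Z) L1 V2 (g \<Zsemi> n) k h e"
    by (rule split_mono_complement[OF gn h gnh])
  note j = biproduct_closed(2)[OF bL] and c = biproduct_closed(4)[OF bL]
  note k = biproduct_closed(2)[OF bV] and e = biproduct_closed(4)[OF bV]
  have jn: "j \<Zsemi> n \<in> Mor C L2 (Sh C Z)" and ne: "n \<Zsemi> e \<in> Mor C L V2" using j n e by auto
  have jnh: "(j \<Zsemi> n) \<Zsemi> h = \<zero>\<^bsub>Hom C L2 L1\<^esub>" using bL Comp_assoc[OF j n h] by (simp add: biproduct_def)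
  have gne: "(g \<Zsemi> n) \<Zsemi> e = \<zero>\<^bsub>Hom C L1 V2\<^esub>" using bV by (simp add: biproduct_def)
  define r where "r = (j \<Zsemi> n) \<Zsemi> e"
  have r: "r \<in> Mor C L2 V2" using jn e by (auto simp: r_def)
  have rad: "r \<in> radHom C L2 V2"
    unfolding radHom_def
  proof (clarify, intro conjI allI impI notI)
    show "r \<in> Mor C L2 V2" by fact
    fix A s t
    assume *: "indecomposable C A \<and> s \<in> Mor C A L2 \<and> t \<in> Mor C V2 A" and iso: "is_iso C A A (s \<Zsemi> r \<Zsemi> t)"
    then have s: "s \<in> Mor C A L2" and t: "t \<in> Mor C V2 A" and A: "\<not> zero_object C A"
      by (auto simp: indecomposable_def)
    from iso obtain v where v: "v \<in> Mor C A A" "(s \<Zsemi> r \<Zsemi> t) \<Zsemi> v = Ident C A" by (rule is_isoE)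
    \<comment> \<open>After normalization by \<open>v\<close>, the morphisms \<open>sj\<close> and
      \<open>etv\<close> exhibit \<open>A\<close> as a second such retract, orthogonal to
      \<open>L1\<close>.\<close>
    have tv: "t \<Zsemi> v \<in> Mor C V2 A" and sj: "s \<Zsemi> j \<in> Mor C A L" using s j t v by auto
    have etv: "e \<Zsemi> (t \<Zsemi> v) \<in> Mor C (Sh C Z) A" using e tv by blast
    have sjn: "(s \<Zsemi> j) \<Zsemi> n = s \<Zsemi> (j \<Zsemi> n)" by (rule Comp_assoc[OF s j n])
    have sjn': "s \<Zsemi> (j \<Zsemi> n) \<in> Mor C A (Sh C Z)" using s jn by blast
    have "((s \<Zsemi> j) \<Zsemi> n) \<Zsemi> (e \<Zsemi> (t \<Zsemi> v)) = Ident C A"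
      using Comp_assoc[OF sjn' e tv] Comp_assoc[OF s jn e] Comp_assoc[OF comp_closed[OF s r] t v(1)] v(2)
      by (simp add: sjn r_def)
    moreover have "((s \<Zsemi> j) \<Zsemi> n) \<Zsemi> h = \<zero>\<^bsub>Hom C A L1\<^esub>"
      using Comp_assoc[OF s jn h] jnh comp_zero_right[OF s] by (simp add: sjn)
    moreover have "(g \<Zsemi> n) \<Zsemi> (e \<Zsemi> (t \<Zsemi> v)) = \<zero>\<^bsub>Hom C L1 A\<^esub>"
      using Comp_assoc[OF gn e tv] gne comp_zero_left[OF tv] by simp
    ultimately have *: "((s \<Zsemi> j) \<Zsemi> n) \<Zsemi> (e \<Zsemi> (t \<Zsemi> v)) = Ident C A"
      "(g \<Zsemi> n) \<Zsemi> (e \<Zsemi> (t \<Zsemi> v)) = \<zero>\<^bsub>Hom C L1 A\<^esub>" "((s \<Zsemi> j) \<Zsemi> n) \<Zsemi> h = \<zero>\<^bsub>Hom C A L1\<^esub>" by auto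
    obtain B G H where "G \<in> Mor C B L" "H \<in> Mor C (Sh C Z) B" "(G \<Zsemi> n) \<Zsemi> H = Ident C B"
      "card (Mor C L1 L1) < card (Mor C B B)"
      by (rule retract_enlarge[OF n g h gnh sj etv * A])
    then show False using max[of B] by auto
  qed
  have "j \<Zsemi> n = ((j \<Zsemi> n) \<Zsemi> h) \<Zsemi> (g \<Zsemi> n) \<oplus>\<^bsub>Hom C L2 (Sh C Z)\<^esub> ((j \<Zsemi> n) \<Zsemi> e) \<Zsemi> k"
    by (rule biproduct_decompose_right[OF bV jn])
  also have "\<dots> = r \<Zsemi> k"
    using comp_closed[OF r k] by (simp add: jnh comp_zero_left[OF gn] flip: r_def)
  finally have jn_eq: "j \<Zsemi> n = r \<Zsemi> k" .
  have n_eq: "n = (n \<Zsemi> h) \<Zsemi> (g \<Zsemi> n) \<oplus>\<^bsub>Hom C L (Sh C Z)\<^esub> c \<Zsemi> (r \<Zsemi> k)"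
    using biproduct_decompose[OF bL n] unfolding jn_eq .
  \<comment> \<open>The summands of \<open>Z[1]\<close> have to be translates. Essential
    surjectivity supplies \<open>Z1\<close> and \<open>Z2\<close>, and fullness brings the structure
    maps down to \<open>Z\<close>.\<close>
  obtain Z1 s where s: "is_iso C (Sh C Z1) L1 s"
    using Sh_essentially_surjective[of L1] by (auto simp: isomorphic_def)
  then obtain t where t: "inverse_mor C (Sh C Z1) L1 s t" by (auto simp: is_iso_def)
  obtain Z2 s' where s': "is_iso C (Sh C Z2) V2 s'"
    using Sh_essentially_surjective[of V2] by (auto simp: isomorphic_def)
  then obtain t' where t': "inverse_mor C (Sh C Z2) V2 s' t'" by (auto simp: is_iso_def)
  have st: "s \<in> Mor C (Sh C Z1) L1" "t \<in> Mor C L1 (Sh C Z1)" "t \<Zsemi> s = Ident C L1"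
    using t by (auto simp: inverse_mor_def)
  have st': "s' \<in> Mor C (Sh C Z2) V2" "t' \<in> Mor C V2 (Sh C Z2)" "t' \<Zsemi> s' = Ident C V2"
    using t' by (auto simp: inverse_mor_def)
  note bS = biproduct_iso[OF bV t t']
  obtain j1 where j1: "j1 \<in> Mor C Z1 Z" "Shm C j1 = s \<Zsemi> (g \<Zsemi> n)"
    using Shm_surj[OF biproduct_closed(1)[OF bS]] .
  obtain j2 where j2: "j2 \<in> Mor C Z2 Z" "Shm C j2 = s' \<Zsemi> k"
    using Shm_surj[OF biproduct_closed(2)[OF bS]] .
  obtain q1 where q1: "q1 \<in> Mor C Z Z1" "Shm C q1 = h \<Zsemi> t"
    using Shm_surj[OF biproduct_closed(3)[OF bS]] .
  obtain q2 where q2: "q2 \<in> Mor C Z Z2" "Shm C q2 = e \<Zsemi> t'"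
    using Shm_surj[OF biproduct_closed(4)[OF bS]] .
  have bZ: "biproduct C Z Z1 Z2 j1 j2 q1 q2"
    using biproduct_Shm_iff[OF j1(1) j2(1) q1(1) q2(1)] bS j1 j2 q1 q2 by simp
  have 1: "(n \<Zsemi> h) \<Zsemi> t \<Zsemi> Shm C j1 = (n \<Zsemi> h) \<Zsemi> (g \<Zsemi> n)"
    using Comp_assoc[OF nh st(2) comp_closed[OF st(1) gn]] comp_cancel_inverse[OF st(2,1,3) gn]
    by (simp add: j1)
  have "(r \<Zsemi> t') \<Zsemi> (s' \<Zsemi> k) = r \<Zsemi> k"
    using Comp_assoc[OF r st'(2) comp_closed[OF st'(1) k]] comp_cancel_inverse[OF st'(2,1,3) k] by simp
  then have 2: "c \<Zsemi> (r \<Zsemi> t') \<Zsemi> Shm C j2 = c \<Zsemi> (r \<Zsemi> k)"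
    using Comp_assoc[OF c comp_closed[OF r st'(2)] comp_closed[OF st'(1) k]] by (simp add: j2)
  \<comment> \<open>Identities serve as \<open>b\<close> and \<open>d\<close>, since the two
    decompositions already absorb the change of basis; the diagonal entries are \<open>t\<close> and
    \<open>r t'\<close>.\<close>
  have tw: "twist C Z L (Ident C Z) (Ident C L) n =
      ((n \<Zsemi> h) \<Zsemi> t \<Zsemi> Shm C j1) \<oplus>\<^bsub>Hom C L (Sh C Z)\<^esub> (c \<Zsemi> (r \<Zsemi> t') \<Zsemi> Shm C j2)"
    unfolding twist_Ident[OF n] 1 2 by (rule n_eq)
  have aut: "Ident C X \<in> Aut C X" for X by (simp add: Aut_iff is_iso_Ident)
  show ?thesis
    unfolding diag_form_def
    by (intro exI conjI, rule bL, rule bZ, rule aut, rule aut, rule is_iso_inverse[OF t],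
        rule radHom_comp_right[OF rad st'(2)], rule tw)
qed

section \<open>The proportion of invertible \<open>1 + nx\<close>\<close>

text \<open>Once the radical block is dropped, what remains is \<open>1 + p1 y\<close> with
  \<open>y = n11 j1 x\<close>, and the swap moves it to \<open>1 + y p1\<close> in
  \<open>End L1\<close>. The map \<open>\<phi>\<close> sending \<open>x\<close> to
  \<open>y p1\<close> is a surjective homomorphism, so the proportion can be counted in
  \<open>End L1\<close>.\<close>

lemma card_one_plus_block:
  assumes bL: "biproduct C L L1 L2 i1 i2 p1 p2" and bV: "biproduct C V V1 V2 j1 j2 q1 q2"
    and iso: "is_iso C L1 V1 n11" and rad: "n22 \<in> radHom C L2 V2"
    and n: "n = p1 \<Zsemi> n11 \<Zsemi> j1 \<oplus>\<^bsub>Hom C L V\<^esub> p2 \<Zsemi> n22 \<Zsemi> j2"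
  shows "card {x \<in> Mor C V L. is_iso C L L (Ident C L \<oplus>\<^bsub>Hom C L L\<^esub> n \<Zsemi> x)} * card (Mor C L1 L1) =
    card (Aut C L1) * card (Mor C V L)"
proof -
  note b = biproduct_closed[OF bL] and v = biproduct_closed[OF bV]
  from iso obtain m where m: "n11 \<in> Mor C L1 V1" "m \<in> Mor C V1 L1" "n11 \<Zsemi> m = Ident C L1"
    by (rule is_isoE)
  note n22 = radHom_closed[OF rad]
  have nj: "n11 \<Zsemi> j1 \<in> Mor C L1 V" using m v by blast
  have cl: "p1 \<Zsemi> n11 \<Zsemi> j1 \<in> Mor C L V" "p2 \<Zsemi> n22 \<Zsemi> j2 \<in> Mor C L V" using b v m n22 by (meson comp_closed)+
  have rad2: "p2 \<Zsemi> n22 \<Zsemi> j2 \<in> radHom C L V"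
    by (rule radHom_comp_right[OF radHom_comp_left[OF b(4) rad] v(2)])
  define \<phi> where "\<phi> x = ((n11 \<Zsemi> j1) \<Zsemi> x) \<Zsemi> p1" for x
  define S where "S = {y \<in> Mor C L1 L1. is_iso C L1 L1 (Ident C L1 \<oplus>\<^bsub>Hom C L1 L1\<^esub> y)}"
  have \<phi>: "\<phi> x \<in> Mor C L1 L1" if "x \<in> Mor C V L" for x
    using that nj b unfolding \<phi>_def by blast
  have add: "\<phi> (x \<oplus>\<^bsub>Hom C V L\<^esub> y) = \<phi> x \<oplus>\<^bsub>Hom C L1 L1\<^esub> \<phi> y" if "x \<in> Mor C V L" "y \<in> Mor C V L" for x y
    using that comp_add_right[OF nj that] comp_add_left[OF _ _ b(3), of "(n11 \<Zsemi> j1) \<Zsemi> x" L1 "(n11 \<Zsemi> j1) \<Zsemi> y"] nj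
    by (simp add: \<phi>_def comp_closed[OF nj])
  have surj: "\<phi> ` Mor C V L = Mor C L1 L1"
  proof (intro equalityI subsetI)
    fix y assume y: "y \<in> Mor C L1 L1"
    have yi: "y \<Zsemi> i1 \<in> Mor C L1 L" using y b by blast
    have myi: "m \<Zsemi> (y \<Zsemi> i1) \<in> Mor C V1 L" using m yi by blast
    \<comment> \<open>The preimage of \<open>y\<close> is the block matrix whose only nonzero entry
      is \<open>m y\<close>, with \<open>m\<close> inverse to \<open>n11\<close>.\<close>
    have x: "q1 \<Zsemi> (m \<Zsemi> (y \<Zsemi> i1)) \<in> Mor C V L" using v m yi by blast
    have jq: "j1 \<Zsemi> q1 = Ident C V1" and ip: "i1 \<Zsemi> p1 = Ident C L1"
      using bL bV by (simp_all add: biproduct_def)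
    have "(n11 \<Zsemi> j1) \<Zsemi> (q1 \<Zsemi> (m \<Zsemi> (y \<Zsemi> i1))) = y \<Zsemi> i1"
      using Comp_assoc[OF m(1) v(1) x] comp_cancel_inverse[OF v(1,3) jq myi]
        comp_cancel_inverse[OF m yi] by simp
    then have "\<phi> (q1 \<Zsemi> (m \<Zsemi> (y \<Zsemi> i1))) = y"
      using Comp_assoc[OF y b(1,3)] ip Id_right[OF y] by (simp add: \<phi>_def)
    then show "y \<in> \<phi> ` Mor C V L" using x by (metis imageI)
  qed (use \<phi> in auto)
  have iff: "is_iso C L L (Ident C L \<oplus>\<^bsub>Hom C L L\<^esub> n \<Zsemi> x) \<longleftrightarrow> \<phi> x \<in> S" if x: "x \<in> Mor C V L" for x
  proof -
    let ?y = "(n11 \<Zsemi> j1) \<Zsemi> x"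
    have y: "?y \<in> Mor C L1 L" using nj x by blast
    have eq: "n \<Zsemi> x = p1 \<Zsemi> ?y \<oplus>\<^bsub>Hom C L L\<^esub> (p2 \<Zsemi> n22 \<Zsemi> j2) \<Zsemi> x"
      using comp_add_left[OF cl x] Comp_assoc[OF b(3) m(1) v(1)] Comp_assoc[OF b(3) nj x] by (simp add: n)
    have "is_iso C L L (Ident C L \<oplus>\<^bsub>Hom C L L\<^esub> n \<Zsemi> x) \<longleftrightarrow> is_iso C L L (Ident C L \<oplus>\<^bsub>Hom C L L\<^esub> p1 \<Zsemi> ?y)"
      using is_iso_add_radHom_iff[OF _ rad2 x, of "Ident C L \<oplus>\<^bsub>Hom C L L\<^esub> p1 \<Zsemi> ?y"]
        comp_closed[OF b(3) y] comp_closed[OF cl(2) x] by (simp add: eq Id_closed Hom.a_assoc)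
    also have "\<dots> \<longleftrightarrow> \<phi> x \<in> S"
      using is_iso_one_plus_swap_iff[OF b(3) y] \<phi>[OF x] by (simp add: S_def \<phi>_def)
    finally show ?thesis .
  qed
  have "card {x \<in> Mor C V L. \<phi> x \<in> S} = card S * card {x \<in> Mor C V L. \<phi> x = \<zero>\<^bsub>Hom C L1 L1\<^esub>}"
    by (rule card_hom_preimage) (use finite_Hom \<phi> add surj in \<open>auto simp: S_def intro: Hom.abelian_group_axioms\<close>)
  moreover have "card (Mor C V L) = card (Mor C L1 L1) * card {x \<in> Mor C V L. \<phi> x = \<zero>\<^bsub>Hom C L1 L1\<^esub>}"
    using card_hom_image_kernel[OF Hom.abelian_group_axioms Hom.abelian_group_axioms finite_Hom \<phi> add] surj by simp
  moreover have "{x \<in> Mor C V L. is_iso C L L (Ident C L \<oplus>\<^bsub>Hom C L L\<^esub> n \<Zsemi> x)} = {x \<in> Mor C V L. \<phi> x \<in> S}"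
    using iff by blast
  moreover have "card S = card (Aut C L1)"
  proof -
    have "bij_betw (\<lambda>y. Ident C L1 \<oplus>\<^bsub>Hom C L1 L1\<^esub> y) S (Aut C L1)"
    proof (rule bij_betwI[where g = "\<lambda>y. \<ominus>\<^bsub>Hom C L1 L1\<^esub> Ident C L1 \<oplus>\<^bsub>Hom C L1 L1\<^esub> y"])
      show "(\<lambda>y. \<ominus>\<^bsub>Hom C L1 L1\<^esub> Ident C L1 \<oplus>\<^bsub>Hom C L1 L1\<^esub> y) \<in> Aut C L1 \<rightarrow> S"
        by (auto simp: S_def Aut_iff Id_closed Hom.r_neg2 is_iso_closed)
    qed (auto simp: S_def Aut_iff Id_closed is_iso_closed Hom.r_neg1 Hom.r_neg2)
    then show ?thesis by (rule bij_betw_same_card)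
  qed
  ultimately show ?thesis by simp
qed

text \<open>The bijection sends \<open>x\<close> to \<open>d'[1] x b\<close>, with \<open>d'\<close>
  inverse to \<open>d\<close>: the outer factor \<open>b\<close> of the twist is swapped to the
  right end, and both factors are absorbed into \<open>x\<close>.\<close>

lemma card_one_plus_twist:
  assumes b: "b \<in> Aut C L" and d: "d \<in> Aut C Z" and n: "n \<in> Mor C L (Sh C Z)"
  shows "card {x \<in> Mor C (Sh C Z) L. is_iso C L L (Ident C L \<oplus>\<^bsub>Hom C L L\<^esub> twist C Z L d b n \<Zsemi> x)} =
    card {x \<in> Mor C (Sh C Z) L. is_iso C L L (Ident C L \<oplus>\<^bsub>Hom C L L\<^esub> n \<Zsemi> x)}"
proof -
  from b obtain b' where b': "inverse_mor C L L b b'" by (auto simp: Aut_iff is_iso_def)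
  from d obtain d' where d': "inverse_mor C Z Z d d'" by (auto simp: Aut_iff is_iso_def)
  let ?e = "Shm C d" and ?e' = "Shm C d'"
  have bc: "b \<in> Mor C L L" "b' \<in> Mor C L L" "b \<Zsemi> b' = Ident C L" "b' \<Zsemi> b = Ident C L"
    using b' by (auto simp: inverse_mor_def)
  have "inverse_mor C (Sh C Z) (Sh C Z) ?e ?e'"
    using d' inverse_mor_Shm[of d Z Z d'] by (auto simp: inverse_mor_def)
  then have ec: "?e \<in> Mor C (Sh C Z) (Sh C Z)" "?e' \<in> Mor C (Sh C Z) (Sh C Z)"
    "?e \<Zsemi> ?e' = Ident C (Sh C Z)" "?e' \<Zsemi> ?e = Ident C (Sh C Z)"
    by (auto simp: inverse_mor_def)
  note tw = twist_eq[OF d', of L b n]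
  let ?N = "{x \<in> Mor C (Sh C Z) L. is_iso C L L (Ident C L \<oplus>\<^bsub>Hom C L L\<^esub> n \<Zsemi> x)}"
  let ?N' = "{x \<in> Mor C (Sh C Z) L. is_iso C L L (Ident C L \<oplus>\<^bsub>Hom C L L\<^esub> twist C Z L d b n \<Zsemi> x)}"
  have iff: "x \<in> ?N' \<longleftrightarrow> ?e' \<Zsemi> (x \<Zsemi> b) \<in> ?N" if x: "x \<in> Mor C (Sh C Z) L" for x
  proof -
    have ex: "?e' \<Zsemi> x \<in> Mor C (Sh C Z) L" using ec x by blast
    have nex: "n \<Zsemi> (?e' \<Zsemi> x) \<in> Mor C L L" using n ex by blast
    have "twist C Z L d b n \<Zsemi> x = b \<Zsemi> (n \<Zsemi> (?e' \<Zsemi> x))"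
      using Comp_assoc[OF comp_closed[OF bc(1) n] ec(2) x] Comp_assoc[OF bc(1) n ex] by (simp add: tw)
    moreover have "(n \<Zsemi> (?e' \<Zsemi> x)) \<Zsemi> b = n \<Zsemi> (?e' \<Zsemi> (x \<Zsemi> b))"
      using Comp_assoc[OF n ex bc(1)] Comp_assoc[OF ec(2) x bc(1)] by simp
    ultimately show ?thesis
      using is_iso_one_plus_swap_iff[OF bc(1) nex] x ec(2) bc(1) by auto
  qed
  have "bij_betw (\<lambda>x. ?e' \<Zsemi> (x \<Zsemi> b)) ?N' ?N"
  proof (rule bij_betwI[where g = "\<lambda>x. ?e \<Zsemi> (x \<Zsemi> b')"])
    have inv1: "?e \<Zsemi> ((?e' \<Zsemi> (x \<Zsemi> b)) \<Zsemi> b') = x" if x: "x \<in> Mor C (Sh C Z) L" for x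
      using Comp_assoc[OF ec(2) comp_closed[OF x bc(1)] bc(2)] Comp_assoc[OF x bc(1,2)] bc(3) Id_right[OF x]
        comp_cancel_inverse[OF ec(1-3) x] by simp
    have inv2: "?e' \<Zsemi> ((?e \<Zsemi> (x \<Zsemi> b')) \<Zsemi> b) = x" if x: "x \<in> Mor C (Sh C Z) L" for x
      using Comp_assoc[OF ec(1) comp_closed[OF x bc(2)] bc(1)] Comp_assoc[OF x bc(2,1)] bc(4) Id_right[OF x]
        comp_cancel_inverse[OF ec(2,1,4) x] by simp
    show "(\<lambda>x. ?e' \<Zsemi> (x \<Zsemi> b)) \<in> ?N' \<rightarrow> ?N" using iff by blast
    show "(\<lambda>x. ?e \<Zsemi> (x \<Zsemi> b')) \<in> ?N \<rightarrow> ?N'"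
    proof
      fix x assume x: "x \<in> ?N"
      then have "?e \<Zsemi> (x \<Zsemi> b') \<in> Mor C (Sh C Z) L" using ec bc by blast
      then show "?e \<Zsemi> (x \<Zsemi> b') \<in> ?N'" using iff[of "?e \<Zsemi> (x \<Zsemi> b')"] inv2[of x] x by simp
    qed
    show "?e \<Zsemi> ((?e' \<Zsemi> (x \<Zsemi> b)) \<Zsemi> b') = x" if "x \<in> ?N'" for x using inv1 that by blast
    show "?e' \<Zsemi> ((?e \<Zsemi> (x \<Zsemi> b')) \<Zsemi> b) = x" if "x \<in> ?N" for x using inv2 that by blast
  qed
  then show ?thesis by (rule bij_betw_same_card)
qed

text \<open>The count on the left depends on \<open>n\<close> alone, so the ratio of
  \<open>|Aut L1|\<close> to \<open>|End L1|\<close> is the same for every admissible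
  \<open>L1\<close>.\<close>

lemma card_one_plus_diag_form:
  assumes n: "n \<in> Mor C L (Sh C Z)" and D: "diag_form C Z L n L1"
  shows "card {x \<in> Mor C (Sh C Z) L. is_iso C L L (Ident C L \<oplus>\<^bsub>Hom C L L\<^esub> n \<Zsemi> x)} * card (Mor C L1 L1) =
    card (Aut C L1) * card (Mor C (Sh C Z) L)"
proof -
  from D obtain L2 Z1 Z2 i1 i2 p1 p2 j1 j2 q1 q2 b d n11 n22 where
    bL: "biproduct C L L1 L2 i1 i2 p1 p2" and bZ: "biproduct C Z Z1 Z2 j1 j2 q1 q2"
    and bd: "b \<in> Aut C L" "d \<in> Aut C Z" and iso: "is_iso C L1 (Sh C Z1) n11"
    and rad: "n22 \<in> radHom C L2 (Sh C Z2)"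
    and eq: "twist C Z L d b n =
      (p1 \<Zsemi> n11 \<Zsemi> Shm C j1) \<oplus>\<^bsub>Hom C L (Sh C Z)\<^esub> (p2 \<Zsemi> n22 \<Zsemi> Shm C j2)"
    unfolding diag_form_def by blast
  have "biproduct C (Sh C Z) (Sh C Z1) (Sh C Z2) (Shm C j1) (Shm C j2) (Shm C q1) (Shm C q2)"
    using biproduct_Shm_iff[OF biproduct_closed[OF bZ]] bZ by simp
  from card_one_plus_block[OF bL this iso rad eq] show ?thesis
    by (simp add: card_one_plus_twist[OF bd n])
qed

section \<open>Braces and long exact sequences\<close>

lemma card_Mor_pos: "card (Mor C X Y) > 0"
  using finite_Hom Hom.zero_closed by (metis card_gt_0_iff empty_iff)

text \<open>A trivial Hom set has one element and contributes the factor 1, so the infinite product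
  stops at \<open>N\<close>.\<close>

lemma brace_finite:
  assumes "\<forall>i\<ge>N. Mor C ((Sh C ^^ Suc i) X) Y = {\<zero>\<^bsub>Hom C ((Sh C ^^ Suc i) X) Y\<^esub>}"
  shows "brace C X Y = (\<Prod>i<N. real (card (Mor C ((Sh C ^^ Suc i) X) Y)) powi ((- 1) ^ Suc i))"
  unfolding brace_def by (rule prodinf_finite) (use assms in auto)

lemma brace_eventually:
  obtains N where "\<forall>i\<ge>N. Mor C ((Sh C ^^ Suc i) X) Y = {\<zero>\<^bsub>Hom C ((Sh C ^^ Suc i) X) Y\<^esub>}"
proof -
  from Hom_Sh_eventually_zero[of X Y] obtain N
    where "\<forall>i\<ge>N. Mor C ((Sh C ^^ i) X) Y = {\<zero>\<^bsub>Hom C ((Sh C ^^ i) X) Y\<^esub>}" by blast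
  then show ?thesis by (intro that[of N]) (metis le_SucI)
qed

lemma brace_pos: "brace C X Y > 0"
proof -
  obtain N where "\<forall>i\<ge>N. Mor C ((Sh C ^^ Suc i) X) Y = {\<zero>\<^bsub>Hom C ((Sh C ^^ Suc i) X) Y\<^esub>}"
    by (rule brace_eventually)
  from brace_finite[OF this] show ?thesis
    using card_Mor_pos by (simp add: prod_pos)
qed

text \<open>Translating \<open>X\<close> moves every factor one place and reverses the sign of its
  exponent. The two braces cancel up to the first factor, the inverse of
  \<open>|Hom(X[1],Y)|\<close>.\<close>

lemma brace_Sh: "brace C X Y * brace C (Sh C X) Y * real (card (Mor C (Sh C X) Y)) = 1"
proof -
  let ?a = "\<lambda>i. real (card (Mor C ((Sh C ^^ Suc i) X) Y))"
  obtain N where N: "\<forall>i\<ge>N. Mor C ((Sh C ^^ Suc i) X) Y = {\<zero>\<^bsub>Hom C ((Sh C ^^ Suc i) X) Y\<^esub>}"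
    by (rule brace_eventually)
  have a: "real (card (Mor C ((Sh C ^^ Suc i) (Sh C X)) Y)) = ?a (Suc i)" for i
    by (simp add: funpow_swap1)
  have "\<forall>i\<ge>N. Mor C ((Sh C ^^ Suc i) (Sh C X)) Y = {\<zero>\<^bsub>Hom C ((Sh C ^^ Suc i) (Sh C X)) Y\<^esub>}"
    using N by (simp add: funpow_swap1) (metis funpow_swap1 funpow.simps(2) comp_apply le_SucI)
  from brace_finite[OF this] have 1: "brace C (Sh C X) Y = (\<Prod>i<N. ?a (Suc i) powi ((- 1) ^ Suc i))"
    by (simp only: a)
  \<comment> \<open>One factor more is kept, so that splitting off the first leaves \<open>N\<close>
    factors to match with \<open>1\<close>.\<close>
  have "\<forall>i\<ge>Suc N. Mor C ((Sh C ^^ Suc i) X) Y = {\<zero>\<^bsub>Hom C ((Sh C ^^ Suc i) X) Y\<^esub>}" using N by simp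
  from brace_finite[OF this] have "brace C X Y = (\<Prod>i<Suc N. ?a i powi ((- 1) ^ Suc i))" .
  also have "\<dots> = ?a 0 powi ((- 1) ^ Suc 0) * (\<Prod>i<N. ?a (Suc i) powi ((- 1) ^ Suc (Suc i)))"
    by (rule prod.lessThan_Suc_shift)
  also have "(\<Prod>i<N. ?a (Suc i) powi ((- 1) ^ Suc (Suc i))) = inverse (brace C (Sh C X) Y)"
    unfolding 1 prod_inversef[symmetric] by (intro prod.cong) (simp_all add: power_int_minus)
  finally have "brace C X Y = inverse (real (card (Mor C (Sh C X) Y))) * inverse (brace C (Sh C X) Y)"
    by (simp add: power_int_minus)
  moreover have "brace C (Sh C X) Y > 0" and "card (Mor C (Sh C X) Y) > 0"
    by (rule brace_pos, rule card_Mor_pos)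
  ultimately show ?thesis by (simp add: field_simps)
qed

lemma card_exact_contravariant:
  assumes T: "Tri C X Y Z f g h"
  shows "card (Mor C Y W) = card ((\<lambda>a. f \<Zsemi> a) ` Mor C Y W) * card ((\<lambda>a. g \<Zsemi> a) ` Mor C Z W)"
  unfolding Tri_kernel_contravariant[OF T, symmetric]
  by (rule card_hom_image_kernel[OF Hom.abelian_group_axioms Hom.abelian_group_axioms finite_Hom])
    (use Tri_closed[OF T] in \<open>auto simp: comp_add_right\<close>)

lemma card_exact_covariant:
  assumes T: "Tri C X Y Z f g h"
  shows "card (Mor C W Y) = card ((\<lambda>a. a \<Zsemi> g) ` Mor C W Y) * card ((\<lambda>a. a \<Zsemi> f) ` Mor C W X)"
  unfolding Tri_kernel_covariant[OF T, symmetric]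
  by (rule card_hom_image_kernel[OF Hom.abelian_group_axioms Hom.abelian_group_axioms finite_Hom])
    (use Tri_closed[OF T] in \<open>auto simp: comp_add_left\<close>)

text \<open>Let \<open>I\<close> and \<open>I'\<close> be the orders of the images of
  \<open>h\<close> and \<open>h[1]\<close>. Exactness at three consecutive places gives
  \<open>I I' |Hom(Y[1],W)| = |Hom(X[1],W)| |Hom(Z[1],W)|\<close>. By \<open>brace_Sh\<close> the
  quotients of braces satisfy the same recursion, and it starts where all Hom sets vanish.\<close>

lemma card_image_contravariant:
  assumes "Tri C X Y Z f g h"
  shows "real (card ((\<lambda>a. h \<Zsemi> a) ` Mor C (Sh C X) W)) = brace C Y W / (brace C X W * brace C Z W)"
proof -
  obtain N where N: "\<forall>i\<ge>N. Mor C ((Sh C ^^ Suc i) X) W = {\<zero>\<^bsub>Hom C ((Sh C ^^ Suc i) X) W\<^esub>}"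
    by (rule brace_eventually)
  obtain N1 where N1: "\<forall>i\<ge>N1. Mor C ((Sh C ^^ Suc i) Y) W = {\<zero>\<^bsub>Hom C ((Sh C ^^ Suc i) Y) W\<^esub>}"
    by (rule brace_eventually)
  obtain N2 where N2: "\<forall>i\<ge>N2. Mor C ((Sh C ^^ Suc i) Z) W = {\<zero>\<^bsub>Hom C ((Sh C ^^ Suc i) Z) W\<^esub>}"
    by (rule brace_eventually)
  define M where "M = max N (max N1 N2)"
  have "\<forall>i\<ge>M. \<forall>V\<in>{X, Y, Z}. Mor C ((Sh C ^^ Suc i) V) W = {\<zero>\<^bsub>Hom C ((Sh C ^^ Suc i) V) W\<^esub>}"
    using N N1 N2 by (simp add: M_def)
  with assms show ?thesis
  proof (induction M arbitrary: X Y Z f g h)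
    case 0
    have "brace C V W = 1" if "V \<in> {X, Y, Z}" for V
      by (subst brace_finite[of 0]) (use 0(2) that in blast, simp)
    moreover have "Mor C (Sh C X) W = {\<zero>\<^bsub>Hom C (Sh C X) W\<^esub>}" using 0(2)[rule_format, of 0 X] by simp
    ultimately show ?case by simp
  next
    case (Suc M)
    note T0 = Tri_rotated[OF Suc.prems(1)]
    note T1 = Tri_rotated[OF T0]
    note T2 = Tri_rotated[OF T1]
    note T3 = Tri_rotated[OF T2]
    have triv: "\<forall>i\<ge>M. \<forall>V\<in>{Sh C X, Sh C Y, Sh C Z}.
      Mor C ((Sh C ^^ Suc i) V) W = {\<zero>\<^bsub>Hom C ((Sh C ^^ Suc i) V) W\<^esub>}"
    proof (intro allI impI ballI)
      fix i V' assume "i \<ge> M" "V' \<in> {Sh C X, Sh C Y, Sh C Z}"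
      then obtain V where "V \<in> {X, Y, Z}" "V' = Sh C V" "Suc i \<ge> Suc M" by auto
      then have "Mor C ((Sh C ^^ Suc (Suc i)) V) W = {\<zero>\<^bsub>Hom C ((Sh C ^^ Suc (Suc i)) V) W\<^esub>}"
        using Suc.prems(2) by blast
      then show "Mor C ((Sh C ^^ Suc i) V') W = {\<zero>\<^bsub>Hom C ((Sh C ^^ Suc i) V') W\<^esub>}"
        by (simp add: \<open>V' = Sh C V\<close> funpow_swap1)
    qed
    define I where "I = real (card ((\<lambda>a. h \<Zsemi> a) ` Mor C (Sh C X) W))"
    \<comment> \<open>Three rotations give the translated triangle with all maps negated, so
      \<open>I'\<close> is formed with \<open>-h[1]\<close>, ready for the induction hypothesis on
      \<open>T2\<close>.\<close>
    define I' where "I' = real (card ((\<lambda>a. (\<ominus>\<^bsub>Hom C (Sh C Z) (Sh C (Sh C X))\<^esub> Shm C h) \<Zsemi> a) ` Mor C (Sh C (Sh C X)) W))"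
    have IH: "I' = brace C (Sh C Y) W / (brace C (Sh C X) W * brace C (Sh C Z) W)"
      unfolding I'_def by (rule Suc.IH[OF T2 triv])
    have "I * I' * real (card (Mor C (Sh C Y) W)) = real (card (Mor C (Sh C X) W)) * real (card (Mor C (Sh C Z) W))"
      unfolding I_def I'_def
      using card_exact_contravariant[OF T1, of W] card_exact_contravariant[OF T2, of W]
        card_exact_contravariant[OF T3, of W] by simp
    then have I: "I * I' = real (card (Mor C (Sh C X) W)) * real (card (Mor C (Sh C Z) W)) / real (card (Mor C (Sh C Y) W))"
      using card_Mor_pos[of "Sh C Y" W] by (simp add: field_simps)
    have c: "real (card (Mor C (Sh C V) W)) = 1 / (brace C V W * brace C (Sh C V) W)" for V
      using brace_Sh[of V W] brace_pos[of V W] brace_pos[of "Sh C V" W] by (simp add: field_simps)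
    have pos: "brace C V W > 0" for V by (rule brace_pos)
    have "I = brace C Y W / (brace C X W * brace C Z W)"
      using I pos[of X] pos[of Y] pos[of Z] pos[of "Sh C X"] pos[of "Sh C Y"] pos[of "Sh C Z"]
      unfolding IH c by (simp add: divide_simps mult_ac)
    then show ?case by (simp add: I_def)
  qed
qed

text \<open>Here the triangle stays fixed and the test object \<open>W\<close> is translated. The
  image of \<open>h\<close> on \<open>Hom(V[1],Z)\<close> is the kernel of \<open>f[1]\<close>, and
  the translation identifies it with the kernel of \<open>f\<close> on \<open>Hom(V,X)\<close>; this
  closes the recursion \<open>step\<close> without negative translates.\<close>

lemma card_image_covariant:
  assumes T: "Tri C X Y Z f g h"
  shows "real (card ((\<lambda>a. a \<Zsemi> h) ` Mor C (Sh C W) Z)) = brace C W Y / (brace C W Z * brace C W X)"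
proof -
  from Tri_closed[OF T] have f: "f \<in> Mor C X Y" by auto
  define J where "J V = real (card ((\<lambda>a. a \<Zsemi> h) ` Mor C V Z))" for V
  have step: "J V * J (Sh C V) * real (card (Mor C V Y)) = real (card (Mor C V Z)) * real (card (Mor C V X))" for V
  proof -
    have "card ((\<lambda>a. a \<Zsemi> h) ` Mor C (Sh C V) Z) = card {a \<in> Mor C V X. a \<Zsemi> f = \<zero>\<^bsub>Hom C V Y\<^esub>}"
      using bij_betw_same_card[OF bij_betw_Shm_kernel[OF f, of V]] unfolding Shm_kernel_image[OF T] by simp
    moreover have "card (Mor C V X) =
        card ((\<lambda>a. a \<Zsemi> f) ` Mor C V X) * card {a \<in> Mor C V X. a \<Zsemi> f = \<zero>\<^bsub>Hom C V Y\<^esub>}"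
      by (rule card_hom_image_kernel[OF Hom.abelian_group_axioms Hom.abelian_group_axioms finite_Hom])
        (use f in \<open>auto simp: comp_add_left\<close>)
    ultimately show ?thesis unfolding J_def
      using card_exact_covariant[OF T, of V] card_exact_covariant[OF Tri_rotated[OF T], of V] by simp
  qed
  obtain N where N: "\<forall>i\<ge>N. Mor C ((Sh C ^^ Suc i) W) Z = {\<zero>\<^bsub>Hom C ((Sh C ^^ Suc i) W) Z\<^esub>}"
    by (rule brace_eventually)
  obtain N1 where N1: "\<forall>i\<ge>N1. Mor C ((Sh C ^^ Suc i) W) Y = {\<zero>\<^bsub>Hom C ((Sh C ^^ Suc i) W) Y\<^esub>}"
    by (rule brace_eventually)
  obtain N2 where N2: "\<forall>i\<ge>N2. Mor C ((Sh C ^^ Suc i) W) X = {\<zero>\<^bsub>Hom C ((Sh C ^^ Suc i) W) X\<^esub>}"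
    by (rule brace_eventually)
  define M where "M = max N (max N1 N2)"
  have "\<forall>i\<ge>M. \<forall>V\<in>{X, Y, Z}. Mor C ((Sh C ^^ Suc i) W) V = {\<zero>\<^bsub>Hom C ((Sh C ^^ Suc i) W) V\<^esub>}"
    using N N1 N2 by (simp add: M_def)
  then have "J (Sh C W) = brace C W Y / (brace C W Z * brace C W X)"
  proof (induction M arbitrary: W)
    case 0
    have "brace C W V = 1" if "V \<in> {X, Y, Z}" for V
      by (subst brace_finite[of 0]) (use 0 that in blast, simp)
    moreover have "Mor C (Sh C W) Z = {\<zero>\<^bsub>Hom C (Sh C W) Z\<^esub>}" using 0[rule_format, of 0 Z] by simp
    ultimately show ?case by (simp add: J_def)
  next
    case (Suc M)
    have triv: "\<forall>i\<ge>M. \<forall>V\<in>{X, Y, Z}. Mor C ((Sh C ^^ Suc i) (Sh C W)) V = {\<zero>\<^bsub>Hom C ((Sh C ^^ Suc i) (Sh C W)) V\<^esub>}"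
    proof (intro allI impI ballI)
      fix i V assume "i \<ge> M" "V \<in> {X, Y, Z}"
      then have "Mor C ((Sh C ^^ Suc (Suc i)) W) V = {\<zero>\<^bsub>Hom C ((Sh C ^^ Suc (Suc i)) W) V\<^esub>}"
        using Suc.prems by (meson Suc_le_mono)
      then show "Mor C ((Sh C ^^ Suc i) (Sh C W)) V = {\<zero>\<^bsub>Hom C ((Sh C ^^ Suc i) (Sh C W)) V\<^esub>}"
        by (simp add: funpow_swap1)
    qed
    have IH: "J (Sh C (Sh C W)) = brace C (Sh C W) Y / (brace C (Sh C W) Z * brace C (Sh C W) X)"
      by (rule Suc.IH[OF triv])
    have I: "J (Sh C W) * J (Sh C (Sh C W)) =
      real (card (Mor C (Sh C W) Z)) * real (card (Mor C (Sh C W) X)) / real (card (Mor C (Sh C W) Y))"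
      using step[of "Sh C W"] card_Mor_pos[of "Sh C W" Y] by (simp add: field_simps)
    have c: "real (card (Mor C (Sh C W) V)) = 1 / (brace C W V * brace C (Sh C W) V)" for V
      using brace_Sh[of W V] brace_pos[of W V] brace_pos[of "Sh C W" V] by (simp add: field_simps)
    have pos: "brace C W V > 0" "brace C (Sh C W) V > 0" for V by (rule brace_pos)+
    show ?case
      using I pos[of X] pos[of Y] pos[of Z]
      unfolding IH c by (simp add: divide_simps mult_ac)
  qed
  then show ?thesis by (simp add: J_def)
qed

section \<open>Stabilizers and orbits\<close>

lemma finite_triangle_triples: "finite (triangle_triples C Z L M)"
proof (rule finite_subset)
  show "triangle_triples C Z L M \<subseteq> Mor C Z M \<times> Mor C M L \<times> Mor C L (Sh C Z)"
    by (auto simp: triangle_triples_def)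
qed (intro finite_cartesian_product finite_Hom)

text \<open>With \<open>b = 1 + y\<close>, the condition \<open>mb = m\<close> becomes the linear
  condition \<open>my = 0\<close>.\<close>

lemma card_stabilizer_middle:
  assumes m: "m \<in> Mor C M L"
  shows "card {b \<in> Aut C L. m \<Zsemi> b = m} =
    card {y \<in> Mor C L L. m \<Zsemi> y = \<zero>\<^bsub>Hom C M L\<^esub> \<and> is_iso C L L (Ident C L \<oplus>\<^bsub>Hom C L L\<^esub> y)}"
proof -
  have "bij_betw (\<lambda>y. Ident C L \<oplus>\<^bsub>Hom C L L\<^esub> y)
    {y \<in> Mor C L L. m \<Zsemi> y = \<zero>\<^bsub>Hom C M L\<^esub> \<and> is_iso C L L (Ident C L \<oplus>\<^bsub>Hom C L L\<^esub> y)}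
    {b \<in> Mor C L L. m \<Zsemi> b = m \<and> is_iso C L L b}"
  proof (rule bij_betw_Collect[OF bij_betw_one_plus])
    fix y assume y: "y \<in> Mor C L L"
    have "m \<Zsemi> (Ident C L \<oplus>\<^bsub>Hom C L L\<^esub> y) = m \<oplus>\<^bsub>Hom C M L\<^esub> m \<Zsemi> y"
      using comp_add_right[OF m Id_closed y] Id_right[OF m] by simp
    then show "m \<Zsemi> (Ident C L \<oplus>\<^bsub>Hom C L L\<^esub> y) = m \<and> is_iso C L L (Ident C L \<oplus>\<^bsub>Hom C L L\<^esub> y) \<longleftrightarrow>
      m \<Zsemi> y = \<zero>\<^bsub>Hom C M L\<^esub> \<and> is_iso C L L (Ident C L \<oplus>\<^bsub>Hom C L L\<^esub> y)"
      using m comp_closed[OF m y] by (simp add: Hom.add.l_cancel_one)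
  qed
  moreover have "{b \<in> Mor C L L. m \<Zsemi> b = m \<and> is_iso C L L b} = {b \<in> Aut C L. m \<Zsemi> b = m}"
    using is_iso_closed by (auto simp: Aut_iff)
  ultimately show ?thesis using bij_betw_same_card by fastforce
qed

lemma card_stabilizer_left:
  assumes l: "l \<in> Mor C Z M"
  shows "card {d \<in> Aut C Z. d \<Zsemi> l = l} =
    card {y \<in> Mor C Z Z. y \<Zsemi> l = \<zero>\<^bsub>Hom C Z M\<^esub> \<and> is_iso C Z Z (Ident C Z \<oplus>\<^bsub>Hom C Z Z\<^esub> y)}"
proof -
  have "bij_betw (\<lambda>y. Ident C Z \<oplus>\<^bsub>Hom C Z Z\<^esub> y)
    {y \<in> Mor C Z Z. y \<Zsemi> l = \<zero>\<^bsub>Hom C Z M\<^esub> \<and> is_iso C Z Z (Ident C Z \<oplus>\<^bsub>Hom C Z Z\<^esub> y)}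
    {d \<in> Mor C Z Z. d \<Zsemi> l = l \<and> is_iso C Z Z d}"
  proof (rule bij_betw_Collect[OF bij_betw_one_plus])
    fix y assume y: "y \<in> Mor C Z Z"
    have "(Ident C Z \<oplus>\<^bsub>Hom C Z Z\<^esub> y) \<Zsemi> l = l \<oplus>\<^bsub>Hom C Z M\<^esub> y \<Zsemi> l"
      using comp_add_left[OF Id_closed y l] Id_left[OF l] by simp
    then show "(Ident C Z \<oplus>\<^bsub>Hom C Z Z\<^esub> y) \<Zsemi> l = l \<and> is_iso C Z Z (Ident C Z \<oplus>\<^bsub>Hom C Z Z\<^esub> y) \<longleftrightarrow>
      y \<Zsemi> l = \<zero>\<^bsub>Hom C Z M\<^esub> \<and> is_iso C Z Z (Ident C Z \<oplus>\<^bsub>Hom C Z Z\<^esub> y)"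
      using l comp_closed[OF y l] by (simp add: Hom.add.l_cancel_one)
  qed
  moreover have "{d \<in> Mor C Z Z. d \<Zsemi> l = l \<and> is_iso C Z Z d} = {d \<in> Aut C Z. d \<Zsemi> l = l}"
    using is_iso_closed by (auto simp: Aut_iff)
  ultimately show ?thesis using bij_betw_same_card by fastforce
qed

text \<open>Right multiplication by \<open>c\<close> carries the stabilizer onto the fibre over
  \<open>mc\<close>, so all fibres have equal size.\<close>

lemma card_orbit_middle:
  assumes m: "m \<in> Mor C M L"
  shows "card (Aut C L) = card ((\<lambda>b. m \<Zsemi> b) ` Aut C L) * card {b \<in> Aut C L. m \<Zsemi> b = m}"
proof (rule card_eq_card_image_times_fibre)
  have sub: "Aut C L \<subseteq> Mor C L L" using is_iso_closed by (auto simp: Aut_iff)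
  then show "finite (Aut C L)" using finite_Hom finite_subset by blast
  fix y assume "y \<in> (\<lambda>b. m \<Zsemi> b) ` Aut C L"
  then obtain c where c: "c \<in> Aut C L" "y = m \<Zsemi> c" by blast
  obtain c' where c': "c \<in> Mor C L L" "c' \<in> Aut C L" "c' \<in> Mor C L L" "c \<Zsemi> c' = Ident C L" "c' \<Zsemi> c = Ident C L"
    by (rule Aut_inverse[OF c(1)])
  have cancel: "(b \<Zsemi> c) \<Zsemi> c' = b" "(b \<Zsemi> c') \<Zsemi> c = b" if "b \<in> Mor C X L" for b X
    using that c' Comp_assoc[OF that c'(1,3)] Comp_assoc[OF that c'(3,1)] by (simp_all add: Id_right)
  have comp: "b \<Zsemi> c \<in> Aut C L" "b \<Zsemi> c' \<in> Aut C L" if "b \<in> Aut C L" for b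
    using that c c' is_iso_comp by (auto simp: Aut_iff)
  have "bij_betw (\<lambda>b. b \<Zsemi> c) {b \<in> Aut C L. m \<Zsemi> b = m} {b \<in> Aut C L. m \<Zsemi> b = y}"
  proof (rule bij_betwI[where g = "\<lambda>b. b \<Zsemi> c'"])
    show "(\<lambda>b. b \<Zsemi> c) \<in> {b \<in> Aut C L. m \<Zsemi> b = m} \<rightarrow> {b \<in> Aut C L. m \<Zsemi> b = y}"
      using sub comp Comp_assoc[OF m _ c'(1), symmetric] by (auto simp: c(2))
    show "(\<lambda>b. b \<Zsemi> c') \<in> {b \<in> Aut C L. m \<Zsemi> b = y} \<rightarrow> {b \<in> Aut C L. m \<Zsemi> b = m}"
      using sub comp Comp_assoc[OF m _ c'(3), symmetric] cancel(1)[OF m] by (auto simp: c(2))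
  qed (use sub cancel in auto)
  then show "card {b \<in> Aut C L. m \<Zsemi> b = y} = card {b \<in> Aut C L. m \<Zsemi> b = m}"
    using bij_betw_same_card by fastforce
qed

lemma card_orbit_left:
  assumes l: "l \<in> Mor C Z M"
  shows "card (Aut C Z) = card ((\<lambda>d. d \<Zsemi> l) ` Aut C Z) * card {d \<in> Aut C Z. d \<Zsemi> l = l}"
proof (rule card_eq_card_image_times_fibre)
  have sub: "Aut C Z \<subseteq> Mor C Z Z" using is_iso_closed by (auto simp: Aut_iff)
  then show "finite (Aut C Z)" using finite_Hom finite_subset by blast
  fix y assume "y \<in> (\<lambda>d. d \<Zsemi> l) ` Aut C Z"
  then obtain c where c: "c \<in> Aut C Z" "y = c \<Zsemi> l" by blast
  obtain c' where c': "c \<in> Mor C Z Z" "c' \<in> Aut C Z" "c' \<in> Mor C Z Z" "c \<Zsemi> c' = Ident C Z" "c' \<Zsemi> c = Ident C Z"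
    by (rule Aut_inverse[OF c(1)])
  have cancel: "c \<Zsemi> (c' \<Zsemi> d) = d" "c' \<Zsemi> (c \<Zsemi> d) = d" if "d \<in> Mor C Z X" for d X
    using comp_cancel_inverse[OF c'(1,3,4) that] comp_cancel_inverse[OF c'(3,1,5) that] by simp_all
  have comp: "c \<Zsemi> d \<in> Aut C Z" "c' \<Zsemi> d \<in> Aut C Z" if "d \<in> Aut C Z" for d
    using that c c' is_iso_comp by (auto simp: Aut_iff)
  have "bij_betw (\<lambda>d. c \<Zsemi> d) {d \<in> Aut C Z. d \<Zsemi> l = l} {d \<in> Aut C Z. d \<Zsemi> l = y}"
  proof (rule bij_betwI[where g = "\<lambda>d. c' \<Zsemi> d"])
    show "(\<lambda>d. c \<Zsemi> d) \<in> {d \<in> Aut C Z. d \<Zsemi> l = l} \<rightarrow> {d \<in> Aut C Z. d \<Zsemi> l = y}"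
      using sub comp Comp_assoc[OF c'(1) _ l] by (auto simp: c(2))
    show "(\<lambda>d. c' \<Zsemi> d) \<in> {d \<in> Aut C Z. d \<Zsemi> l = y} \<rightarrow> {d \<in> Aut C Z. d \<Zsemi> l = l}"
      using sub comp Comp_assoc[OF c'(3) _ l] cancel(2)[OF l] by (auto simp: c(2))
  qed (use sub cancel in auto)
  then show "card {d \<in> Aut C Z. d \<Zsemi> l = y} = card {d \<in> Aut C Z. d \<Zsemi> l = l}"
    using bij_betw_same_card by fastforce
qed

text \<open>With \<open>N\<close> the number of \<open>x\<close> for which \<open>1 + nx\<close>, equivalently \<open>1 + xn\<close>, is invertible, both
  stabilizers have order \<open>N\<close> divided by the order of the kernel of multiplication by \<open>n\<close>.\<close>

lemma card_stabilizer_middle_diag_form: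
  assumes T: "Tri C Z M L l m n" and D: "diag_form C Z L n L1"
  shows "card {b \<in> Aut C L. m \<Zsemi> b = m} * card (Mor C L1 L1) =
    card (Aut C L1) * card ((\<lambda>x. n \<Zsemi> x) ` Mor C (Sh C Z) L)"
proof -
  from Tri_closed[OF T] have cl: "m \<in> Mor C M L" "n \<in> Mor C L (Sh C Z)" by auto
  let ?im = "(\<lambda>x. n \<Zsemi> x) ` Mor C (Sh C Z) L"
  let ?k = "card {x \<in> Mor C (Sh C Z) L. n \<Zsemi> x = \<zero>\<^bsub>Hom C L L\<^esub>}"
  define S where "S = {y \<in> ?im. is_iso C L L (Ident C L \<oplus>\<^bsub>Hom C L L\<^esub> y)}"
  \<comment> \<open>By exactness at \<open>L\<close>, the endomorphisms killed by \<open>m\<close>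
    are those of the form \<open>nx\<close>.\<close>
  have ker: "?im = {y \<in> Mor C L L. m \<Zsemi> y = \<zero>\<^bsub>Hom C M L\<^esub>}"
    by (rule Tri_kernel_contravariant[OF Tri_rotated[OF T], symmetric])
  have "card {b \<in> Aut C L. m \<Zsemi> b = m} = card S"
    unfolding card_stabilizer_middle[OF cl(1)] S_def ker by (simp add: conj_assoc)
  moreover have "card {x \<in> Mor C (Sh C Z) L. n \<Zsemi> x \<in> S} = card S * ?k"
    by (rule card_hom_preimage[OF Hom.abelian_group_axioms Hom.abelian_group_axioms finite_Hom])
      (use cl in \<open>auto simp: comp_add_right S_def\<close>)
  moreover have "{x \<in> Mor C (Sh C Z) L. n \<Zsemi> x \<in> S} =
    {x \<in> Mor C (Sh C Z) L. is_iso C L L (Ident C L \<oplus>\<^bsub>Hom C L L\<^esub> n \<Zsemi> x)}"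
    by (auto simp: S_def)
  moreover have "card (Mor C (Sh C Z) L) = card ?im * ?k"
    by (rule card_hom_image_kernel[OF Hom.abelian_group_axioms Hom.abelian_group_axioms finite_Hom])
      (use cl in \<open>auto simp: comp_add_right\<close>)
  moreover from this have "?k > 0" using card_Mor_pos[of "Sh C Z" L] by (simp add: card_gt_0_iff)
  ultimately show ?thesis using card_one_plus_diag_form[OF cl(2) D] by simp
qed

lemma card_stabilizer_left_diag_form:
  assumes T: "Tri C Z M L l m n" and D: "diag_form C Z L n L1"
  shows "card {d \<in> Aut C Z. d \<Zsemi> l = l} * card (Mor C L1 L1) =
    card (Aut C L1) * card ((\<lambda>x. x \<Zsemi> n) ` Mor C (Sh C Z) L)"
proof -
  from Tri_closed[OF T] have cl: "l \<in> Mor C Z M" "n \<in> Mor C L (Sh C Z)" by auto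
  let ?im = "(\<lambda>x. x \<Zsemi> n) ` Mor C (Sh C Z) L"
  let ?iso = "\<lambda>X y. is_iso C X X (Ident C X \<oplus>\<^bsub>Hom C X X\<^esub> y)"
  let ?k = "card {x \<in> Mor C (Sh C Z) L. x \<Zsemi> n = \<zero>\<^bsub>Hom C (Sh C Z) (Sh C Z)\<^esub>}"
  define S where "S = {y \<in> ?im. ?iso (Sh C Z) y}"
  \<comment> \<open>Exactness at \<open>Z[1]\<close> describes not \<open>y\<close> but
    \<open>y[1]\<close>, which takes the form \<open>xn\<close>; \<open>1 + y\<close> and its
    translate \<open>1 + y[1]\<close> are invertible together.\<close>
  have "bij_betw (Shm C) {y \<in> {y \<in> Mor C Z Z. y \<Zsemi> l = \<zero>\<^bsub>Hom C Z M\<^esub>}. ?iso Z y}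
    {y \<in> {y \<in> Mor C (Sh C Z) (Sh C Z). y \<Zsemi> Shm C l = \<zero>\<^bsub>Hom C (Sh C Z) (Sh C M)\<^esub>}. ?iso (Sh C Z) y}"
  proof (rule bij_betw_Collect[OF bij_betw_Shm_kernel[OF cl(1)]])
    fix y assume "y \<in> {y \<in> Mor C Z Z. y \<Zsemi> l = \<zero>\<^bsub>Hom C Z M\<^esub>}"
    then have y: "y \<in> Mor C Z Z" by simp
    show "?iso (Sh C Z) (Shm C y) \<longleftrightarrow> ?iso Z y"
      using is_iso_Shm_iff[of "Ident C Z \<oplus>\<^bsub>Hom C Z Z\<^esub> y" Z Z] y
      by (simp add: Shm_add[OF Id_closed y] Shm_Id Id_closed)
  qed
  then have "bij_betw (Shm C) {y \<in> {y \<in> Mor C Z Z. y \<Zsemi> l = \<zero>\<^bsub>Hom C Z M\<^esub>}. ?iso Z y} S"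
    unfolding Shm_kernel_image[OF T] S_def .
  then have "card {d \<in> Aut C Z. d \<Zsemi> l = l} = card S"
    unfolding card_stabilizer_left[OF cl(1)] by (simp add: bij_betw_same_card)
  moreover have "card {x \<in> Mor C (Sh C Z) L. x \<Zsemi> n \<in> S} = card S * ?k"
    by (rule card_hom_preimage[OF Hom.abelian_group_axioms Hom.abelian_group_axioms finite_Hom])
      (use cl in \<open>auto simp: comp_add_left S_def\<close>)
  \<comment> \<open>The swap turns \<open>1 + xn\<close> on \<open>Z[1]\<close> into
    \<open>1 + nx\<close> on \<open>L\<close>, so the number obtained for the other stabilizer
    appears again.\<close>
  moreover have "{x \<in> Mor C (Sh C Z) L. x \<Zsemi> n \<in> S} = {x \<in> Mor C (Sh C Z) L. ?iso L (n \<Zsemi> x)}"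
    using is_iso_one_plus_swap_iff[OF _ cl(2)] by (auto simp: S_def)
  moreover have "card (Mor C (Sh C Z) L) = card ?im * ?k"
    by (rule card_hom_image_kernel[OF Hom.abelian_group_axioms Hom.abelian_group_axioms finite_Hom])
      (use cl in \<open>auto simp: comp_add_left\<close>)
  moreover from this have "?k > 0" using card_Mor_pos[of "Sh C Z" L] by (simp add: card_gt_0_iff)
  ultimately show ?thesis using card_one_plus_diag_form[OF cl(2) D] by simp
qed

lemma card_Aut_pos: "card (Aut C X) > 0"
proof -
  have "Aut C X \<subseteq> Mor C X X" "Ident C X \<in> Aut C X" using is_iso_closed is_iso_Ident by (auto simp: Aut_iff)
  then show ?thesis using finite_Hom finite_subset by (metis card_gt_0_iff empty_iff)
qed

section \<open>Summation over orbits\<close>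

text \<open>The choice behind \<open>L_one\<close> belongs to some unspecified triple of the orbit.
  The orbit is therefore written as the class of that triple.\<close>

lemma L_one_representative:
  assumes "\<alpha> \<in> triangle_orbits C Z L M"
  obtains l m n where "Tri C Z M L l m n" "\<alpha> = triple_rel Z L M `` {(l, m, n)}"
    "diag_form C Z L n (L_one C Z L \<alpha>)"
proof -
  note eq = equiv_triple_rel[of Z L M]
  from assms obtain t where t: "t \<in> triangle_triples C Z L M" "\<alpha> = triple_rel Z L M `` {t}"
    by (auto simp: triangle_orbits_eq_quotient quotient_def)
  obtain l m n where lmn: "t = (l, m, n)" by (cases t)
  have "(l, m, n) \<in> \<alpha>" using equiv_class_self[OF eq t(1)] t(2) lmn by simp
  moreover have "\<exists>L1. diag_form C Z L n L1"
    using t(1) by (intro diag_form_exists) (simp add: lmn triangle_triples_def)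
  ultimately have "\<exists>L1. \<exists>(l, m, n)\<in>\<alpha>. diag_form C Z L n L1" by blast
  from someI_ex[OF this] obtain l' m' n' where t': "(l', m', n') \<in> \<alpha>" "diag_form C Z L n' (L_one C Z L \<alpha>)"
    unfolding L_one_def by blast
  have rel: "(t, (l', m', n')) \<in> triple_rel Z L M" using t'(1) t(2) by simp
  then have "\<alpha> = triple_rel Z L M `` {(l', m', n')}"
    using equiv_class_eq[OF eq] t(2) by simp
  moreover have "Tri C Z M L l' m' n'" using rel by (auto simp: triple_rel_def triangle_triples_iff)
  ultimately show ?thesis using that t'(2) by simp
qed

text \<open>Shared by both equalities, with \<open>f\<close> the projection to \<open>m\<close> or
  to \<open>l\<close>. The local identity \<open>orbit\<close> is assumed for every admissible
  \<open>L1\<close>, hence it covers whichever object \<open>L_one\<close> selects.\<close>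

lemma sum_triangle_orbits:
  fixes A B :: real
  assumes inj: "\<And>s t. s \<in> triangle_triples C Z L M \<Longrightarrow> t \<in> triangle_triples C Z L M \<Longrightarrow> f s = f t \<Longrightarrow>
      (s, t) \<in> triple_rel Z L M"
    and orbit: "\<And>l m n L1. Tri C Z M L l m n \<Longrightarrow> diag_form C Z L n L1 \<Longrightarrow>
      real (card (f ` (triple_rel Z L M `` {(l, m, n)}))) / A * B =
      real (card (Mor C L1 L1)) / real (card (Aut C L1))"
  shows "real (card (f ` triangle_triples C Z L M)) / A * B =
    (\<Sum>\<alpha>\<in>triangle_orbits C Z L M.
      real (card (Mor C (L_one C Z L \<alpha>) (L_one C Z L \<alpha>))) / real (card (Aut C (L_one C Z L \<alpha>))))"
proof -
  have "card (f ` triangle_triples C Z L M) = (\<Sum>\<alpha>\<in>triangle_orbits C Z L M. card (f ` \<alpha>))"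
    unfolding triangle_orbits_eq_quotient
    by (rule card_image_eq_sum_quotient[OF equiv_triple_rel finite_triangle_triples inj])
  then have "real (card (f ` triangle_triples C Z L M)) / A * B =
    (\<Sum>\<alpha>\<in>triangle_orbits C Z L M. real (card (f ` \<alpha>)) / A * B)"
    by (simp add: sum_divide_distrib sum_distrib_right)
  also have "\<dots> = (\<Sum>\<alpha>\<in>triangle_orbits C Z L M.
      real (card (Mor C (L_one C Z L \<alpha>) (L_one C Z L \<alpha>))) / real (card (Aut C (L_one C Z L \<alpha>))))"
  proof (rule sum.cong[OF refl])
    fix \<alpha> assume "\<alpha> \<in> triangle_orbits C Z L M"
    then obtain l m n where T: "Tri C Z M L l m n" and \<alpha>: "\<alpha> = triple_rel Z L M `` {(l, m, n)}"
      and D: "diag_form C Z L n (L_one C Z L \<alpha>)" by (rule L_one_representative)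
    show "real (card (f ` \<alpha>)) / A * B =
      real (card (Mor C (L_one C Z L \<alpha>) (L_one C Z L \<alpha>))) / real (card (Aut C (L_one C Z L \<alpha>)))"
      using orbit[OF T D] by (simp flip: \<alpha>)
  qed
  finally show ?thesis .
qed

theorem card_Mor_cone_middle:
  "real (card (Mor_cone C M L (Sh C Z))) / real (card (Aut C L)) *
      (brace C M L / (brace C Z L * brace C L L)) =
    (\<Sum>\<alpha>\<in>triangle_orbits C Z L M.
      real (card (Mor C (L_one C Z L \<alpha>) (L_one C Z L \<alpha>))) / real (card (Aut C (L_one C Z L \<alpha>))))"
  unfolding Mor_cone_eq_image_middle
proof (rule sum_triangle_orbits)
  fix l m n L1 assume T: "Tri C Z M L l m n" and D: "diag_form C Z L n L1"
  from Tri_closed[OF T] have m: "m \<in> Mor C M L" by simp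
  from T have t: "(l, m, n) \<in> triangle_triples C Z L M" by (simp add: triangle_triples_iff)
  \<comment> \<open>The factor of braces is the order of the image of \<open>Hom(Z[1],L)\<close> in
    \<open>End L\<close> under left composition with \<open>n\<close>, from the long exact sequence
    of Hom into \<open>L\<close>.\<close>
  show "real (card ((\<lambda>(l, m, n). m) ` (triple_rel Z L M `` {(l, m, n)}))) / real (card (Aut C L)) *
      (brace C M L / (brace C Z L * brace C L L)) = real (card (Mor C L1 L1)) / real (card (Aut C L1))"
    unfolding class_image_middle[OF t]
    by (rule orbit_stabilizer_ratio[OF card_orbit_middle[OF m] card_stabilizer_middle_diag_form[OF T D]
          card_image_contravariant[OF T] card_Aut_pos card_Aut_pos])
qed (use triple_rel_same_middle in auto)

theorem card_Mor_cone_left: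
  "real (card (Mor_cone C Z M L)) / real (card (Aut C Z)) *
      (brace C Z M / (brace C Z L * brace C Z Z)) =
    (\<Sum>\<alpha>\<in>triangle_orbits C Z L M.
      real (card (Mor C (L_one C Z L \<alpha>) (L_one C Z L \<alpha>))) / real (card (Aut C (L_one C Z L \<alpha>))))"
  unfolding Mor_cone_eq_image_left
proof (rule sum_triangle_orbits)
  fix l m n L1 assume T: "Tri C Z M L l m n" and D: "diag_form C Z L n L1"
  from Tri_closed[OF T] have l: "l \<in> Mor C Z M" by simp
  from T have t: "(l, m, n) \<in> triangle_triples C Z L M" by (simp add: triangle_triples_iff)
  \<comment> \<open>Here it is the order of the image of \<open>Hom(Z[1],L)\<close> in
    \<open>End(Z[1])\<close> under right composition with \<open>n\<close>, from Hom out of the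
    translates of \<open>Z\<close>.\<close>
  show "real (card ((\<lambda>(l, m, n). l) ` (triple_rel Z L M `` {(l, m, n)}))) / real (card (Aut C Z)) *
      (brace C Z M / (brace C Z L * brace C Z Z)) = real (card (Mor C L1 L1)) / real (card (Aut C L1))"
    unfolding class_image_left[OF t]
    by (rule orbit_stabilizer_ratio[OF card_orbit_left[OF l] card_stabilizer_left_diag_form[OF T D]
          card_image_covariant[OF T] card_Aut_pos card_Aut_pos])
qed (use triple_rel_same_left in auto)

end

theorem proposition2:
  fixes K :: "('k, 'r) ring_scheme"
    and C :: "('k, 'o, 'm, 'z) translation_category_scheme"
    and Z L M :: 'o
  assumes "field K" and "finite (carrier K)"
    and "triangulated_linear_category K C"
    and "\<And>X Y. vectorspace.fin_dim K (Hom C X Y)"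
    and "\<And>X. indecomposable C X \<Longrightarrow> local_ring (End_ring C X)"
    and "\<And>X Y. summable (\<lambda>i. real (vectorspace.dim K (Hom C ((Sh C ^^ i) X) Y)))"
  shows "(real (card (Mor_cone C M L (Sh C Z))) / real (card (Aut C L)) *
           (brace C M L / (brace C Z L * brace C L L))
         = (\<Sum>\<alpha>\<in>triangle_orbits C Z L M.
              real (card (Mor C (L_one C Z L \<alpha>) (L_one C Z L \<alpha>))) /
              real (card (Aut C (L_one C Z L \<alpha>)))))
    \<and> (real (card (Mor_cone C Z M L)) / real (card (Aut C Z)) *
           (brace C Z M / (brace C Z L * brace C Z Z))
         = (\<Sum>\<alpha>\<in>triangle_orbits C Z L M.
              real (card (Mor C (L_one C Z L \<alpha>) (L_one C Z L \<alpha>))) /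
              real (card (Aut C (L_one C Z L \<alpha>)))))"
proof -
  interpret triangulated_linear_category K C by fact
  have "finite (Mor C X Y)" for X Y
    by (rule vectorspace.finite_carrier[OF Hom_vectorspace assms(2,4)])
  moreover have "\<exists>N. \<forall>i\<ge>N. Mor C ((Sh C ^^ i) X) Y = {\<zero>\<^bsub>Hom C ((Sh C ^^ i) X) Y\<^esub>}" for X Y
    using summable_nat_eventually_zero[OF assms(6)] vectorspace.dim_0_carrier[OF Hom_vectorspace assms(4)]
    by meson
  ultimately interpret finite_triangulated_category K C
    using assms(5) by unfold_locales
  show ?thesis using card_Mor_cone_middle card_Mor_cone_left by blast
qed

end
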